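(* Let $H$ be a finitely presented cancellative hoop and let $u\in H$ be a unit. Let $\sharp(E_u\le t)$ denote the number of discrete extremal states of $(H,u)$ of denominator $\le t$. Then the limit $$l=\lim_{t\to\infty}\frac{\log\bigl(\sharp(E_u\le t)\bigr)}{\log t}$$ exists and is an integer not depending on $u$. Moreover $l=0$ iff $E_u$ is finite iff $\mathrm{MaxSpec}\,H$ has topological dimension $0$; otherwise $2\le l\le$ (the minimum cardinality of a generating set of $H$), and $\mathrm{MaxSpec}\,H$ has topological dimension $l-1$.
   Context: Cancellative hoop: algebra $(H,+,\dot-,0)$ with $(H,+,0)$ a commutative monoid and $x\dot-x=0$, $(x\dot-y)\dot-z=x\dot-(y+z)$, $x+(y\dot-x)=y+(x\dot-y)$, $(x+y)\dot-y=x$; order $x\le y$ iff $x\dot-y=0$. $\mathbb{R}_{\ge0}$ is a cancellative hoop with $x\dot-y=\max\{0,x-y\}$. Finitely presented: quotient of a finitely generated free cancellative hoop by finitely many equations. Unit: $u\in H$ such that every $h\in H$ satisfies $h\le ku$ for some integer $k\ge1$. $E_u$ is the set of hoop homomorphisms $e:H\to\mathbb{R}_{\ge0}$ with $e(u)=1$ (extremal states); $e$ is discrete if $e[H]=b^{-1}\mathbb{Z}_{\ge0}$ for some (unique) integer $b\ge1$, its denominator. $\mathrm{MaxSpec}\,H$ is the set of kernels of nonzero hoop homomorphisms $H\to\mathbb{R}_{\ge0}$ (maximal ideals), with the hull-kernel topology generated by the sets $\{\mathfrak m:h\notin\mathfrak m\}$, $h\in H$. Topological dimension is the usual (small inductive)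 dimension. *)

theory Defs
  imports "HOL-Analysis.Analysis" "HOL-Algebra.Coset"
begin

text \<open>
  The additive monoid of a hoop is a library monoid, so the sum and the zero element appear as
  \<open>\<otimes>\<close> and \<open>\<one>\<close>, and the multiple \<open>k u\<close> appears as \<open>u [^] k\<close>.
\<close>

record 'a hoop = "'a monoid" +
  monus :: "'a \<Rightarrow> 'a \<Rightarrow> 'a" (infixl \<open>\<setminus>\<index>\<close> 65)

locale cancellative_hoop = comm_monoid H for H (structure) +
  assumes monus_closed: "\<lbrakk>x \<in> carrier H; y \<in> carrier H\<rbrakk> \<Longrightarrow> x \<setminus> y \<in> carrier H"
    and monus_self: "x \<in> carrier H \<Longrightarrow> x \<setminus> x = \<one>"
    and monus_monus: "\<lbrakk>x \<in> carrier H; y \<in> carrier H; z \<in> carrier H\<rbrakk>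
      \<Longrightarrow> (x \<setminus> y) \<setminus> z = x \<setminus> (y \<otimes> z)"
    and add_monus_swap: "\<lbrakk>x \<in> carrier H; y \<in> carrier H\<rbrakk>
      \<Longrightarrow> x \<otimes> (y \<setminus> x) = y \<otimes> (x \<setminus> y)"
    and add_monus_cancel: "\<lbrakk>x \<in> carrier H; y \<in> carrier H\<rbrakk> \<Longrightarrow> (x \<otimes> y) \<setminus> y = x"

definition hoop_le :: "('a, 'm) hoop_scheme \<Rightarrow> 'a \<Rightarrow> 'a \<Rightarrow> bool" where
  "hoop_le H x y \<longleftrightarrow> x \<setminus>\<^bsub>H\<^esub> y = \<one>\<^bsub>H\<^esub>"

definition nonneg_real_hoop :: "real hoop" where
  "nonneg_real_hoop =
     \<lparr>carrier = {0..}, mult = (+), one = 0, monus = (\<lambda>x y. max 0 (x - y))\<rparr>"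

lemma cancellative_hoop_nonneg_real: "cancellative_hoop nonneg_real_hoop"
  by unfold_locales (simp_all add: nonneg_real_hoop_def max_def)

definition hoop_hom ::
    "('a, 'm) hoop_scheme \<Rightarrow> ('b, 'n) hoop_scheme \<Rightarrow> ('a \<Rightarrow> 'b) set" where
  "hoop_hom H K = {f \<in> hom H K. f \<one>\<^bsub>H\<^esub> = \<one>\<^bsub>K\<^esub> \<and>
     (\<forall>x \<in> carrier H. \<forall>y \<in> carrier H. f (x \<setminus>\<^bsub>H\<^esub> y) = f x \<setminus>\<^bsub>K\<^esub> f y)}"

definition hoop_isomorphic ::
    "('a, 'm) hoop_scheme \<Rightarrow> ('b, 'n) hoop_scheme \<Rightarrow> bool" where
  "hoop_isomorphic H K \<longleftrightarrow> (\<exists>f \<in> hoop_hom H K. bij_betw f (carrier H) (carrier K))"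


section \<open>Quotients, free hoops and finite presentations\<close>

text \<open>
  Congruences and quotients only use the signature, not the hoop axioms, so that they also apply
  to the term algebra.
\<close>

definition hoop_congruence :: "('a, 'm) hoop_scheme \<Rightarrow> ('a \<times> 'a) set \<Rightarrow> bool" where
  "hoop_congruence H \<theta> \<longleftrightarrow> equiv (carrier H) \<theta> \<and>
     (\<forall>x x' y y'. (x, x') \<in> \<theta> \<longrightarrow> (y, y') \<in> \<theta> \<longrightarrow>
        (x \<otimes>\<^bsub>H\<^esub> y, x' \<otimes>\<^bsub>H\<^esub> y') \<in> \<theta> \<and> (x \<setminus>\<^bsub>H\<^esub> y, x' \<setminus>\<^bsub>H\<^esub> y') \<in> \<theta>)"

definition hoop_quotient ::
    "('a, 'm) hoop_scheme \<Rightarrow> ('a \<times> 'a) set \<Rightarrow> 'a set hoop" where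
  "hoop_quotient H \<theta> =
     \<lparr>carrier = carrier H // \<theta>,
      mult = (\<lambda>A B. \<Union>a\<in>A. \<Union>b\<in>B. \<theta> `` {a \<otimes>\<^bsub>H\<^esub> b}),
      one = \<theta> `` {\<one>\<^bsub>H\<^esub>},
      monus = (\<lambda>A B. \<Union>a\<in>A. \<Union>b\<in>B. \<theta> `` {a \<setminus>\<^bsub>H\<^esub> b})\<rparr>"

definition generated_congruence ::
    "('a, 'm) hoop_scheme \<Rightarrow> ('a \<times> 'a) set \<Rightarrow> ('a \<times> 'a) set" where
  "generated_congruence H R = \<Inter>{\<theta>. hoop_congruence H \<theta> \<and> R \<subseteq> \<theta>}"

datatype hoop_term =
  HVar nat | HZero | HPlus hoop_term hoop_term | HMonus hoop_term hoop_term

primrec term_vars :: "hoop_term \<Rightarrow> nat set" where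
  "term_vars (HVar i) = {i}"
| "term_vars HZero = {}"
| "term_vars (HPlus s t) = term_vars s \<union> term_vars t"
| "term_vars (HMonus s t) = term_vars s \<union> term_vars t"

definition term_algebra :: "nat \<Rightarrow> hoop_term hoop" where
  "term_algebra n =
     \<lparr>carrier = {t. term_vars t \<subseteq> {..<n}}, mult = HPlus, one = HZero, monus = HMonus\<rparr>"

text \<open>
  As in any equational class, the free cancellative hoop on \<open>n\<close> generators is the term algebra
  modulo the least congruence whose quotient is a cancellative hoop.
\<close>

definition free_hoop :: "nat \<Rightarrow> hoop_term set hoop" where
  "free_hoop n = hoop_quotient (term_algebra n)
     (\<Inter>{\<theta>. hoop_congruence (term_algebra n) \<theta> \<and>
             cancellative_hoop (hoop_quotient (term_algebra n) \<theta>)})"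

definition finitely_presented :: "('a, 'm) hoop_scheme \<Rightarrow> bool" where
  "finitely_presented H \<longleftrightarrow>
     (\<exists>n R. finite R \<and> R \<subseteq> carrier (free_hoop n) \<times> carrier (free_hoop n) \<and>
        hoop_isomorphic H
          (hoop_quotient (free_hoop n) (generated_congruence (free_hoop n) R)))"


section \<open>Generating sets\<close>

definition subhoop :: "('a, 'm) hoop_scheme \<Rightarrow> 'a set \<Rightarrow> bool" where
  "subhoop H T \<longleftrightarrow> T \<subseteq> carrier H \<and> \<one>\<^bsub>H\<^esub> \<in> T \<and>
     (\<forall>x \<in> T. \<forall>y \<in> T. x \<otimes>\<^bsub>H\<^esub> y \<in> T \<and> x \<setminus>\<^bsub>H\<^esub> y \<in> T)"

definition generates :: "('a, 'm) hoop_scheme \<Rightarrow> 'a set \<Rightarrow> bool" where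
  "generates H S \<longleftrightarrow> S \<subseteq> carrier H \<and> \<Inter>{T. subhoop H T \<and> S \<subseteq> T} = carrier H"

text \<open>Only meaningful for finitely generated \<open>H\<close>.\<close>

definition min_generators :: "('a, 'm) hoop_scheme \<Rightarrow> nat" where
  "min_generators H = (LEAST k. \<exists>S. finite S \<and> card S = k \<and> generates H S)"


section \<open>Units and extremal states\<close>

definition hoop_unit :: "('a, 'm) hoop_scheme \<Rightarrow> 'a \<Rightarrow> bool" where
  "hoop_unit H u \<longleftrightarrow> u \<in> carrier H \<and>
     (\<forall>h \<in> carrier H. \<exists>k::nat. 1 \<le> k \<and> hoop_le H h (u [^]\<^bsub>H\<^esub> k))"

text \<open>
  Homomorphisms are only determined on the carrier; restricting to extensional functions makes
  each state a single HOL function, so that finiteness and cardinality count states.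
\<close>

definition extremal_states :: "('a, 'm) hoop_scheme \<Rightarrow> 'a \<Rightarrow> ('a \<Rightarrow> real) set" where
  "extremal_states H u =
     {e \<in> hoop_hom H nonneg_real_hoop. e \<in> extensional (carrier H) \<and> e u = 1}"

definition has_denominator :: "('a, 'm) hoop_scheme \<Rightarrow> ('a \<Rightarrow> real) \<Rightarrow> nat \<Rightarrow> bool" where
  "has_denominator H e b \<longleftrightarrow> 1 \<le> b \<and> e ` carrier H = range (\<lambda>k::nat. real k / real b)"

definition discrete_state :: "('a, 'm) hoop_scheme \<Rightarrow> ('a \<Rightarrow> real) \<Rightarrow> bool" where
  "discrete_state H e \<longleftrightarrow> (\<exists>b. has_denominator H e b)"

definition denominator :: "('a, 'm) hoop_scheme \<Rightarrow> ('a \<Rightarrow> real) \<Rightarrow> nat" where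
  "denominator H e = (THE b. has_denominator H e b)"

definition discrete_states_upto ::
    "('a, 'm) hoop_scheme \<Rightarrow> 'a \<Rightarrow> real \<Rightarrow> ('a \<Rightarrow> real) set" where
  "discrete_states_upto H u t =
     {e \<in> extremal_states H u. discrete_state H e \<and> real (denominator H e) \<le> t}"


section \<open>The maximal spectrum and its dimension\<close>

definition max_spec :: "('a, 'm) hoop_scheme \<Rightarrow> 'a set set" where
  "max_spec H = {kernel H nonneg_real_hoop e | e.
     e \<in> hoop_hom H nonneg_real_hoop \<and> (\<exists>x \<in> carrier H. e x \<noteq> 0)}"

definition max_spec_topology :: "('a, 'm) hoop_scheme \<Rightarrow> 'a set topology" where
  "max_spec_topology H = topology_generated_by {{m \<in> max_spec H. h \<notin> m} | h. h \<in> carrier H}"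

lemma topspace_max_spec_topology: "topspace (max_spec_topology H) = max_spec H"
proof -
  have "\<exists>h \<in> carrier H. h \<notin> m" if "m \<in> max_spec H" for m
    using that by (auto simp: max_spec_def kernel_def nonneg_real_hoop_def)
  then show ?thesis
    unfolding max_spec_topology_def topology_generated_by_topspace by blast
qed

text \<open>\<open>dim_le\<close> is the library's small inductive dimension bound, with value \<open>-1\<close> for the empty space.\<close>

definition has_dimension :: "'a topology \<Rightarrow> int \<Rightarrow> bool" where
  "has_dimension X d \<longleftrightarrow> X dim_le d \<and> \<not> X dim_le (d - 1)"

end

(* Presenting H by n generators and a finite set of relations between terms identifies the
   homomorphisms from H to the nonnegative reals with the points of the cone C of all x >= 0 in R^n
   that satisfy the relations. Splitting by the signs of the linear forms that occur in the terms
   writes C as a finite union of relatively open rational polyhedral cones; let m be their largest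
   dimension. The points of C of coordinate sum 1 form a compact set B homeomorphic to MaxSpec H.
   It is covered by finitely many affine sets of dimension m - 1 and contains a copy of the simplex of
   that dimension, so dim B = m - 1; the lower bound is Lebesgue's covering theorem, by way of
   Brouwer's fixed point theorem. Clearing denominators turns the discrete states of denominator at
   most t into the primitive integer points of C on which u takes a value at most t. Their number
   is of order t^m if m >= 2 and bounded if m = 1, so l = m or l = 0. Mapping such a point to its values
   at k generators of H is injective into a cube of side O(t), whence m <= k. That C contains a nonzero
   point at all is Hoelder's theorem, applied modulo an ideal that is maximal among those avoiding u. *)
theory Submission
  imports Defs
begin

section \<open>Small inductive dimension of finite unions of affine sets\<close>

text \<open>The value l = 1 is skipped for an arithmetical reason: a ray through an integer point
  carries a single primitive point, whereas for m >= 2 the points with a common factor are thinned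
  out by the convergent sum of 1 / k^m, and a positive proportion stays primitive. Independence of u
  comes from the order of choices: m is read off the cone before any unit is named. Small inductive
  dimension is awkward for unions, so the upper bound is proved at once for all subsets of a finite
  union of affine sets, by boxes whose faces avoid finitely many bad positions. For the lower bound,
  dimension is traded for the multiplicity of open covers, which it bounds on compact sets and which
  a partition of unity can test against a fixed point theorem. All points live in
  \<open>nat \<Rightarrow> real\<close>, because n and m are numbers found in the course of the
  proof and cannot be types. For the same reason Brouwer's theorem is derived from Kuhn's
  combinatorial lemma.\<close>

definition rank_le :: "nat \<Rightarrow> (nat \<Rightarrow> real) set \<Rightarrow> bool" where
  "rank_le k A \<longleftrightarrow> (\<exists>J c s. finite J \<and> card J \<le> k \<and>
     (\<forall>x\<in>A. \<forall>i. x i = c i + (\<Sum>j\<in>J. s i j * x j)))"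

text \<open>\<open>rank_le\<close> stands for affine dimension, with coordinates of the point itself
  as parameters, so that cutting by a hyperplane is one step of Gaussian elimination: the equation
  is solved for the coordinate \<open>j0\<close> and substituted everywhere. The bound
  \<open>1 \<le> k\<close> keeps \<open>k - 1\<close> from truncating.\<close>

lemma rank_le_affine_slice:
  fixes c b :: "nat \<Rightarrow> real"
  assumes J: "finite J" "card J \<le> k"
    and x: "\<And>x i. x \<in> A \<Longrightarrow> x i = c i + (\<Sum>j\<in>J. s i j * x j)"
    and b: "\<And>x. x \<in> A \<Longrightarrow> (\<Sum>j\<in>J. b j * x j) = r"
    and j0: "j0 \<in> J" "b j0 \<noteq> 0"
  shows "1 \<le> k" "rank_le (k - 1) A"
proof -
  have "card J \<noteq> 0"
    using j0 J by auto
  then show "1 \<le> k" using J(2) by linarith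
  have elim: "x j0 = r / b j0 - (\<Sum>j\<in>J - {j0}. b j / b j0 * x j)" if "x \<in> A" for x
  proof -
    have "b j0 * x j0 + (\<Sum>j\<in>J - {j0}. b j * x j) = r"
      using b[OF that] sum.remove[OF J(1) j0(1), of "\<lambda>j. b j * x j"] by simp
    moreover have "(\<Sum>j\<in>J - {j0}. b j / b j0 * x j) = (\<Sum>j\<in>J - {j0}. b j * x j) / b j0"
      by (simp add: sum_divide_distrib)
    ultimately show ?thesis
      using j0(2) by (simp add: field_simps)
  qed
  have "x i = (c i + s i j0 * (r / b j0)) + (\<Sum>j\<in>J - {j0}. (s i j - s i j0 * (b j / b j0)) * x j)"
    if "x \<in> A" for x i
  proof -
    have "x i = c i + s i j0 * x j0 + (\<Sum>j\<in>J - {j0}. s i j * x j)"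
      using x[OF that, of i] sum.remove[OF J(1) j0(1), of "\<lambda>j. s i j * x j"] by simp
    then show ?thesis
      by (simp add: elim[OF that] algebra_simps sum_subtractf sum_distrib_left)
  qed
  moreover have "card (J - {j0}) \<le> k - 1"
    using J j0 by simp
  ultimately show "rank_le (k - 1) A"
    unfolding rank_le_def using J(1)
    by (intro exI[of _ "J - {j0}"] exI[of _ "\<lambda>i. c i + s i j0 * (r / b j0)"]
        exI[of _ "\<lambda>i j. s i j - s i j0 * (b j / b j0)"]) auto
qed

text \<open>Each coordinate has a single bad level, its constant term \<open>c i\<close>: only there
  can the equation \<open>x i = r\<close> hold on all of \<open>A\<close> for want of a linear part.
  At any other level the equation is either contradictory or removes a parameter.\<close>

lemma rank_le_generic_slice:
  assumes "rank_le k A"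
  shows "\<exists>c. \<forall>i r. r \<noteq> c i \<longrightarrow> A \<inter> {x. x i = r} = {} \<or> 1 \<le> k \<and> rank_le (k - 1) (A \<inter> {x. x i = r})"
proof -
  obtain J c s where J: "finite J" "card J \<le> k"
    and x: "\<And>x i. x \<in> A \<Longrightarrow> x i = c i + (\<Sum>j\<in>J. s i j * x j)"
    using assms unfolding rank_le_def by blast
  have "A \<inter> {x. x i = r} = {} \<or> 1 \<le> k \<and> rank_le (k - 1) (A \<inter> {x. x i = r})"
    if "r \<noteq> c i" for i r
  proof (cases "\<forall>j\<in>J. s i j = 0")
    case True
    then have "x i = c i" if "x \<in> A" for x
      using x[OF that, of i] by simp
    with \<open>r \<noteq> c i\<close> show ?thesis by auto
  next
    case False
    then obtain j0 where j0: "j0 \<in> J" "s i j0 \<noteq> 0" by blast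
    have "(\<Sum>j\<in>J. s i j * x j) = r - c i" if "x \<in> A \<inter> {x. x i = r}" for x
      using x[of x i] that by auto
    then show ?thesis
      using rank_le_affine_slice[where A = "A \<inter> {x. x i = r}" and b = "s i" and s = s and c = c and r = "r - c i" and J = J and k = k and ?j0.0 = j0]
        J j0 x by simp
  qed
  then show ?thesis by (intro exI[of _ c]) simp
qed

lemma open_fun_contains_box:
  fixes W :: "(nat \<Rightarrow> real) set"
  assumes "open W" "a \<in> W"
  obtains I e where "finite I" "0 < e" "{y. \<forall>i\<in>I. \<bar>y i - a i\<bar> < e} \<subseteq> W"
proof -
  have "\<exists>U. finite {i. U i \<noteq> UNIV} \<and> (\<forall>i. open (U i)) \<and> a \<in> Pi\<^sub>E UNIV U \<and> Pi\<^sub>E UNIV U \<subseteq> W"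
    using assms unfolding open_fun_def openin_product_topology_alt by simp
  then obtain U where U: "finite {i. U i \<noteq> UNIV}" "\<And>i. open (U i)" "\<And>i. a i \<in> U i"
      "Pi\<^sub>E UNIV U \<subseteq> W"
    by (auto simp: PiE_iff)
  define I where "I = {i. U i \<noteq> UNIV}"
  have "\<exists>e>0. \<forall>y. \<bar>y - a i\<bar> < e \<longrightarrow> y \<in> U i" for i
    using U(2,3)[of i] by (metis open_dist dist_real_def)
  then obtain e where e: "\<And>i. 0 < e i" "\<And>i y. \<bar>y - a i\<bar> < e i \<Longrightarrow> y \<in> U i"
    by metis
  define d where "d = Min (insert 1 (e ` I))"
  have "finite I" using U(1) by (simp add: I_def)
  then have d: "0 < d" "\<And>i. i \<in> I \<Longrightarrow> d \<le> e i"
    using e(1) by (auto simp: d_def)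
  have "y \<in> W" if "\<forall>i\<in>I. \<bar>y i - a i\<bar> < d" for y
  proof -
    have "y i \<in> U i" for i
      by (cases "i \<in> I") (use that d(2) e(2) in \<open>force simp: I_def\<close>)+
    then show ?thesis using U(4) by (auto simp: PiE_iff)
  qed
  with \<open>finite I\<close> d(1) show ?thesis by (intro that[of I d]) auto
qed

lemma exists_avoiding:
  fixes l u :: real
  assumes "l < u" "finite C"
  shows "\<exists>r. l < r \<and> r < u \<and> r \<notin> C"
  using assms infinite_Ioo[of l u] by (metis finite_subset greaterThanLessThan_iff subsetI)

text \<open>A face \<open>x i = r\<close> of a box cuts every one of the affine sets in smaller rank unless \<open>r\<close> is one of
  finitely many exceptional values.\<close>

lemma rank_le_small_box:
  assumes "finite F" "\<And>A. A \<in> F \<Longrightarrow> rank_le k A" "X \<subseteq> \<Union>F" "open W" "a \<in> W"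
  shows "\<exists>U G. a \<in> U \<and> U \<subseteq> W \<and> open U \<and> top_of_set X frontier_of (X \<inter> U) \<subseteq> \<Union>G \<and>
    finite G \<and> (\<forall>B\<in>G. 1 \<le> k \<and> rank_le (k - 1) B)"
proof -
  obtain I e where I: "finite I" "0 < e" "{y. \<forall>i\<in>I. \<bar>y i - a i\<bar> < e} \<subseteq> W"
    using open_fun_contains_box assms(4,5) by blast
  obtain c where c: "\<And>A i r. A \<in> F \<Longrightarrow> r \<noteq> c A i \<Longrightarrow>
      A \<inter> {x. x i = r} = {} \<or> 1 \<le> k \<and> rank_le (k - 1) (A \<inter> {x. x i = r})"
    using rank_le_generic_slice assms(2) by metis
  have "\<exists>r. a i - e < r \<and> r < a i \<and> r \<notin> (\<lambda>A. c A i) ` F" for i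
    by (rule exists_avoiding) (use I assms in auto)
  then obtain l where l: "\<And>i. a i - e < l i" "\<And>i. l i < a i" "\<And>A i. A \<in> F \<Longrightarrow> l i \<noteq> c A i"
    by (metis imageI)
  have "\<exists>r. a i < r \<and> r < a i + e \<and> r \<notin> (\<lambda>A. c A i) ` F" for i
    by (rule exists_avoiding) (use I assms in auto)
  then obtain u where u: "\<And>i. a i < u i" "\<And>i. u i < a i + e" "\<And>A i. A \<in> F \<Longrightarrow> u i \<noteq> c A i"
    by (metis imageI)
  define U where "U = (\<Inter>i\<in>I. {y. l i < y i} \<inter> {y. y i < u i})"
  define K where "K = (\<Inter>i\<in>I. {y. l i \<le> y i} \<inter> {y. y i \<le> u i})"
  \<comment> \<open>Empty slices are discarded because only a nonempty one forces
    \<open>1 \<le> k\<close>; for \<open>k = 0\<close> nothing is left, and the frontier is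
    empty.\<close>
  define G where "G = (\<lambda>(A, i, r). A \<inter> {x. x i = r}) ` (SIGMA A:F. SIGMA i:I. {l i, u i}) - {{}}"
  have coord: "continuous_on UNIV (\<lambda>y::nat \<Rightarrow> real. y i)" for i
    by simp
  have "open U"
    unfolding U_def by (intro open_INT I ballI open_Int open_Collect_less coord continuous_intros)
  have "closed K"
    unfolding K_def by (intro closed_INT ballI closed_Int closed_Collect_le coord continuous_intros)
  have "a \<in> U" using l u by (simp add: U_def)
  have "U \<subseteq> W"
  proof
    fix y assume "y \<in> U"
    then have "\<bar>y i - a i\<bar> < e" if "i \<in> I" for i
      using that l(1)[of i] u(2)[of i] by (force simp: U_def)
    then show "y \<in> W" using I(3) by blast
  qed
  have "top_of_set X frontier_of (X \<inter> U) \<subseteq> X \<inter> K - U"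
  proof -
    have "top_of_set X closure_of (X \<inter> U) \<subseteq> X \<inter> K"
      using \<open>closed K\<close> by (intro closure_of_minimal) (auto simp: U_def K_def closedin_closed_Int intro: less_imp_le)
    moreover have "top_of_set X interior_of (X \<inter> U) = X \<inter> U"
      using \<open>open U\<close> by (simp add: interior_of_eq openin_open_Int)
    ultimately show ?thesis by (auto simp: frontier_of_def)
  qed
  also have "\<dots> \<subseteq> \<Union>G"
  proof
    fix x assume x: "x \<in> X \<inter> K - U"
    then obtain i where i: "i \<in> I" "\<not> (l i < x i \<and> x i < u i)"
      by (auto simp: U_def)
    moreover have "l i \<le> x i" "x i \<le> u i"
      using x i by (auto simp: K_def)
    ultimately have "i \<in> I" "x i = l i \<or> x i = u i"
      by linarith+
    moreover obtain A where "A \<in> F" "x \<in> A" using x assms(3) by blast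
    ultimately show "x \<in> \<Union>G"
    proof (intro UnionI[of "A \<inter> {y. y i = x i}"])
      have "(A, i, x i) \<in> (SIGMA A:F. SIGMA i:I. {l i, u i})"
        using \<open>A \<in> F\<close> \<open>i \<in> I\<close> \<open>x i = l i \<or> x i = u i\<close> by auto
      then have "A \<inter> {y. y i = x i} \<in> (\<lambda>(A, i, r). A \<inter> {x. x i = r}) ` (SIGMA A:F. SIGMA i:I. {l i, u i})"
        by (rule rev_image_eqI) simp
      then show "A \<inter> {y. y i = x i} \<in> G"
        using \<open>x \<in> A\<close> unfolding G_def Diff_iff by (metis (mono_tags, lifting) IntI mem_Collect_eq empty_iff singletonD)
    qed (use \<open>x \<in> A\<close> in simp)
  qed
  finally have "top_of_set X frontier_of (X \<inter> U) \<subseteq> \<Union>G" .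
  moreover have "finite G"
    using assms(1) I(1) by (simp add: G_def)
  moreover have "\<forall>B\<in>G. 1 \<le> k \<and> rank_le (k - 1) B"
  proof
    fix B assume "B \<in> G"
    then have "B \<noteq> {}" "B \<in> (\<lambda>(A, i, r). A \<inter> {x. x i = r}) ` (SIGMA A:F. SIGMA i:I. {l i, u i})"
      unfolding G_def by blast+
    then obtain z where "z \<in> (SIGMA A:F. SIGMA i:I. {l i, u i})" "B = (\<lambda>(A, i, r). A \<inter> {x. x i = r}) z"
      by (elim imageE)
    then obtain A i r where "A \<in> F" "r = l i \<or> r = u i" "B = A \<inter> {x. x i = r}"
      by (cases z) fastforce
    then show "1 \<le> k \<and> rank_le (k - 1) B"
      using c[of A r i] l(3)[of A i] u(3)[of A i] \<open>B \<noteq> {}\<close> by blast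
  qed
  ultimately show ?thesis
    using \<open>a \<in> U\<close> \<open>U \<subseteq> W\<close> \<open>open U\<close> by (intro exI[of _ U] exI[of _ G] conjI)
qed

text \<open>Every point has arbitrarily small box neighbourhoods whose frontiers lie in finitely
  many sets of rank \<open>k - 1\<close>. Since a frontier is only known to be covered by such sets,
  the induction runs over arbitrary subsets \<open>X\<close> of the union.\<close>

lemma dim_le_finite_Union_rank_le:
  assumes "finite F" "\<And>A. A \<in> F \<Longrightarrow> rank_le k A" "X \<subseteq> \<Union>F"
  shows "top_of_set X dim_le int k"
  using assms
proof (induction k arbitrary: F X)
  case (0 F X)
  show ?case
  proof (intro dimension_le_eq_subtopology[THEN iffD2] conjI allI impI)
    fix W a assume "openin euclidean W \<and> a \<in> W \<and> a \<in> X"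
    then obtain U G where "a \<in> U" "U \<subseteq> W" "open U" "top_of_set X frontier_of (X \<inter> U) \<subseteq> \<Union>G"
        "\<forall>B\<in>G. False"
      using rank_le_small_box[of F 0 X W a] 0 by auto
    then show "\<exists>U. a \<in> U \<and> U \<subseteq> W \<and> openin euclidean U \<and>
        top_of_set (top_of_set X frontier_of (X \<inter> U)) dim_le int 0 - 1"
      by (intro exI[of _ U]) auto
  qed simp
next
  case (Suc k F X)
  show ?case
  proof (intro dimension_le_eq_subtopology[THEN iffD2] conjI allI impI)
    fix W a assume "openin euclidean W \<and> a \<in> W \<and> a \<in> X"
    then obtain U G where "a \<in> U" "U \<subseteq> W" "open U" "top_of_set X frontier_of (X \<inter> U) \<subseteq> \<Union>G"
        "finite G" "\<forall>B\<in>G. rank_le k B"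
      using rank_le_small_box[of F "Suc k" X W a] Suc.prems by auto
    then show "\<exists>U. a \<in> U \<and> U \<subseteq> W \<and> openin euclidean U \<and>
        top_of_set (top_of_set X frontier_of (X \<inter> U)) dim_le int (Suc k) - 1"
      using Suc.IH[of G] by (intro exI[of _ U]) auto
  qed simp
qed

section \<open>Multiplicity of covers and small inductive dimension\<close>

text \<open>The bound \<open>n\<close> on the multiplicity corresponds to covering dimension at most \<open>n - 1\<close>.\<close>

definition ord_cover :: "nat \<Rightarrow> 'a::metric_space set \<Rightarrow> bool" where
  "ord_cover n X \<longleftrightarrow> (\<forall>(I::nat set) U. finite I \<and> (\<forall>i\<in>I. open (U i)) \<and> X \<subseteq> (\<Union>i\<in>I. U i) \<longrightarrow>
     (\<exists>W. (\<forall>i\<in>I. open (W i) \<and> W i \<subseteq> U i) \<and> X \<subseteq> (\<Union>i\<in>I. W i) \<and>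
        (\<forall>x\<in>X. card {i\<in>I. x \<in> W i} \<le> n)))"

lemma ord_coverD:
  fixes I :: "nat set"
  assumes "ord_cover n X" "finite I" "\<And>i. i \<in> I \<Longrightarrow> open (U i)" "X \<subseteq> (\<Union>i\<in>I. U i)"
  obtains W where "\<And>i. i \<in> I \<Longrightarrow> open (W i)" "\<And>i. i \<in> I \<Longrightarrow> W i \<subseteq> U i"
    "X \<subseteq> (\<Union>i\<in>I. W i)" "\<And>x. x \<in> X \<Longrightarrow> card {i\<in>I. x \<in> W i} \<le> n"
proof -
  have "\<exists>W. (\<forall>i\<in>I. open (W i) \<and> W i \<subseteq> U i) \<and> X \<subseteq> (\<Union>i\<in>I. W i) \<and> (\<forall>x\<in>X. card {i\<in>I. x \<in> W i} \<le> n)"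
    using assms unfolding ord_cover_def by simp
  with that show ?thesis by blast
qed

lemma ord_cover_empty: "ord_cover n {}"
  unfolding ord_cover_def by blast

text \<open>Off \<open>B\<close> the refinement for \<open>A\<close> is left alone, so its multiplicity on \<open>A - B\<close> survives the
  refinement for \<open>B\<close>.\<close>

lemma ord_cover_Un:
  assumes "closed A" "closed B" "ord_cover n A" "ord_cover n B"
  shows "ord_cover n (A \<union> B)"
  unfolding ord_cover_def
proof (intro allI impI, elim conjE)
  fix I :: "nat set" and U
  assume I: "finite I" and U: "\<forall>i\<in>I. open (U i)" and cov: "A \<union> B \<subseteq> (\<Union>i\<in>I. U i)"
  obtain W where W: "\<And>i. i \<in> I \<Longrightarrow> open (W i)" "\<And>i. i \<in> I \<Longrightarrow> W i \<subseteq> U i"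
      "A \<subseteq> (\<Union>i\<in>I. W i)" "\<And>x. x \<in> A \<Longrightarrow> card {i\<in>I. x \<in> W i} \<le> n"
    by (rule ord_coverD[OF assms(3) I, of U]) (use U cov in auto)
  define U' where "U' i = W i \<union> (U i - A)" for i
  have U': "open (U' i)" "U' i \<subseteq> U i" if "i \<in> I" for i
    using U W(1,2)[OF that] assms(1) that unfolding U'_def by (auto intro!: open_Un open_Diff)
  have cov': "A \<union> B \<subseteq> (\<Union>i\<in>I. U' i)"
    using W(3) cov unfolding U'_def by blast
  obtain W' where W': "\<And>i. i \<in> I \<Longrightarrow> open (W' i)" "\<And>i. i \<in> I \<Longrightarrow> W' i \<subseteq> U' i"
      "B \<subseteq> (\<Union>i\<in>I. W' i)" "\<And>x. x \<in> B \<Longrightarrow> card {i\<in>I. x \<in> W' i} \<le> n"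
    by (rule ord_coverD[OF assms(4) I, of U']) (use U' cov' in auto)
  define Z where "Z i = W' i \<union> (U' i - B)" for i
  have "card {i\<in>I. x \<in> Z i} \<le> n" if x: "x \<in> A \<union> B" for x
  proof (cases "x \<in> B")
    case True
    then have "{i\<in>I. x \<in> Z i} = {i\<in>I. x \<in> W' i}" by (auto simp: Z_def)
    with W'(4)[OF True] show ?thesis by simp
  next
    case False
    then have "x \<in> A" using x by simp
    then have "{i\<in>I. x \<in> Z i} \<subseteq> {i\<in>I. x \<in> W i}"
      using False W'(2) by (auto simp: Z_def U'_def)
    then have "card {i\<in>I. x \<in> Z i} \<le> card {i\<in>I. x \<in> W i}"
      using I by (intro card_mono) auto
    with W(4)[OF \<open>x \<in> A\<close>] show ?thesis by simp
  qed
  moreover have "open (Z i) \<and> Z i \<subseteq> U i" if "i \<in> I" for i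
    using U'[OF that] W'(1,2)[OF that] assms(2) unfolding Z_def by (auto intro!: open_Un open_Diff)
  moreover have "A \<union> B \<subseteq> (\<Union>i\<in>I. Z i)"
    using W'(3) cov' unfolding Z_def by blast
  ultimately show "\<exists>W. (\<forall>i\<in>I. open (W i) \<and> W i \<subseteq> U i) \<and> A \<union> B \<subseteq> (\<Union>i\<in>I. W i) \<and>
      (\<forall>x\<in>A \<union> B. card {i\<in>I. x \<in> W i} \<le> n)"
    by blast
qed

lemma ord_cover_finite_Union:
  assumes "finite F" "\<And>A. A \<in> F \<Longrightarrow> closed A" "\<And>A. A \<in> F \<Longrightarrow> ord_cover n A"
  shows "ord_cover n (\<Union>F)"
  using assms
proof (induction F rule: finite_induct)
  case (insert A F)
  then show ?case
    using ord_cover_Un[of A "\<Union>F" n] by (simp add: closed_Union)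
qed (simp add: ord_cover_empty)

text \<open>A finite subcover by balls whose closed balls stay inside members of the cover, grouped
  by member. The closures are what makes the set of points of high multiplicity closed in the next
  theorem.\<close>

lemma compact_open_cover_shrink:
  fixes F :: "'a::metric_space set"
  assumes "compact F" "finite I" "\<And>i. i \<in> I \<Longrightarrow> open (W i)" "F \<subseteq> (\<Union>i\<in>I. W i)"
  obtains W' where "\<And>i. i \<in> I \<Longrightarrow> open (W' i)" "\<And>i. i \<in> I \<Longrightarrow> closure (W' i) \<subseteq> W i"
    "F \<subseteq> (\<Union>i\<in>I. W' i)"
proof -
  have "\<forall>x\<in>F. \<exists>p. fst p \<in> I \<and> 0 < snd p \<and> cball x (snd p) \<subseteq> W (fst p)"
  proof
    fix x assume "x \<in> F"
    then obtain i where i: "i \<in> I" "x \<in> W i" using assms(4) by blast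
    then obtain e where "0 < e" "cball x e \<subseteq> W i"
      using assms(3)[OF i(1)] by (auto simp: open_contains_cball)
    then show "\<exists>p. fst p \<in> I \<and> 0 < snd p \<and> cball x (snd p) \<subseteq> W (fst p)"
      using i by (intro exI[of _ "(i, e)"]) auto
  qed
  from bchoice[OF this] obtain p where
    p: "\<forall>x\<in>F. fst (p x) \<in> I \<and> 0 < snd (p x) \<and> cball x (snd (p x)) \<subseteq> W (fst (p x))" ..
  define ix where "ix x = fst (p x)" for x
  define e where "e x = snd (p x)" for x
  have ix: "\<And>x. x \<in> F \<Longrightarrow> ix x \<in> I" "\<And>x. x \<in> F \<Longrightarrow> 0 < e x"
      "\<And>x. x \<in> F \<Longrightarrow> cball x (e x) \<subseteq> W (ix x)"
    using p by (auto simp: ix_def e_def)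
  obtain T where T: "T \<subseteq> F" "finite T" "F \<subseteq> (\<Union>x\<in>T. ball x (e x))"
  proof (rule compactE_image[OF assms(1), of F "\<lambda>x. ball x (e x)"])
    show "F \<subseteq> (\<Union>x\<in>F. ball x (e x))" using ix(2) by auto
  qed auto
  define W' where "W' i = (\<Union>x\<in>{x\<in>T. ix x = i}. ball x (e x))" for i
  have "closure (W' i) \<subseteq> W i" for i
  proof (rule closure_minimal[THEN subset_trans])
    show "W' i \<subseteq> (\<Union>x\<in>{x\<in>T. ix x = i}. cball x (e x))"
      unfolding W'_def using ball_subset_cball by blast
    show "closed (\<Union>x\<in>{x\<in>T. ix x = i}. cball x (e x))"
      using T(2) by (intro closed_UN) auto
    show "(\<Union>x\<in>{x\<in>T. ix x = i}. cball x (e x)) \<subseteq> W i"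
    proof (rule UN_least)
      fix x assume "x \<in> {x \<in> T. ix x = i}"
      then show "cball x (e x) \<subseteq> W i" using ix(3)[of x] T(1) by auto
    qed
  qed
  moreover have "F \<subseteq> (\<Union>i\<in>I. W' i)"
  proof
    fix y assume "y \<in> F"
    then obtain x where x: "x \<in> T" "y \<in> ball x (e x)" using T(3) by blast
    then have "y \<in> W' (ix x)" by (auto simp: W'_def)
    moreover have "ix x \<in> I" using ix(1) T(1) x(1) by blast
    ultimately show "y \<in> (\<Union>i\<in>I. W' i)" by blast
  qed
  ultimately show ?thesis
    using that[of W'] by (simp add: W'_def open_UN)
qed

text \<open>Finitely many neighbourhoods with low-dimensional frontiers cover \<open>X\<close>. Near
  the union \<open>F\<close> of these frontiers the induction hypothesis refines the cover with
  multiplicity \<open>n\<close>; off \<open>F\<close> the neighbourhoods can be made disjoint, which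
  adds one more layer.\<close>

theorem dim_le_imp_ord_cover:
  fixes X :: "'a::metric_space set"
  assumes "compact X" "top_of_set X dim_le int n - 1"
  shows "ord_cover n X"
  using assms
proof (induction n arbitrary: X)
  case 0
  then have "topspace (top_of_set X) = {}" by simp
  then have "X = {}" by simp
  then show ?case by (simp add: ord_cover_empty)
next
  case (Suc n X)
  show ?case
    unfolding ord_cover_def
  proof (intro allI impI, elim conjE)
    fix I :: "nat set" and U
    assume I: "finite I" and U: "\<forall>i\<in>I. open (U i)" and cov: "X \<subseteq> (\<Union>i\<in>I. U i)"
    have "\<exists>i O'. i \<in> I \<and> x \<in> O' \<and> open O' \<and> O' \<subseteq> U i \<and>
        top_of_set (top_of_set X frontier_of (X \<inter> O')) dim_le int n - 1" if "x \<in> X" for x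
    proof -
      have "x \<in> (\<Union>i\<in>I. U i)" using cov that by (rule subsetD)
      then obtain i where i: "i \<in> I" "x \<in> U i" by (elim UN_E)
      have "\<exists>O'. x \<in> O' \<and> O' \<subseteq> U i \<and> openin euclidean O' \<and>
          top_of_set (top_of_set X frontier_of (X \<inter> O')) dim_le (int (Suc n) - 1 - 1)"
        using dimension_le_eq_subtopology[THEN iffD1, OF Suc.prems(2)] i U that by (metis open_openin)
      with i show ?thesis by auto
    qed
    then obtain ix O' where O': "\<And>x. x \<in> X \<Longrightarrow> ix x \<in> I" "\<And>x. x \<in> X \<Longrightarrow> x \<in> O' x"
        "\<And>x. x \<in> X \<Longrightarrow> open (O' x)" "\<And>x. x \<in> X \<Longrightarrow> O' x \<subseteq> U (ix x)"
        "\<And>x. x \<in> X \<Longrightarrow> top_of_set (top_of_set X frontier_of (X \<inter> O' x)) dim_le int n - 1"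
      by metis
    \<comment> \<open>These closures stay in \<open>X\<close>, as \<open>X\<close> is compact, so
      they are also the closures relative to \<open>X\<close>; the relative frontier becomes
      \<open>K x - O' x\<close>.\<close>
    define K where "K x = closure (X \<inter> O' x)" for x
    have KX: "K x \<subseteq> X" for x
      unfolding K_def by (rule closure_minimal) (auto simp: Suc.prems compact_imp_closed)
    have fr: "top_of_set X frontier_of (X \<inter> O' x) = K x - O' x" if "x \<in> X" for x
    proof -
      have "top_of_set X closure_of (X \<inter> O' x) = K x"
        using KX by (auto simp: closure_of_subtopology K_def)
      moreover have "top_of_set X interior_of (X \<inter> O' x) = X \<inter> O' x"
        using O'(3)[OF that] by (simp add: interior_of_eq openin_open_Int)
      ultimately show ?thesis using KX by (auto simp: frontier_of_def)
    qed
    have cpt: "compact (K x - O' x)" if "x \<in> X" for x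
      using O'(3)[OF that] Suc.prems(1) KX[of x]
      by (metis K_def closed_closure compact_Int_closed compact_diff inf.absorb_iff2)
    obtain T where T: "T \<subseteq> X" "finite T" "X \<subseteq> (\<Union>x\<in>T. O' x)"
      by (rule compactE_image[OF Suc.prems(1), of X O']) (use O'(2,3) in auto)
    define F where "F = (\<Union>x\<in>T. K x - O' x)"
    have "F \<subseteq> X" using KX by (auto simp: F_def)
    have "compact F" unfolding F_def using T cpt by (intro compact_UN) auto
    have "ord_cover n F"
      unfolding F_def
    proof (rule ord_cover_finite_Union)
      fix A assume "A \<in> (\<lambda>x. K x - O' x) ` T"
      then obtain x where x: "x \<in> X" "A = K x - O' x" using T(1) by blast
      then show "closed A" "ord_cover n A"
        using cpt[of x] Suc.IH[of A] O'(5)[of x] fr[of x] by (auto simp: compact_imp_closed)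
    qed (use T in auto)
    then obtain W where W: "\<And>i. i \<in> I \<Longrightarrow> open (W i)" "\<And>i. i \<in> I \<Longrightarrow> W i \<subseteq> U i"
        "F \<subseteq> (\<Union>i\<in>I. W i)" "\<And>x. x \<in> F \<Longrightarrow> card {i\<in>I. x \<in> W i} \<le> n"
      by (rule ord_coverD[OF _ I, of n F U]) (use U cov \<open>F \<subseteq> X\<close> in auto)
    obtain W' where W': "\<And>i. i \<in> I \<Longrightarrow> open (W' i)" "\<And>i. i \<in> I \<Longrightarrow> closure (W' i) \<subseteq> W i"
        "F \<subseteq> (\<Union>i\<in>I. W' i)"
      using compact_open_cover_shrink[OF \<open>compact F\<close> I W(1,3)] by blast
    \<comment> \<open>The points lying in more than \<open>n\<close> of the closures.
      \<open>B\<close> is closed and misses \<open>F\<close>, so removing it from each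
      \<open>W' i\<close> bounds the multiplicity everywhere and not only on \<open>F\<close>, while
      \<open>F\<close> remains covered.\<close>
    define B where "B = (\<Union>S\<in>{S. S \<subseteq> I \<and> card S = Suc n}. \<Inter>i\<in>S. closure (W' i))"
    have "closed B"
      unfolding B_def using I by (intro closed_UN closed_INT ballI) auto
    have "F \<inter> B = {}"
    proof -
      have False if x: "x \<in> F" "S \<subseteq> I" "card S = Suc n" "\<And>i. i \<in> S \<Longrightarrow> x \<in> closure (W' i)" for x S
      proof -
        have "S \<subseteq> {i\<in>I. x \<in> W i}" using x(2,4) W'(2) by blast
        then have "card S \<le> card {i\<in>I. x \<in> W i}" using I by (intro card_mono) auto
        then show False using W(4)[OF x(1)] x(3) by simp
      qed
      then show ?thesis unfolding B_def by blast
    qed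
    have cardW': "card {i\<in>I. x \<in> W' i - B} \<le> n" for x
    proof (rule ccontr)
      assume "\<not> card {i\<in>I. x \<in> W' i - B} \<le> n"
      then have "Suc n \<le> card {i\<in>I. x \<in> W' i - B}" by simp
      then obtain S where S: "S \<subseteq> {i\<in>I. x \<in> W' i - B}" "card S = Suc n"
        by (rule obtain_subset_with_card_n)
      then have "x \<in> W' i" if "i \<in> S" for i using that by blast
      then have "x \<in> closure (W' i)" if "i \<in> S" for i
        using that closure_subset[of "W' i"] by blast
      moreover have "S \<in> {S. S \<subseteq> I \<and> card S = Suc n}" using S by blast
      ultimately have "x \<in> B" unfolding B_def by (intro UN_I[of S]) auto
      moreover have "S \<noteq> {}" using S(2) by auto
      ultimately show False using S(1) by blast
    qed
    obtain xs where xs: "set xs = T" using finite_list[OF T(2)] by blast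
    \<comment> \<open>Each neighbourhood without the closures of the earlier ones: disjoint on
      \<open>X\<close>, and still open because closures are removed. A point of \<open>X\<close>
      that is lost altogether lies on an earlier frontier, hence in \<open>F\<close>.\<close>
    define V where "V j = O' (xs ! j) - (\<Union>l<j. K (xs ! l))" for j
    have V_open: "open (V j)" if "j < length xs" for j
    proof -
      have "xs ! j \<in> X" using T(1) xs nth_mem[OF that] by blast
      then show ?thesis
        unfolding V_def K_def using O'(3) by (intro open_Diff closed_UN) auto
    qed
    have V_unique: "j = j'" if "x \<in> X" "x \<in> V j" "x \<in> V j'" for x j j'
    proof -
      have "x \<in> K (xs ! j)" "x \<in> K (xs ! j')"
        using that closure_subset[of "X \<inter> O' (xs ! j)"] closure_subset[of "X \<inter> O' (xs ! j')"]
        by (auto simp: V_def K_def)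
      then have "\<not> j < j'" "\<not> j' < j" using that(2,3) by (auto simp: V_def)
      then show ?thesis by simp
    qed
    have V_cov: "x \<in> F \<or> (\<exists>j<length xs. x \<in> V j)" if "x \<in> X" for x
    proof (cases "x \<in> F")
      case False
      have ex: "\<exists>j. j < length xs \<and> x \<in> O' (xs ! j)"
      proof -
        obtain y where "y \<in> T" "x \<in> O' y" using subsetD[OF T(3) \<open>x \<in> X\<close>] by auto
        then show ?thesis using xs by (auto simp: in_set_conv_nth)
      qed
      define j where "j = (LEAST j. j < length xs \<and> x \<in> O' (xs ! j))"
      have j: "j < length xs" "x \<in> O' (xs ! j)"
        using LeastI_ex[OF ex] by (auto simp: j_def)
      have "x \<notin> K (xs ! l)" if "l < j" for l
      proof
        assume "x \<in> K (xs ! l)"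
        moreover have "x \<notin> O' (xs ! l)"
          using not_less_Least[of l "\<lambda>j. j < length xs \<and> x \<in> O' (xs ! j)"] that j(1) by (auto simp: j_def)
        moreover have "xs ! l \<in> T" using that j(1) xs by (auto simp: set_conv_nth)
        ultimately show False using False unfolding F_def by blast
      qed
      then have "x \<in> V j" using j unfolding V_def by blast
      then show ?thesis using j by blast
    qed simp
    \<comment> \<open>Every \<open>V j\<close> is credited to the one index
      \<open>ix (xs ! j)\<close> whose \<open>U\<close> was chosen to contain it. As a point of
      \<open>X\<close> lies in at most one \<open>V j\<close>, it gains at most one index.\<close>
    define Z where "Z i = (W' i - B) \<union> (\<Union>j\<in>{j. j < length xs \<and> ix (xs ! j) = i}. V j)" for i
    have "open (Z i) \<and> Z i \<subseteq> U i" if "i \<in> I" for i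
    proof
      show "open (Z i)"
        unfolding Z_def using \<open>closed B\<close> W'(1) that V_open by (intro open_Un open_Diff open_UN) auto
      have "W' i \<subseteq> U i" using W'(2) W(2) that closure_subset by blast
      moreover have "V j \<subseteq> U (ix (xs ! j))" if "j < length xs" for j
        using O'(4)[of "xs ! j"] T(1) xs that nth_mem unfolding V_def by blast
      ultimately show "Z i \<subseteq> U i" unfolding Z_def by blast
    qed
    moreover have "X \<subseteq> (\<Union>i\<in>I. Z i)"
    proof
      fix x assume "x \<in> X"
      from V_cov[OF this] show "x \<in> (\<Union>i\<in>I. Z i)"
      proof
        assume "x \<in> F"
        then show ?thesis using W'(3) \<open>F \<inter> B = {}\<close> unfolding Z_def by blast
      next
        assume "\<exists>j<length xs. x \<in> V j"
        then obtain j where j: "j < length xs" "x \<in> V j" by blast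
        then have "ix (xs ! j) \<in> I" using O'(1) T(1) xs nth_mem by blast
        then show ?thesis using j unfolding Z_def by blast
      qed
    qed
    moreover have "card {i\<in>I. x \<in> Z i} \<le> Suc n" if "x \<in> X" for x
    proof -
      define Q where "Q = {i. \<exists>j<length xs. ix (xs ! j) = i \<and> x \<in> V j}"
      have Q: "a = b" if "a \<in> Q" "b \<in> Q" for a b
        using V_unique[OF \<open>x \<in> X\<close>] that unfolding Q_def by auto
      have "Q \<subseteq> {SOME q. q \<in> Q}"
      proof
        fix y assume "y \<in> Q"
        then show "y \<in> {SOME q. q \<in> Q}" using Q[OF \<open>y \<in> Q\<close> someI[of "\<lambda>q. q \<in> Q"]] by simp
      qed
      then have "finite Q" "card Q \<le> 1"
        using finite_subset[of Q] card_mono[of "{SOME q. q \<in> Q}" Q] by auto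
      have "{i\<in>I. x \<in> Z i} \<subseteq> {i\<in>I. x \<in> W' i - B} \<union> Q"
        by (auto simp: Z_def Q_def)
      then have "card {i\<in>I. x \<in> Z i} \<le> card ({i\<in>I. x \<in> W' i - B} \<union> Q)"
        using I \<open>finite Q\<close> by (intro card_mono) auto
      also have "\<dots> \<le> card {i\<in>I. x \<in> W' i - B} + card Q" by (rule card_Un_le)
      finally show ?thesis using cardW'[of x] \<open>card Q \<le> 1\<close> by simp
    qed
    ultimately show "\<exists>W. (\<forall>i\<in>I. open (W i) \<and> W i \<subseteq> U i) \<and> X \<subseteq> (\<Union>i\<in>I. W i) \<and>
        (\<forall>x\<in>X. card {i\<in>I. x \<in> W i} \<le> Suc n)"
      by (intro exI[of _ Z] conjI ballI) auto
  qed
qed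

section \<open>Brouwer's theorem and the dimension of a simplex\<close>

lemma tendsto_fun_iff:
  fixes X :: "nat \<Rightarrow> nat \<Rightarrow> real"
  shows "X \<longlonglongrightarrow> l \<longleftrightarrow> (\<forall>i. (\<lambda>k. X k i) \<longlonglongrightarrow> l i)"
  using limitin_componentwise[of "\<lambda>_::nat. euclideanreal" UNIV X l sequentially]
  by (simp add: euclidean_product_topology)

definition fcube :: "nat \<Rightarrow> (nat \<Rightarrow> real) set" where
  "fcube n = {x. (\<forall>i<n. 0 \<le> x i \<and> x i \<le> 1) \<and> (\<forall>i\<ge>n. x i = 0)}"

lemma compact_fcube: "compact (fcube n)"
proof -
  have "fcube n = Pi\<^sub>E UNIV (\<lambda>i. if i < n then {0..1} else {0})"
    by (auto simp: fcube_def PiE_iff split: if_splits)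
  moreover have "compactin (product_topology (\<lambda>_. euclidean) UNIV)
      (Pi\<^sub>E UNIV (\<lambda>i. if i < n then {0..1::real} else {0}))"
    by (simp add: compactin_PiE)
  ultimately show ?thesis by (simp add: euclidean_product_topology)
qed

text \<open>Kuhn's argument. Label 0 at a coordinate means that \<open>f\<close> does not lower it,
  label 1 that \<open>f\<close> does not raise it; the combinatorial lemma finds in each grid a
  small cube on which every coordinate gets both labels. At a limit of these cubes both inequalities
  hold, coordinate by coordinate.\<close>

theorem brouwer_fcube:
  assumes cont: "continuous_on (fcube n) f" and im: "\<And>x. x \<in> fcube n \<Longrightarrow> f x \<in> fcube n"
  shows "\<exists>x\<in>fcube n. f x = x"
proof -
  have "\<forall>x. x \<in> fcube n \<longrightarrow> (\<forall>i. i < n \<longrightarrow> 0 \<le> x i \<and> x i \<le> 1)"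
    by (simp add: fcube_def)
  from kuhn_labelling_lemma'[OF _ this, of f] im
  obtain lab where lab0: "(\<forall>x i. lab x i \<le> (1::nat)) \<and>
      (\<forall>x i. x \<in> fcube n \<and> i < n \<and> x i = 0 \<longrightarrow> lab x i = 0) \<and>
      (\<forall>x i. x \<in> fcube n \<and> i < n \<and> x i = 1 \<longrightarrow> lab x i = 1) \<and>
      (\<forall>x i. x \<in> fcube n \<and> i < n \<and> lab x i = 0 \<longrightarrow> x i \<le> f x i) \<and>
      (\<forall>x i. x \<in> fcube n \<and> i < n \<and> lab x i = 1 \<longrightarrow> f x i \<le> x i)"
    by auto
  have lab: "\<And>x i. lab x i \<le> (1::nat)"
      "\<And>x i. x \<in> fcube n \<Longrightarrow> i < n \<Longrightarrow> x i = 0 \<Longrightarrow> lab x i = 0"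
      "\<And>x i. x \<in> fcube n \<Longrightarrow> i < n \<Longrightarrow> x i = 1 \<Longrightarrow> lab x i = 1"
      "\<And>x i. x \<in> fcube n \<Longrightarrow> i < n \<Longrightarrow> lab x i = 0 \<Longrightarrow> x i \<le> f x i"
      "\<And>x i. x \<in> fcube n \<Longrightarrow> i < n \<Longrightarrow> lab x i = 1 \<Longrightarrow> f x i \<le> x i"
    using lab0 by simp_all
  have approx: "\<exists>z\<in>fcube n. \<forall>i<n.
      (\<exists>a\<in>fcube n. (\<forall>j. \<bar>a j - z j\<bar> \<le> 1 / real p) \<and> a i \<le> f a i) \<and>
      (\<exists>b\<in>fcube n. (\<forall>j. \<bar>b j - z j\<bar> \<le> 1 / real p) \<and> f b i \<le> b i)" if p: "0 < p" for p :: nat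
  proof -
    define g where "g y = (\<lambda>i. if i < n then real (y i) / real p else 0)" for y :: "nat \<Rightarrow> nat"
    have g: "g y \<in> fcube n" if "\<forall>i<n. y i \<le> p" for y
      using that p by (auto simp: g_def fcube_def)
    obtain q where q: "\<forall>i<n. q i < p"
      and qrs: "\<forall>i<n. \<exists>r s. (\<forall>j<n. q j \<le> r j \<and> r j \<le> q j + 1) \<and>
          (\<forall>j<n. q j \<le> s j \<and> s j \<le> q j + 1) \<and> lab (g r) i \<noteq> lab (g s) i"
    proof (rule kuhn_lemma[of p n "\<lambda>y. lab (g y)"])
      show "\<forall>x. (\<forall>i<n. x i \<le> p) \<longrightarrow> (\<forall>i<n. lab (g x) i = 0 \<or> lab (g x) i = 1)"
        using lab(1) by (metis le_eq_less_or_eq less_one)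
      show "\<forall>x. (\<forall>i<n. x i \<le> p) \<longrightarrow> (\<forall>i<n. x i = 0 \<longrightarrow> lab (g x) i = 0)"
        using lab(2) g by (simp add: g_def)
      show "\<forall>x. (\<forall>i<n. x i \<le> p) \<longrightarrow> (\<forall>i<n. x i = p \<longrightarrow> lab (g x) i = 1)"
        using lab(3) g p by (simp add: g_def)
    qed (use p in auto)
    have near: "\<bar>g y j - g q j\<bar> \<le> 1 / real p" if "\<forall>j<n. q j \<le> y j \<and> y j \<le> q j + 1" for y j
    proof (cases "j < n")
      case True
      then have "\<bar>real (y j) - real (q j)\<bar> \<le> 1" using that by auto
      then have "\<bar>real (y j) - real (q j)\<bar> / real p \<le> 1 / real p"
        by (rule divide_right_mono) simp
      then show ?thesis using True by (simp add: g_def flip: diff_divide_distrib)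
    qed (simp add: g_def)
    have *: "(\<exists>a\<in>fcube n. (\<forall>j. \<bar>a j - g q j\<bar> \<le> 1 / real p) \<and> a i \<le> f a i) \<and>
        (\<exists>b\<in>fcube n. (\<forall>j. \<bar>b j - g q j\<bar> \<le> 1 / real p) \<and> f b i \<le> b i)" if i: "i < n" for i
    proof -
      obtain r s where r: "\<forall>j<n. q j \<le> r j \<and> r j \<le> q j + 1"
        and s: "\<forall>j<n. q j \<le> s j \<and> s j \<le> q j + 1" and rs: "lab (g r) i \<noteq> lab (g s) i"
        using mp[OF spec[OF qrs] i] by (elim exE conjE)
      have "r j \<le> p" "s j \<le> p" if "j < n" for j
      proof -
        have "r j \<le> q j + 1" "s j \<le> q j + 1" "q j < p" using q r s that by auto
        then show "r j \<le> p" "s j \<le> p" by auto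
      qed
      then have gr: "g r \<in> fcube n" "g s \<in> fcube n" by (simp_all add: g)
      have "lab (g r) i = 0 \<and> lab (g s) i = 1 \<or> lab (g r) i = 1 \<and> lab (g s) i = 0"
        using lab(1)[of "g r" i] lab(1)[of "g s" i] rs by linarith
      then show ?thesis
        using lab(4,5)[OF gr(1) i] lab(4,5)[OF gr(2) i] gr near[OF r] near[OF s] by blast
    qed
    have "g q \<in> fcube n" using q by (intro g) (auto intro: less_imp_le)
    then show ?thesis using * by (intro bexI[of _ "g q"]) auto
  qed
  then have "\<forall>p. \<exists>z. z \<in> fcube n \<and> (\<forall>i<n.
      (\<exists>a\<in>fcube n. (\<forall>j. \<bar>a j - z j\<bar> \<le> 1 / real (Suc p)) \<and> a i \<le> f a i) \<and>
      (\<exists>b\<in>fcube n. (\<forall>j. \<bar>b j - z j\<bar> \<le> 1 / real (Suc p)) \<and> f b i \<le> b i))"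
    by blast
  from choice[OF this] obtain z where z: "\<And>p. z p \<in> fcube n"
    and za: "\<And>p i. i < n \<Longrightarrow> \<exists>a\<in>fcube n. (\<forall>j. \<bar>a j - z p j\<bar> \<le> 1 / real (Suc p)) \<and> a i \<le> f a i"
    and zb: "\<And>p i. i < n \<Longrightarrow> \<exists>b\<in>fcube n. (\<forall>j. \<bar>b j - z p j\<bar> \<le> 1 / real (Suc p)) \<and> f b i \<le> b i"
    by blast
  obtain w r where w: "w \<in> fcube n" and r: "strict_mono r" and lim: "(z \<circ> r) \<longlonglongrightarrow> w"
    using seq_compactE[OF compact_imp_seq_compact[OF compact_fcube[of n]], of z] z by auto
  \<comment> \<open>The two witnesses vary with the coordinate, but both are within
    \<open>1 / Suc (r k)\<close> of the same \<open>z (r k)\<close>, so every such sequence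
    converges to \<open>w\<close>.\<close>
  have lims: "a \<longlonglongrightarrow> w" if a: "\<And>k j. \<bar>a k j - z (r k) j\<bar> \<le> 1 / real (Suc (r k))" for a
    unfolding tendsto_fun_iff
  proof
    fix i
    have "(\<lambda>k. 1 / real (Suc (r k))) \<longlonglongrightarrow> 0"
      using LIMSEQ_subseq_LIMSEQ[OF lim_1_over_n[where 'a = real, THEN LIMSEQ_Suc] r] by (simp add: o_def)
    then have "(\<lambda>k. a k i - z (r k) i) \<longlonglongrightarrow> 0"
      by (rule Lim_null_comparison[rotated]) (use a in simp)
    moreover have "(\<lambda>k. z (r k) i) \<longlonglongrightarrow> w i"
      using lim by (simp add: tendsto_fun_iff o_def)
    ultimately show "(\<lambda>k. a k i) \<longlonglongrightarrow> w i"
      using tendsto_add by fastforce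
  qed
  have flim: "(\<lambda>k. f (a k) i) \<longlonglongrightarrow> f w i" if "a \<longlonglongrightarrow> w" "\<And>k. a k \<in> fcube n" for a i
  proof -
    have "(f \<circ> a) \<longlonglongrightarrow> f w"
      using cont that w unfolding continuous_on_sequentially by blast
    then show ?thesis by (simp add: tendsto_fun_iff o_def)
  qed
  have "f w i = w i" if i: "i < n" for i
  proof (rule antisym)
    have "\<forall>k. \<exists>b. b \<in> fcube n \<and> (\<forall>j. \<bar>b j - z (r k) j\<bar> \<le> 1 / real (Suc (r k))) \<and> f b i \<le> b i"
      using zb[OF i] by blast
    from choice[OF this] obtain b where b: "\<And>k. b k \<in> fcube n"
        "\<And>k j. \<bar>b k j - z (r k) j\<bar> \<le> 1 / real (Suc (r k))" "\<And>k. f (b k) i \<le> b k i"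
      by blast
    have "b \<longlonglongrightarrow> w" using b(2) by (rule lims)
    then show "f w i \<le> w i"
      using b(1,3) by (intro LIMSEQ_le[OF flim[of b i], of "\<lambda>k. b k i"]) (auto simp: tendsto_fun_iff)
    have "\<forall>k. \<exists>a. a \<in> fcube n \<and> (\<forall>j. \<bar>a j - z (r k) j\<bar> \<le> 1 / real (Suc (r k))) \<and> a i \<le> f a i"
      using za[OF i] by blast
    from choice[OF this] obtain a where a: "\<And>k. a k \<in> fcube n"
        "\<And>k j. \<bar>a k j - z (r k) j\<bar> \<le> 1 / real (Suc (r k))" "\<And>k. a k i \<le> f (a k) i"
      by blast
    have "a \<longlonglongrightarrow> w" using a(2) by (rule lims)
    then show "w i \<le> f w i"
      using a(1,3) by (intro LIMSEQ_le[OF _ flim[of a i], of "\<lambda>k. a k i"]) (auto simp: tendsto_fun_iff)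
  qed
  moreover have "f w i = w i" if "\<not> i < n" for i
    using im[OF w] w that by (simp add: fcube_def)
  ultimately have "f w = w" by blast
  with w show ?thesis by blast
qed

text \<open>\<open>n\<close> counts the vertices, so the dimension is \<open>n - 1\<close>.\<close>

definition fsimplex :: "nat \<Rightarrow> (nat \<Rightarrow> real) set" where
  "fsimplex n = {x. (\<forall>i<n. 0 \<le> x i) \<and> (\<forall>i\<ge>n. x i = 0) \<and> (\<Sum>i<n. x i) = 1}"

lemma continuous_on_coordinate [continuous_intros]:
  "continuous_on S (\<lambda>x::nat \<Rightarrow> real. x i)"
  by (rule continuous_on_subset[OF continuous_on_product_coordinates]) simp

lemma fsimplex_subset_fcube: "fsimplex n \<subseteq> fcube n"
proof
  fix x assume x: "x \<in> fsimplex n"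
  have "x i \<le> 1" if "i < n" for i
    using member_le_sum[of i "{..<n}" x] x that by (simp add: fsimplex_def)
  with x show "x \<in> fcube n" by (simp add: fsimplex_def fcube_def)
qed

lemma compact_fsimplex: "compact (fsimplex n)"
proof -
  have "fsimplex n = fcube n \<inter> {x. (\<Sum>i<n. x i) = 1}"
    using fsimplex_subset_fcube[of n] by (auto simp: fsimplex_def fcube_def)
  moreover have "closed {x::nat \<Rightarrow> real. (\<Sum>i<n. x i) = 1}"
    by (intro closed_Collect_eq continuous_intros)
  ultimately show ?thesis
    using compact_fcube compact_Int_closed by metis
qed

lemma brouwer_fsimplex:
  assumes n: "0 < n" and cont: "continuous_on (fsimplex n) f"
    and im: "\<And>x. x \<in> fsimplex n \<Longrightarrow> f x \<in> fsimplex n"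
  shows "\<exists>x\<in>fsimplex n. f x = x"
proof -
  \<comment> \<open>A retraction of the cube onto the simplex: a coordinate sum below 1 is topped up
    in equal shares, a larger one is scaled down.\<close>
  define r where "r x = (\<lambda>i. if i < n then
      (x i + max 0 (1 - (\<Sum>j<n. x j)) / real n) / max 1 (\<Sum>j<n. x j) else 0)" for x :: "nat \<Rightarrow> real"
  have r: "r x \<in> fsimplex n" if "x \<in> fcube n" for x
  proof -
    have "(\<Sum>i<n. r x i) = ((\<Sum>i<n. x i) + max 0 (1 - (\<Sum>j<n. x j))) / max 1 (\<Sum>j<n. x j)"
      using n by (simp add: r_def sum.distrib flip: sum_divide_distrib)
    also have "\<dots> = 1" by (simp add: max_def)
    finally show ?thesis
      using that n by (auto simp: fsimplex_def fcube_def r_def intro!: divide_nonneg_nonneg)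
  qed
  have r_id: "r x = x" if "x \<in> fsimplex n" for x
    using that by (auto simp: r_def fsimplex_def)
  have "continuous_on (fcube n) r"
  proof (rule continuous_on_coordinatewise_then_product)
    fix i
    show "continuous_on (fcube n) (\<lambda>x. r x i)"
    proof (cases "i < n")
      case True
      have "continuous_on (fcube n) (\<lambda>x. (x i + max 0 (1 - (\<Sum>j<n. x j)) / real n) / max 1 (\<Sum>j<n. x j))"
        using n by (intro continuous_intros) (auto simp: max_def)
      then show ?thesis using True by (simp add: r_def)
    qed (simp add: r_def)
  qed
  moreover have "continuous_on (r ` fcube n) f"
    by (rule continuous_on_subset[OF cont]) (use r in blast)
  ultimately have "continuous_on (fcube n) (f \<circ> r)"
    by (rule continuous_on_compose)
  moreover have "(f \<circ> r) x \<in> fcube n" if "x \<in> fcube n" for x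
    using im[OF r[OF that]] fsimplex_subset_fcube[of n] by auto
  ultimately obtain x where x: "x \<in> fcube n" "(f \<circ> r) x = x"
    using brouwer_fcube by blast
  then have "x \<in> fsimplex n" using im[OF r[OF x(1)]] by simp
  with x(2) r_id show ?thesis by auto
qed

text \<open>Refine the cover by the complements of the facets to \<open>n\<close> open sets with empty intersection.
  The associated partition of unity maps the simplex to its boundary, preserving each face; after
  a cyclic shift of the coordinates such a map has no fixed point.\<close>

lemma not_ord_cover_fsimplex: "\<not> ord_cover n (fsimplex (Suc n))"
proof
  let ?S = "fsimplex (Suc n)"
  assume oc: "ord_cover n ?S"
  have op: "open {x::nat \<Rightarrow> real. 0 < x i}" for i
    by (intro open_Collect_less continuous_intros)
  have cov: "?S \<subseteq> (\<Union>i\<in>{..<Suc n}. {x. 0 < x i})"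
  proof
    fix x assume x: "x \<in> ?S"
    have "\<exists>i<Suc n. x i \<noteq> 0"
    proof (rule ccontr)
      assume "\<not> ?thesis"
      then have "(\<Sum>i<Suc n. x i) = 0" by (intro sum.neutral) auto
      with x show False by (simp add: fsimplex_def)
    qed
    then obtain i where "i < Suc n" "x i \<noteq> 0" by blast
    moreover from this have "0 \<le> x i" using x by (simp add: fsimplex_def)
    ultimately show "x \<in> (\<Union>i\<in>{..<Suc n}. {x. 0 < x i})" by force
  qed
  obtain W where W: "\<And>i. i \<in> {..<Suc n} \<Longrightarrow> open (W i)"
      "\<And>i. i \<in> {..<Suc n} \<Longrightarrow> W i \<subseteq> {x. 0 < x i}" "?S \<subseteq> (\<Union>i\<in>{..<Suc n}. W i)"
      "\<And>x. x \<in> ?S \<Longrightarrow> card {i\<in>{..<Suc n}. x \<in> W i} \<le> n"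
    using ord_coverD[OF oc finite_lessThan op cov] by blast
  define p where "p i x = infdist x (- W i)" for i x
  have p_nonneg: "0 \<le> p i x" for i x by (simp add: p_def infdist_nonneg)
  have p_pos: "p i x = 0 \<longleftrightarrow> x \<notin> W i" if "i < Suc n" for i x
  proof -
    \<comment> \<open>\<open>infdist\<close> from the empty set is 0 by convention, so positivity on
      \<open>W i\<close> requires a point outside it; the origin is one, because \<open>W i\<close>
      keeps coordinate \<open>i\<close> positive.\<close>
    have "(\<lambda>_. 0) \<notin> W i" using W(2)[of i] that by auto
    then have "- W i \<noteq> {}" by blast
    moreover have "closed (- W i)" using W(1)[of i] that by (simp add: closed_Compl)
    ultimately show ?thesis using in_closed_iff_infdist_zero[of "- W i" x] by (simp add: p_def)
  qed
  define s where "s x = (\<Sum>i<Suc n. p i x)" for x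
  have s_pos: "0 < s x" if "x \<in> ?S" for x
  proof -
    have "x \<in> (\<Union>i\<in>{..<Suc n}. W i)" using W(3) that by (rule subsetD)
    then obtain i where i: "i \<in> {..<Suc n}" "x \<in> W i" by (rule UN_E)
    then have "p i x > 0" using p_pos[of i x] p_nonneg[of i x] by (simp add: less_le)
    then show ?thesis
      unfolding s_def using i(1) p_nonneg by (intro sum_pos2[of _ i]) auto
  qed
  define f where "f x = (\<lambda>i. if i < Suc n then p (if i = 0 then n else i - 1) x / s x else 0)" for x
  have "f x \<in> ?S" if "x \<in> ?S" for x
  proof -
    have "(\<Sum>i<Suc n. f x i) = p n x / s x + (\<Sum>i<n. p i x / s x)"
      by (subst sum.lessThan_Suc_shift) (simp add: f_def)
    also have "\<dots> = ((\<Sum>i<n. p i x) + p n x) / s x"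
      by (simp add: add_divide_distrib sum_divide_distrib)
    also have "\<dots> = s x / s x" by (simp add: s_def)
    finally have "(\<Sum>i<Suc n. f x i) = s x / s x" .
    then show ?thesis
      using s_pos[OF that] p_nonneg by (auto simp: fsimplex_def f_def intro!: divide_nonneg_pos)
  qed
  moreover have "continuous_on ?S f"
  proof (rule continuous_on_coordinatewise_then_product)
    fix i
    have "continuous_on ?S (\<lambda>x. p j x / s x)" for j
      unfolding p_def s_def using s_pos
      by (intro continuous_intros) (auto simp: s_def p_def dest!: s_pos)
    then show "continuous_on ?S (\<lambda>x. f x i)" by (cases "i < Suc n") (simp_all add: f_def)
  qed
  ultimately obtain x where x: "x \<in> ?S" "f x = x"
    using brouwer_fsimplex[of "Suc n" f] by auto
  \<comment> \<open>At the fixed point, a vanishing weight of the preceding index makes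
    \<open>x i\<close> zero, which puts \<open>x\<close> outside \<open>W i\<close> and kills the
    next weight. Since at most \<open>n\<close> of the \<open>n + 1\<close> sets contain
    \<open>x\<close>, one weight vanishes, and the cycle carries the zero to all of them.\<close>
  have down: "p i x = 0" if "i < Suc n" "p (if i = 0 then n else i - 1) x = 0" for i
  proof -
    have "x i = 0"
      using fun_cong[OF x(2), of i] that by (simp add: f_def)
    then have "x \<notin> W i" using W(2)[of i] that(1) by auto
    then show ?thesis using p_pos that(1) by simp
  qed
  have up: "p j x = 0" if "i \<le> j" "j < Suc n" "p i x = 0" for i j
    using that
  proof (induction j rule: dec_induct)
    case (step j)
    then show ?case using down[of "Suc j"] by simp
  qed
  have "\<not> {..<Suc n} \<subseteq> {i\<in>{..<Suc n}. x \<in> W i}"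
  proof
    assume "{..<Suc n} \<subseteq> {i\<in>{..<Suc n}. x \<in> W i}"
    then have "card {..<Suc n} \<le> card {i\<in>{..<Suc n}. x \<in> W i}" by (intro card_mono) auto
    with W(4)[OF x(1)] show False by simp
  qed
  then obtain k where "k < Suc n" "x \<notin> W k" by auto
  then have "p k x = 0" by (simp add: p_pos)
  then have "p n x = 0" using up[of k n] \<open>k < Suc n\<close> by simp
  then have "p 0 x = 0" using down[of 0] by simp
  then have "s x = 0" unfolding s_def using up[of 0] by (intro sum.neutral) auto
  with s_pos[OF x(1)] show False by simp
qed

lemma not_dim_le_fsimplex: "\<not> top_of_set (fsimplex (Suc n)) dim_le int n - 1"
  using dim_le_imp_ord_cover[OF compact_fsimplex] not_ord_cover_fsimplex by blast

section \<open>Rational polyhedral cells\<close>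

primrec term_eval :: "(nat \<Rightarrow> real) \<Rightarrow> hoop_term \<Rightarrow> real" where
  "term_eval x (HVar i) = x i"
| "term_eval x HZero = 0"
| "term_eval x (HPlus s t) = term_eval x s + term_eval x t"
| "term_eval x (HMonus s t) = max 0 (term_eval x s - term_eval x t)"

text \<open>Only equations and strict inequalities occur, so under \<open>section_on\<close> a
  nonempty cell has exactly the dimension \<open>card J\<close>; closed cones are unions of such
  pieces.\<close>

definition cell_of :: "nat set \<Rightarrow> (nat \<Rightarrow> nat \<Rightarrow> real) \<Rightarrow> (nat \<Rightarrow> real) set \<Rightarrow> (nat \<Rightarrow> real) set" where
  "cell_of J s B = {x. (\<forall>i. x i = (\<Sum>j\<in>J. s i j * x j)) \<and> (\<forall>b\<in>B. 0 < (\<Sum>j\<in>J. b j * x j))}"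

text \<open>The coordinates in \<open>J\<close> are free and \<open>s\<close> expresses all coordinates through them.\<close>

definition section_on :: "nat \<Rightarrow> nat set \<Rightarrow> (nat \<Rightarrow> nat \<Rightarrow> real) \<Rightarrow> bool" where
  "section_on n J s \<longleftrightarrow> J \<subseteq> {..<n} \<and> (\<forall>i. \<forall>j\<in>J. s i j \<in> \<rat>) \<and>
     (\<forall>i\<in>J. \<forall>j\<in>J. s i j = (if i = j then 1 else 0)) \<and> (\<forall>i\<ge>n. \<forall>j\<in>J. s i j = 0)"

text \<open>Rationality is imposed on the hull, through \<open>s\<close>, because the hull has to
  supply lattice points. The strict inequalities are open conditions, which lattice points deep
  inside the cone satisfy whatever the coefficients.\<close>

definition is_cell :: "nat \<Rightarrow> nat \<Rightarrow> (nat \<Rightarrow> real) set \<Rightarrow> bool" where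
  "is_cell n m D \<longleftrightarrow> (\<exists>J s B. section_on n J s \<and> card J = m \<and> finite B \<and> D = cell_of J s B)"

definition cell :: "nat \<Rightarrow> (nat \<Rightarrow> real) set \<Rightarrow> bool" where
  "cell n D \<longleftrightarrow> (\<exists>m. is_cell n m D)"

definition lin_on :: "nat \<Rightarrow> (nat \<Rightarrow> real) set \<Rightarrow> ((nat \<Rightarrow> real) \<Rightarrow> real) \<Rightarrow> bool" where
  "lin_on n D f \<longleftrightarrow> (\<exists>L. (\<forall>i. L i \<in> \<rat>) \<and> (\<forall>x\<in>D. f x = (\<Sum>i<n. L i * x i)))"

text \<open>Quantified over all cells and not only the whole space, so that subdivisions can be
  nested: the pieces of one are cut up again for the next property.\<close>

definition refinable :: "nat \<Rightarrow> ((nat \<Rightarrow> real) set \<Rightarrow> bool) \<Rightarrow> bool" where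
  "refinable n P \<longleftrightarrow> (\<forall>D. cell n D \<longrightarrow>
     (\<exists>F. finite F \<and> D = \<Union>F \<and> (\<forall>E\<in>F. cell n E \<and> P E)))"

lemma cell_ofD: "x \<in> cell_of J s B \<Longrightarrow> x i = (\<Sum>j\<in>J. s i j * x j)"
  unfolding cell_of_def by blast

lemma cell_of_pos: "x \<in> cell_of J s B \<Longrightarrow> b \<in> B \<Longrightarrow> 0 < (\<Sum>j\<in>J. b j * x j)"
  unfolding cell_of_def by blast

lemma cell_ofI:
  "(\<And>i. x i = (\<Sum>j\<in>J. s i j * x j)) \<Longrightarrow> (\<And>b. b \<in> B \<Longrightarrow> 0 < (\<Sum>j\<in>J. b j * x j)) \<Longrightarrow>
    x \<in> cell_of J s B"
  unfolding cell_of_def by blast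

lemma cell_full: "cell n {x. \<forall>i\<ge>n. x i = 0}"
proof -
  let ?s = "\<lambda>i j::nat. if i = j then 1 else 0 :: real"
  have sec: "section_on n {..<n} ?s" by (auto simp: section_on_def)
  have "(\<Sum>j<n. ?s i j * x j) = (if i < n then x i else 0)" for x i
    by (subst sum.cong[OF refl, of _ _ "\<lambda>j. if i = j then x j else 0"]) auto
  then have "cell_of {..<n} ?s {} = {x. \<forall>i. x i = (if i < n then x i else 0)}"
    by (simp add: cell_of_def)
  moreover have "(\<forall>i. x i = (if i < n then x i else 0)) \<longleftrightarrow> (\<forall>i\<ge>n. x i = 0)" for x :: "nat \<Rightarrow> real"
    by (metis not_le)
  ultimately have "{x. \<forall>i\<ge>n. x i = 0} = cell_of {..<n} ?s {}" by simp
  with sec show ?thesis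
    unfolding cell_def is_cell_def by (intro exI[of _ n] exI[of _ "{..<n}"] exI[of _ ?s] exI[of _ "{}"]) simp
qed

lemma lin_on_subset: "lin_on n D f \<Longrightarrow> E \<subseteq> D \<Longrightarrow> lin_on n E f"
  unfolding lin_on_def by (meson subsetD)

lemma lin_on_coordinate: "i < n \<Longrightarrow> lin_on n D (\<lambda>x. x i)"
  unfolding lin_on_def
proof (intro exI[of _ "\<lambda>j. if j = i then 1 else 0"] conjI ballI)
  fix x :: "nat \<Rightarrow> real" assume "i < n"
  then show "x i = (\<Sum>j<n. (if j = i then 1 else 0) * x j)"
    by (subst sum.cong[OF refl, of _ _ "\<lambda>j. if j = i then x j else 0"]) auto
qed auto

lemma lin_on_zero: "lin_on n D (\<lambda>x. 0)"
  unfolding lin_on_def by (intro exI[of _ "\<lambda>_. 0"]) auto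

lemma lin_on_add:
  assumes "lin_on n D f" "lin_on n D g"
  shows "lin_on n D (\<lambda>x. f x + g x)"
proof -
  obtain L M where "\<forall>i. L i \<in> \<rat>" "\<forall>x\<in>D. f x = (\<Sum>i<n. L i * x i)"
      "\<forall>i. M i \<in> \<rat>" "\<forall>x\<in>D. g x = (\<Sum>i<n. M i * x i)"
    using assms unfolding lin_on_def by auto
  then show ?thesis
    unfolding lin_on_def
    by (intro exI[of _ "\<lambda>i. L i + M i"]) (auto simp: algebra_simps sum.distrib)
qed

lemma lin_on_diff:
  assumes "lin_on n D f" "lin_on n D g"
  shows "lin_on n D (\<lambda>x. f x - g x)"
proof -
  obtain L M where "\<forall>i. L i \<in> \<rat>" "\<forall>x\<in>D. f x = (\<Sum>i<n. L i * x i)"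
      "\<forall>i. M i \<in> \<rat>" "\<forall>x\<in>D. g x = (\<Sum>i<n. M i * x i)"
    using assms unfolding lin_on_def by auto
  then show ?thesis
    unfolding lin_on_def
    by (intro exI[of _ "\<lambda>i. L i - M i"]) (auto simp: algebra_simps sum_subtractf)
qed

lemma lin_on_cong: "(\<And>x. x \<in> D \<Longrightarrow> f x = g x) \<Longrightarrow> lin_on n D g \<Longrightarrow> lin_on n D f"
  unfolding lin_on_def by auto

lemma cell_form:
  assumes "section_on n J s" "lin_on n (cell_of J s B) f"
  shows "\<exists>b. (\<forall>j. b j \<in> \<rat>) \<and> (\<forall>x\<in>cell_of J s B. f x = (\<Sum>j\<in>J. b j * x j))"
proof -
  obtain L where L: "\<And>i. L i \<in> \<rat>" "\<And>x. x \<in> cell_of J s B \<Longrightarrow> f x = (\<Sum>i<n. L i * x i)"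
    using assms(2) unfolding lin_on_def by auto
  define b where "b j = (if j \<in> J then \<Sum>i<n. L i * s i j else 0)" for j
  have "b j \<in> \<rat>" for j
    using L(1) assms(1) by (auto simp: b_def section_on_def intro!: Rats_sum Rats_mult)
  moreover have "f x = (\<Sum>j\<in>J. b j * x j)" if x: "x \<in> cell_of J s B" for x
  proof -
    have "f x = (\<Sum>i<n. L i * (\<Sum>j\<in>J. s i j * x j))"
      unfolding L(2)[OF x] using cell_ofD[OF x] by (metis (no_types, lifting))
    also have "\<dots> = (\<Sum>i<n. \<Sum>j\<in>J. L i * s i j * x j)"
      by (simp add: sum_distrib_left mult.assoc)
    also have "\<dots> = (\<Sum>j\<in>J. \<Sum>i<n. L i * s i j * x j)"
      by (rule sum.swap)
    also have "\<dots> = (\<Sum>j\<in>J. b j * x j)"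
      by (intro sum.cong refl) (simp add: b_def sum_distrib_right)
    finally show ?thesis .
  qed
  ultimately show ?thesis by blast
qed

lemma cell_Int_pos:
  assumes "cell n D" "lin_on n D f"
  shows "cell n (D \<inter> {x. 0 < f x})"
proof -
  obtain J s B where D: "section_on n J s" "finite B" "D = cell_of J s B"
    using assms(1) unfolding cell_def is_cell_def by auto
  have "\<exists>b. (\<forall>j. b j \<in> \<rat>) \<and> (\<forall>x\<in>D. f x = (\<Sum>j\<in>J. b j * x j))"
    using cell_form[OF D(1), of B f] assms(2) unfolding D(3) .
  then obtain b where b0: "(\<forall>j. b j \<in> \<rat>) \<and> (\<forall>x\<in>D. f x = (\<Sum>j\<in>J. b j * x j))" ..
  have b: "f x = (\<Sum>j\<in>J. b j * x j)" if "x \<in> D" for x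
    using b0 that by blast
  have "x \<in> D \<inter> {x. 0 < f x} \<longleftrightarrow> x \<in> cell_of J s (insert b B)" for x
  proof -
    have "x \<in> cell_of J s (insert b B) \<longleftrightarrow> x \<in> cell_of J s B \<and> 0 < (\<Sum>j\<in>J. b j * x j)"
      unfolding cell_of_def by blast
    then show ?thesis using b[of x] D(3) by auto
  qed
  then have "D \<inter> {x. 0 < f x} = cell_of J s (insert b B)" by blast
  with D show ?thesis
    unfolding cell_def is_cell_def
    by (intro exI[of _ "card J"] exI[of _ J] exI[of _ s] exI[of _ "insert b B"]) simp
qed

text \<open>Unless all its coefficients vanish, the form is solved for a parameter \<open>k\<close>,
  which leaves \<open>J\<close>; substituting the solution into the rows of \<open>s\<close> and the
  forms of \<open>B\<close> gives a cell again.\<close>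

lemma cell_Int_zero:
  assumes "cell n D" "lin_on n D f"
  shows "cell n (D \<inter> {x. f x = 0})"
proof -
  obtain J s B where D: "section_on n J s" "finite B" "D = cell_of J s B"
    using assms(1) unfolding cell_def is_cell_def by auto
  have "\<exists>b. (\<forall>j. b j \<in> \<rat>) \<and> (\<forall>x\<in>D. f x = (\<Sum>j\<in>J. b j * x j))"
    using cell_form[OF D(1), of B f] assms(2) unfolding D(3) .
  then obtain b where b0: "(\<forall>j. b j \<in> \<rat>) \<and> (\<forall>x\<in>D. f x = (\<Sum>j\<in>J. b j * x j))" ..
  have bQ: "b j \<in> \<rat>" for j
    using b0 by blast
  have b: "f x = (\<Sum>j\<in>J. b j * x j)" if "x \<in> D" for x
    using b0 that by blast
  have finJ: "finite J" using D(1) finite_subset unfolding section_on_def by blast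
  show ?thesis
  proof (cases "\<forall>j\<in>J. b j = 0")
    case True
    then have "D \<inter> {x. f x = 0} = D" using b by auto
    with assms(1) show ?thesis by simp
  next
    case False
    then obtain k where k: "k \<in> J" "b k \<noteq> 0" by auto
    define J' where "J' = J - {k}"
    define c where "c j = - (b j / b k)" for j
    define s' where "s' i j = s i j + s i k * c j" for i j
    \<comment> \<open>The substitution on coefficient vectors. The rows of \<open>s'\<close> are
      \<open>h\<close> of the rows of \<open>s\<close>, so the single identity \<open>split\<close>
      treats the equations and the inequalities alike.\<close>
    define h where "h e = (\<lambda>j. e j + e k * c j)" for e :: "nat \<Rightarrow> real"
    have cQ: "c j \<in> \<rat>" for j using bQ by (simp add: c_def)
    have "section_on n J' s'"
      using D(1) cQ k by (auto simp: section_on_def J'_def s'_def intro!: Rats_add Rats_mult)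
    have split: "(\<Sum>j\<in>J. e j * x j) = (\<Sum>j\<in>J'. h e j * x j) + e k * (x k - (\<Sum>j\<in>J'. c j * x j))"
      for e x
    proof -
      have "(\<Sum>j\<in>J. e j * x j) = e k * x k + (\<Sum>j\<in>J'. e j * x j)"
        unfolding J'_def by (rule sum.remove[OF finJ k(1)])
      then show ?thesis
        by (simp add: h_def algebra_simps sum.distrib sum_distrib_left)
    qed
    have b_split: "(\<Sum>j\<in>J. b j * x j) = b k * (x k - (\<Sum>j\<in>J'. c j * x j))" for x
    proof -
      have "h b j = 0" for j using k(2) by (simp add: h_def c_def)
      then show ?thesis unfolding split[of b x] by simp
    qed
    have "x \<in> D \<inter> {x. f x = 0} \<longleftrightarrow> x \<in> cell_of J' s' (h ` B)" for x
    proof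
      assume x: "x \<in> D \<inter> {x. f x = 0}"
      then have "(\<Sum>j\<in>J. b j * x j) = 0" using b by auto
      then have "x k - (\<Sum>j\<in>J'. c j * x j) = 0" using b_split k(2) by simp
      then have *: "(\<Sum>j\<in>J. e j * x j) = (\<Sum>j\<in>J'. h e j * x j)" for e by (simp add: split)
      have xD: "x \<in> cell_of J s B" using x D(3) by blast
      show "x \<in> cell_of J' s' (h ` B)"
      proof (rule cell_ofI)
        show "x i = (\<Sum>j\<in>J'. s' i j * x j)" for i
          using cell_ofD[OF xD, of i] *[of "s i"] unfolding s'_def h_def by linarith
        show "0 < (\<Sum>j\<in>J'. e j * x j)" if "e \<in> h ` B" for e
          using that cell_of_pos[OF xD] by (auto simp: *)
      qed
    next
      assume x: "x \<in> cell_of J' s' (h ` B)"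
      have "x k = (\<Sum>j\<in>J'. s' k j * x j)" using x by (rule cell_ofD)
      also have "\<dots> = (\<Sum>j\<in>J'. c j * x j)"
      proof (rule sum.cong[OF refl])
        fix j assume "j \<in> J'"
        then have "s' k j = c j" using k D(1) by (auto simp: s'_def J'_def section_on_def)
        then show "s' k j * x j = c j * x j" by simp
      qed
      finally have xk: "x k - (\<Sum>j\<in>J'. c j * x j) = 0" by simp
      then have *: "(\<Sum>j\<in>J. e j * x j) = (\<Sum>j\<in>J'. h e j * x j)" for e by (simp add: split)
      have "x \<in> cell_of J s B"
      proof (rule cell_ofI)
        show "x i = (\<Sum>j\<in>J. s i j * x j)" for i
          using cell_ofD[OF x, of i] *[of "s i"] unfolding s'_def h_def by linarith
        show "0 < (\<Sum>j\<in>J. e j * x j)" if "e \<in> B" for e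
          using that cell_of_pos[OF x] by (auto simp: *)
      qed
      then have "x \<in> D" using D(3) by blast
      moreover have "f x = 0" using b[OF \<open>x \<in> D\<close>] b_split[of x] xk by simp
      ultimately show "x \<in> D \<inter> {x. f x = 0}" by blast
    qed
    then have "D \<inter> {x. f x = 0} = cell_of J' s' (h ` B)" by blast
    with \<open>section_on n J' s'\<close> D(2) show ?thesis
      unfolding cell_def is_cell_def
      by (intro exI[of _ "card J'"] exI[of _ J'] exI[of _ s'] exI[of _ "h ` B"]) simp
  qed
qed

section \<open>Subdivisions of cells\<close>

lemma refinable_mono: "refinable n P \<Longrightarrow> (\<And>E. cell n E \<Longrightarrow> P E \<Longrightarrow> Q E) \<Longrightarrow> refinable n Q"
  unfolding refinable_def by meson

lemma refinable_bind:
  assumes "refinable n P"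
    and Q: "\<And>D. cell n D \<Longrightarrow> P D \<Longrightarrow> \<exists>F. finite F \<and> D = \<Union>F \<and> (\<forall>E\<in>F. cell n E \<and> Q E)"
  shows "refinable n Q"
  unfolding refinable_def
proof (intro allI impI)
  fix D assume "cell n D"
  then obtain F where F: "finite F" "D = \<Union>F" "\<forall>E\<in>F. cell n E \<and> P E"
    using assms(1) unfolding refinable_def by auto
  have "\<forall>E\<in>F. \<exists>G. finite G \<and> E = \<Union>G \<and> (\<forall>E'\<in>G. cell n E' \<and> Q E')"
    using F(3) Q by auto
  from bchoice[OF this] obtain G where G: "\<forall>E\<in>F. finite (G E) \<and> E = \<Union>(G E) \<and> (\<forall>E'\<in>G E. cell n E' \<and> Q E')"
    by auto
  have "(\<Union>E\<in>F. E) = (\<Union>E\<in>F. \<Union>(G E))" using G by (intro SUP_cong refl) blast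
  then have "D = \<Union>(\<Union>E\<in>F. G E)" unfolding F(2) by blast
  moreover have "finite (\<Union>E\<in>F. G E)" using F(1) G by auto
  moreover have "\<forall>E'\<in>(\<Union>E\<in>F. G E). cell n E' \<and> Q E'" using G by auto
  ultimately show "\<exists>F. finite F \<and> D = \<Union>F \<and> (\<forall>E\<in>F. cell n E \<and> Q E)"
    by (intro exI[of _ "\<Union>E\<in>F. G E"]) simp
qed

text \<open>Heredity of \<open>P\<close> is what lets the two subdivisions be nested: the pieces
  made for \<open>Q\<close> are subsets of the pieces that satisfied \<open>P\<close>.\<close>

lemma refinable_conj:
  assumes "refinable n P" "refinable n Q" and hered: "\<And>D E. P D \<Longrightarrow> E \<subseteq> D \<Longrightarrow> P E"
  shows "refinable n (\<lambda>E. P E \<and> Q E)"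
proof (rule refinable_bind[OF assms(1)])
  fix D assume D: "cell n D" "P D"
  then obtain F where F: "finite F" "D = \<Union>F" "\<forall>E\<in>F. cell n E \<and> Q E"
    using assms(2) unfolding refinable_def by auto
  have "P E" if "E \<in> F" for E using hered[OF D(2), of E] F(2) that by auto
  with F show "\<exists>F. finite F \<and> D = \<Union>F \<and> (\<forall>E\<in>F. cell n E \<and> (P E \<and> Q E))"
    by (intro exI[of _ F]) simp
qed

definition signed_on :: "(nat \<Rightarrow> real) set \<Rightarrow> ((nat \<Rightarrow> real) \<Rightarrow> real) \<Rightarrow> bool" where
  "signed_on D f \<longleftrightarrow> (\<forall>x\<in>D. 0 < f x) \<or> (\<forall>x\<in>D. f x = 0) \<or> (\<forall>x\<in>D. f x < 0)"

lemma refinable_signed: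
  assumes "refinable n (\<lambda>E. lin_on n E f)"
  shows "refinable n (\<lambda>E. lin_on n E f \<and> signed_on E f)"
proof (rule refinable_bind[OF assms])
  fix D assume D: "cell n D" "lin_on n D f"
  have neg: "lin_on n D (\<lambda>x. 0 - f x)" by (intro lin_on_diff lin_on_zero D(2))
  let ?F = "{D \<inter> {x. 0 < f x}, D \<inter> {x. f x = 0}, D \<inter> {x. 0 < 0 - f x}}"
  have "D = \<Union>?F" by auto
  moreover have "cell n E \<and> lin_on n E f \<and> signed_on E f" if "E \<in> ?F" for E
  proof -
    have "cell n E"
      using that cell_Int_pos[OF D] cell_Int_zero[OF D] cell_Int_pos[OF D(1) neg] by auto
    moreover have "E \<subseteq> D" "signed_on E f" using that by (auto simp: signed_on_def)
    ultimately show ?thesis using lin_on_subset[OF D(2)] by simp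
  qed
  ultimately show "\<exists>F. finite F \<and> D = \<Union>F \<and> (\<forall>E\<in>F. cell n E \<and> lin_on n E f \<and> signed_on E f)"
    by (intro exI[of _ ?F]) simp
qed

lemma refinable_lin_diff:
  assumes "refinable n (\<lambda>E. lin_on n E f)" "refinable n (\<lambda>E. lin_on n E g)"
  shows "refinable n (\<lambda>E. lin_on n E f \<and> lin_on n E g \<and> signed_on E (\<lambda>x. f x - g x))"
proof -
  have *: "refinable n (\<lambda>E. lin_on n E f \<and> lin_on n E g)"
    using assms lin_on_subset by (rule refinable_conj)
  then have "refinable n (\<lambda>E. lin_on n E (\<lambda>x. f x - g x))"
    by (rule refinable_mono) (simp add: lin_on_diff)
  then have "refinable n (\<lambda>E. lin_on n E (\<lambda>x. f x - g x) \<and> signed_on E (\<lambda>x. f x - g x))"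
    by (rule refinable_signed)
  with * have "refinable n (\<lambda>E. (lin_on n E f \<and> lin_on n E g) \<and>
      lin_on n E (\<lambda>x. f x - g x) \<and> signed_on E (\<lambda>x. f x - g x))"
    by (rule refinable_conj) (auto intro: lin_on_subset)
  then show ?thesis by (rule refinable_mono) simp
qed

text \<open>Piecewise linearity of terms. A truncated difference is linear as soon as the sign of
  the difference is constant: it is then the difference itself or 0.\<close>

lemma refinable_term_lin:
  "term_vars t \<subseteq> {..<n} \<Longrightarrow> refinable n (\<lambda>E. lin_on n E (\<lambda>x. term_eval x t))"
proof (induction t)
  case (HVar i)
  then show ?case
    unfolding refinable_def by (auto intro!: exI[of _ "{D}" for D] lin_on_coordinate)
next
  case HZero
  then show ?case
    unfolding refinable_def by (auto intro!: exI[of _ "{D}" for D] lin_on_zero)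
next
  case (HPlus s t)
  then have "refinable n (\<lambda>E. lin_on n E (\<lambda>x. term_eval x s) \<and> lin_on n E (\<lambda>x. term_eval x t))"
    by (intro refinable_conj) (auto intro: lin_on_subset)
  then show ?case by (rule refinable_mono) (simp add: lin_on_add)
next
  case (HMonus s t)
  then have "refinable n (\<lambda>E. lin_on n E (\<lambda>x. term_eval x s) \<and> lin_on n E (\<lambda>x. term_eval x t) \<and>
      signed_on E (\<lambda>x. term_eval x s - term_eval x t))"
    by (intro refinable_lin_diff) auto
  then show ?case
  proof (rule refinable_mono)
    fix E
    assume E: "lin_on n E (\<lambda>x. term_eval x s) \<and> lin_on n E (\<lambda>x. term_eval x t) \<and>
      signed_on E (\<lambda>x. term_eval x s - term_eval x t)"
    then have diff: "lin_on n E (\<lambda>x. term_eval x s - term_eval x t)" by (simp add: lin_on_diff)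
    from E consider "\<forall>x\<in>E. 0 < term_eval x s - term_eval x t" | "\<forall>x\<in>E. term_eval x s - term_eval x t \<le> 0"
      unfolding signed_on_def by force
    then show "lin_on n E (\<lambda>x. term_eval x (HMonus s t))"
    proof cases
      case 1
      then show ?thesis by (intro lin_on_cong[OF _ diff]) auto
    next
      case 2
      then show ?thesis by (intro lin_on_cong[OF _ lin_on_zero]) auto
    qed
  qed
qed

definition decided_on :: "(nat \<Rightarrow> real) set \<Rightarrow> ((nat \<Rightarrow> real) \<Rightarrow> bool) \<Rightarrow> bool" where
  "decided_on D p \<longleftrightarrow> (\<forall>x\<in>D. p x) \<or> (\<forall>x\<in>D. \<not> p x)"

lemma refinable_decided_all:
  assumes "finite Ps" "\<And>p. p \<in> Ps \<Longrightarrow> refinable n (\<lambda>E. decided_on E p)"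
  shows "refinable n (\<lambda>E. \<forall>p\<in>Ps. decided_on E p)"
  using assms
proof (induction Ps rule: finite_induct)
  case empty
  then show ?case unfolding refinable_def by (auto intro!: exI[of _ "{D}" for D])
next
  case (insert p Ps)
  then have "refinable n (\<lambda>E. decided_on E p \<and> (\<forall>p\<in>Ps. decided_on E p))"
    by (intro refinable_conj) (auto simp: decided_on_def)
  then show ?case by (rule refinable_mono) simp
qed

definition solution_cone :: "nat \<Rightarrow> (hoop_term \<times> hoop_term) set \<Rightarrow> (nat \<Rightarrow> real) set" where
  "solution_cone n R = {x. (\<forall>i<n. 0 \<le> x i) \<and> (\<forall>i\<ge>n. x i = 0) \<and>
     (\<forall>(s, t)\<in>R. term_eval x s = term_eval x t)}"

text \<open>All conditions that define the cone get a constant truth value on the pieces of one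
  common subdivision of the space of the first \<open>n\<close> coordinates; the cone consists of
  the pieces on which all of them hold.\<close>

theorem solution_cone_cells:
  assumes "finite R" "\<And>s t. (s, t) \<in> R \<Longrightarrow> term_vars s \<subseteq> {..<n} \<and> term_vars t \<subseteq> {..<n}"
  shows "\<exists>F. finite F \<and> (\<forall>D\<in>F. cell n D) \<and> solution_cone n R = \<Union>F"
proof -
  define Ps where "Ps = (\<lambda>i x. 0 \<le> x i) ` {..<n} \<union> (\<lambda>(s, t) x. term_eval x s = term_eval x t) ` R"
  have ref: "refinable n (\<lambda>E. \<forall>p\<in>Ps. decided_on E p)"
  proof (rule refinable_decided_all)
    fix p assume "p \<in> Ps"
    then consider i where "i < n" "p = (\<lambda>x. 0 \<le> x i)"
      | s t where "(s, t) \<in> R" "p = (\<lambda>x. term_eval x s = term_eval x t)"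
      unfolding Ps_def by (elim UnE imageE) (auto split: prod.splits)
    then show "refinable n (\<lambda>E. decided_on E p)"
    proof cases
      case 1
      then have "refinable n (\<lambda>E. lin_on n E (\<lambda>x. x i) \<and> signed_on E (\<lambda>x. x i))"
        using refinable_signed[OF refinable_term_lin[of "HVar i" n]] by simp
      then show ?thesis
        by (rule refinable_mono) (auto simp: signed_on_def decided_on_def 1 not_le)
    next
      case 2
      then have "refinable n (\<lambda>E. lin_on n E (\<lambda>x. term_eval x s) \<and> lin_on n E (\<lambda>x. term_eval x t) \<and>
          signed_on E (\<lambda>x. term_eval x s - term_eval x t))"
        using assms(2) by (intro refinable_lin_diff refinable_term_lin) auto
      then show ?thesis
        by (rule refinable_mono) (force simp: signed_on_def decided_on_def 2)
    qed
  qed (use assms(1) in \<open>simp add: Ps_def\<close>)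
  have "\<exists>F. finite F \<and> {x. \<forall>i\<ge>n. x i = 0} = \<Union>F \<and> (\<forall>E\<in>F. cell n E \<and> (\<forall>p\<in>Ps. decided_on E p))"
    by (rule ref[unfolded refinable_def, THEN spec, THEN mp, OF cell_full])
  then obtain F where F: "finite F" "{x. \<forall>i\<ge>n. x i = 0} = \<Union>F"
      "\<forall>E\<in>F. cell n E \<and> (\<forall>p\<in>Ps. decided_on E p)"
    by (elim exE conjE)
  define G where "G = {E\<in>F. \<forall>x\<in>E. \<forall>p\<in>Ps. p x}"
  have C: "x \<in> solution_cone n R \<longleftrightarrow> x \<in> \<Union>F \<and> (\<forall>p\<in>Ps. p x)" for x
  proof -
    have "(\<forall>p\<in>Ps. p x) \<longleftrightarrow> (\<forall>i\<in>{..<n}. 0 \<le> x i) \<and> (\<forall>(s, t)\<in>R. term_eval x s = term_eval x t)"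
      unfolding Ps_def by (simp add: ball_Un split_beta)
    moreover have "(\<forall>i\<in>{..<n}. 0 \<le> x i) \<longleftrightarrow> (\<forall>i<n. 0 \<le> x i)" by auto
    moreover have "x \<in> \<Union>F \<longleftrightarrow> (\<forall>i\<ge>n. x i = 0)" by (simp flip: F(2))
    ultimately show ?thesis unfolding solution_cone_def mem_Collect_eq by argo
  qed
  have "solution_cone n R = \<Union>G"
  proof (intro equalityI subsetI)
    fix x assume x: "x \<in> solution_cone n R"
    then obtain E where E: "E \<in> F" "x \<in> E" unfolding C by (elim conjE UnionE)
    have "p y" if "p \<in> Ps" "y \<in> E" for p y
    proof -
      have "decided_on E p" using F(3) E(1) that(1) by blast
      moreover have "p x" using x that(1) unfolding C by blast
      ultimately show ?thesis using E(2) that(2) unfolding decided_on_def by blast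
    qed
    then have "E \<in> G" using E(1) unfolding G_def by blast
    with E(2) show "x \<in> \<Union>G" by (rule UnionI[rotated])
  next
    fix x assume "x \<in> \<Union>G"
    then obtain E where E: "E \<in> G" "x \<in> E" by (rule UnionE)
    then have "E \<in> F" "\<forall>p\<in>Ps. p x" by (auto simp: G_def)
    then show "x \<in> solution_cone n R" using E(2) by (auto simp: C)
  qed
  moreover have "finite G" "\<forall>D\<in>G. cell n D" using F(1,3) by (simp_all add: G_def)
  ultimately show ?thesis by (intro exI[of _ G]) simp
qed

section \<open>Integer points deep inside a cell\<close>

lemma common_denominator:
  assumes "finite Q" "Q \<subseteq> \<rat>"
  shows "\<exists>N::nat. 0 < N \<and> (\<forall>q\<in>Q. real N * q \<in> \<int>)"
  using assms
proof (induction Q rule: finite_induct)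
  case empty
  then show ?case by (intro exI[of _ 1]) simp
next
  case (insert q Q)
  then obtain N where N: "0 < N" "\<forall>q\<in>Q. real N * q \<in> \<int>" by auto
  have "q \<in> \<rat>" using insert.prems by simp
  then obtain a b where "b > 0" "q = of_int a / of_int b" by (rule Rats_cases')
  then have "real (nat b) * q = of_int a" by simp
  have "real (N * nat b) * r \<in> \<int>" if "r \<in> insert q Q" for r
  proof (cases "r = q")
    case True
    then have "real (N * nat b) * r = of_int (int N * a)"
      using \<open>real (nat b) * q = of_int a\<close> by (simp add: mult.assoc)
    then show ?thesis by (metis Ints_of_int)
  next
    case False
    then have "real N * r \<in> \<int>" using N(2) that by blast
    then have "real (nat b) * (real N * r) \<in> \<int>" by (rule Ints_mult[OF Ints_of_nat])
    then show ?thesis by (simp add: mult_ac)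
  qed
  then show ?case using N(1) \<open>b > 0\<close> by (intro exI[of _ "N * nat b"]) simp
qed

text \<open>The vector \<open>w\<close> can be taken integral because a large multiple of a point satisfies the strict
  inequalities with a margin that exceeds every rounding error.\<close>

lemma is_cell_inner:
  assumes "is_cell n m D" "D \<noteq> {}" and nonneg: "\<forall>x\<in>D. \<forall>i. 0 \<le> x i"
  shows "\<exists>J s N w. section_on n J s \<and> card J = m \<and> 0 < (N::nat) \<and>
    (\<forall>i. \<forall>j\<in>J. real N * s i j \<in> \<int>) \<and>
    (\<forall>T a. 0 < T \<longrightarrow> (\<forall>j\<in>J. 0 \<le> a j \<and> a j \<le> T) \<longrightarrow>
       (\<lambda>i. \<Sum>j\<in>J. s i j * (T * real (w j :: nat) + a j)) \<in> D)"
proof -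
  obtain J s B where D: "section_on n J s" "card J = m" "finite B" "D = cell_of J s B"
    using assms(1) unfolding is_cell_def by auto
  have finJ: "finite J" using D(1) finite_subset unfolding section_on_def by blast
  obtain z where z: "z \<in> D" using assms(2) by auto
  define nb where "nb b = (\<Sum>j\<in>J. \<bar>b j\<bar>)" for b :: "nat \<Rightarrow> real"
  define vb where "vb b = (\<Sum>j\<in>J. b j * z j)" for b :: "nat \<Rightarrow> real"
  have vb: "0 < vb b" if "b \<in> B" for b using cell_of_pos[of z J s B b] z that by (simp add: D(4) vb_def)
  have nb: "0 \<le> nb b" for b by (simp add: nb_def sum_nonneg)
  \<comment> \<open>Scaling \<open>z\<close> by \<open>l\<close> lifts every form in
    \<open>B\<close> above \<open>2 * nb b\<close>: one \<open>nb b\<close> pays for rounding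
    \<open>l * z\<close> to \<open>w\<close>, the other, times \<open>T\<close>, for the
    displacement \<open>a\<close>. The sum over \<open>B\<close> stands in for a maximum.\<close>
  define l where "l = (\<Sum>b\<in>B. (2 * nb b + 1) / vb b)"
  have l: "2 * nb b < l * vb b" if "b \<in> B" for b
  proof -
    have "(2 * nb b + 1) / vb b \<le> l"
      unfolding l_def using nb vb that D(3)
      by (intro member_le_sum) (auto intro!: divide_nonneg_pos add_nonneg_nonneg)
    then have "2 * nb b + 1 \<le> l * vb b" using vb[OF that] by (simp add: pos_divide_le_eq)
    then show ?thesis by simp
  qed
  have "0 \<le> l" unfolding l_def using nb vb by (intro sum_nonneg) (auto intro!: divide_nonneg_pos add_nonneg_nonneg)
  define w where "w j = nat \<lfloor>l * z j\<rfloor>" for j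
  have w: "\<bar>real (w j) - l * z j\<bar> \<le> 1" for j
  proof -
    have "0 \<le> l * z j" using \<open>0 \<le> l\<close> nonneg z by simp
    then have "real (w j) = of_int \<lfloor>l * z j\<rfloor>" by (simp add: w_def)
    then show ?thesis by linarith
  qed
  have bound: "\<bar>\<Sum>j\<in>J. b j * v j\<bar> \<le> T * nb b" if "\<And>j. j \<in> J \<Longrightarrow> \<bar>v j\<bar> \<le> T" for b v T
  proof -
    have "\<bar>\<Sum>j\<in>J. b j * v j\<bar> \<le> (\<Sum>j\<in>J. \<bar>b j * v j\<bar>)" by (rule sum_abs)
    also have "\<dots> \<le> (\<Sum>j\<in>J. T * \<bar>b j\<bar>)"
    proof (rule sum_mono)
      fix j assume "j \<in> J"
      then have "\<bar>b j\<bar> * \<bar>v j\<bar> \<le> \<bar>b j\<bar> * T" by (intro mult_left_mono that) auto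
      then show "\<bar>b j * v j\<bar> \<le> T * \<bar>b j\<bar>" by (simp add: abs_mult mult.commute)
    qed
    finally show ?thesis by (simp add: nb_def sum_distrib_left)
  qed
  have wpos: "nb b < (\<Sum>j\<in>J. b j * real (w j))" if "b \<in> B" for b
  proof -
    have "(\<Sum>j\<in>J. b j * real (w j)) = l * vb b + (\<Sum>j\<in>J. b j * (real (w j) - l * z j))"
      by (simp add: vb_def algebra_simps sum_subtractf sum_distrib_left)
    moreover have "\<bar>\<Sum>j\<in>J. b j * (real (w j) - l * z j)\<bar> \<le> 1 * nb b"
      using w by (intro bound) auto
    ultimately show ?thesis using l[OF that] by simp
  qed
  have inD: "(\<lambda>i. \<Sum>j\<in>J. s i j * (T * real (w j) + a j)) \<in> D"
    if T: "0 < T" and a: "\<And>j. j \<in> J \<Longrightarrow> 0 \<le> a j \<and> a j \<le> T" for T a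
  proof -
    define y where "y j = T * real (w j) + a j" for j
    define x where "x i = (\<Sum>j\<in>J. s i j * y j)" for i
    have xy: "x j = y j" if j: "j \<in> J" for j
    proof -
      have "x j = (\<Sum>i\<in>J. if j = i then y i else 0)"
        unfolding x_def using D(1) j by (intro sum.cong) (auto simp: section_on_def)
      then show ?thesis using finJ j by simp
    qed
    have "x \<in> cell_of J s B"
    proof (rule cell_ofI)
      show "x i = (\<Sum>j\<in>J. s i j * x j)" for i
        unfolding x_def[of i] by (intro sum.cong refl) (simp add: xy)
      fix b assume b: "b \<in> B"
      have "(\<Sum>j\<in>J. b j * x j) = (\<Sum>j\<in>J. b j * y j)"
        by (intro sum.cong refl) (simp add: xy)
      also have "\<dots> = T * (\<Sum>j\<in>J. b j * real (w j)) + (\<Sum>j\<in>J. b j * a j)"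
        by (simp add: y_def algebra_simps sum.distrib sum_distrib_left)
      finally have "(\<Sum>j\<in>J. b j * x j) = T * (\<Sum>j\<in>J. b j * real (w j)) + (\<Sum>j\<in>J. b j * a j)" .
      moreover have "\<bar>\<Sum>j\<in>J. b j * a j\<bar> \<le> T * nb b"
      proof (rule bound)
        show "\<bar>a j\<bar> \<le> T" if "j \<in> J" for j using a[OF that] by simp
      qed
      moreover have "T * nb b < T * (\<Sum>j\<in>J. b j * real (w j))" using wpos[OF b] T by simp
      ultimately show "0 < (\<Sum>j\<in>J. b j * x j)" by linarith
    qed
    moreover have "x = (\<lambda>i. \<Sum>j\<in>J. s i j * (T * real (w j) + a j))"
      by (simp add: x_def y_def fun_eq_iff)
    ultimately show ?thesis unfolding D(4) by simp
  qed
  have "finite ((\<lambda>(i, j). s i j) ` ({..<n} \<times> J))" using finJ by simp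
  moreover have "(\<lambda>(i, j). s i j) ` ({..<n} \<times> J) \<subseteq> \<rat>" using D(1) by (auto simp: section_on_def)
  ultimately have "\<exists>N::nat. 0 < N \<and> (\<forall>q\<in>(\<lambda>(i, j). s i j) ` ({..<n} \<times> J). real N * q \<in> \<int>)"
    by (rule common_denominator)
  then obtain N :: nat where N: "0 < N" "\<forall>q\<in>(\<lambda>(i, j). s i j) ` ({..<n} \<times> J). real N * q \<in> \<int>"
    by (elim exE conjE)
  have "real N * s i j \<in> \<int>" if "j \<in> J" for i j
  proof (cases "i < n")
    case True
    then show ?thesis using N(2) that by auto
  next
    case False
    then show ?thesis using D(1) that by (simp add: section_on_def)
  qed
  with D(1,2) N(1) inD show ?thesis
    by (intro exI[of _ J] exI[of _ s] exI[of _ N] exI[of _ w] conjI allI ballI impI) auto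
qed

section \<open>Homomorphisms of a finitely presented hoop\<close>

lemma hoop_hom_real_iff:
  "f \<in> hoop_hom A nonneg_real_hoop \<longleftrightarrow> (\<forall>a\<in>carrier A. 0 \<le> f a) \<and> f \<one>\<^bsub>A\<^esub> = 0 \<and>
     (\<forall>a\<in>carrier A. \<forall>b\<in>carrier A. f (a \<otimes>\<^bsub>A\<^esub> b) = f a + f b \<and>
        f (a \<setminus>\<^bsub>A\<^esub> b) = max 0 (f a - f b))"
  by (auto simp: hoop_hom_def hom_def nonneg_real_hoop_def)

lemma hoop_quotient_class_ops:
  assumes "hoop_congruence A \<theta>" "a \<in> carrier A" "b \<in> carrier A"
  shows "\<theta> `` {a} \<otimes>\<^bsub>hoop_quotient A \<theta>\<^esub> \<theta> `` {b} = \<theta> `` {a \<otimes>\<^bsub>A\<^esub> b}"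
    and "\<theta> `` {a} \<setminus>\<^bsub>hoop_quotient A \<theta>\<^esub> \<theta> `` {b} = \<theta> `` {a \<setminus>\<^bsub>A\<^esub> b}"
proof -
  have eq: "equiv (carrier A) \<theta>"
    and cong: "\<And>x x' y y'. (x, x') \<in> \<theta> \<Longrightarrow> (y, y') \<in> \<theta> \<Longrightarrow>
        (x \<otimes>\<^bsub>A\<^esub> y, x' \<otimes>\<^bsub>A\<^esub> y') \<in> \<theta> \<and> (x \<setminus>\<^bsub>A\<^esub> y, x' \<setminus>\<^bsub>A\<^esub> y') \<in> \<theta>"
    using assms(1) unfolding hoop_congruence_def by auto
  have self: "a \<in> \<theta> `` {a}" "b \<in> \<theta> `` {b}"
    using equiv_class_self[OF eq] assms(2,3) by auto
  have *: "(\<Union>x\<in>\<theta> `` {a}. \<Union>y\<in>\<theta> `` {b}. \<theta> `` {h x y}) = \<theta> `` {h a b}"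
    if h: "\<And>x y. (a, x) \<in> \<theta> \<Longrightarrow> (b, y) \<in> \<theta> \<Longrightarrow> (h a b, h x y) \<in> \<theta>" for h
  proof -
    have "\<theta> `` {h x y} = \<theta> `` {h a b}" if "x \<in> \<theta> `` {a}" "y \<in> \<theta> `` {b}" for x y
      using equiv_class_eq[OF eq h[of x y]] that by auto
    then show ?thesis using self by blast
  qed
  show "\<theta> `` {a} \<otimes>\<^bsub>hoop_quotient A \<theta>\<^esub> \<theta> `` {b} = \<theta> `` {a \<otimes>\<^bsub>A\<^esub> b}"
    using *[of "mult A"] cong by (simp add: hoop_quotient_def)
  show "\<theta> `` {a} \<setminus>\<^bsub>hoop_quotient A \<theta>\<^esub> \<theta> `` {b} = \<theta> `` {a \<setminus>\<^bsub>A\<^esub> b}"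
    using *[of "monus A"] cong by (simp add: hoop_quotient_def)
qed

text \<open>Reflexivity does the work: the pair of \<open>a \<otimes> b\<close> with itself is in
  \<open>\<theta>\<close>, and \<open>\<theta>\<close> lives on the carrier.\<close>

lemma hoop_congruence_closed:
  assumes "hoop_congruence A \<theta>" "a \<in> carrier A" "b \<in> carrier A"
  shows "a \<otimes>\<^bsub>A\<^esub> b \<in> carrier A" "a \<setminus>\<^bsub>A\<^esub> b \<in> carrier A"
proof -
  have eq: "equiv (carrier A) \<theta>" using assms(1) unfolding hoop_congruence_def by auto
  then have "(a, a) \<in> \<theta>" "(b, b) \<in> \<theta>" using assms(2,3) by (auto simp: equiv_def refl_on_def)
  then have "(a \<otimes>\<^bsub>A\<^esub> b, a \<otimes>\<^bsub>A\<^esub> b) \<in> \<theta> \<and> (a \<setminus>\<^bsub>A\<^esub> b, a \<setminus>\<^bsub>A\<^esub> b) \<in> \<theta>"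
    using assms(1) unfolding hoop_congruence_def by blast
  then show "a \<otimes>\<^bsub>A\<^esub> b \<in> carrier A" "a \<setminus>\<^bsub>A\<^esub> b \<in> carrier A"
    using equiv_type[OF eq] by auto
qed

definition map_kernel :: "('a, 'm) hoop_scheme \<Rightarrow> ('a \<Rightarrow> real) \<Rightarrow> ('a \<times> 'a) set" where
  "map_kernel A f = {(a, b). a \<in> carrier A \<and> b \<in> carrier A \<and> f a = f b}"

lemma hoop_congruence_map_kernel:
  assumes f: "f \<in> hoop_hom A nonneg_real_hoop"
    and cl: "\<And>a b. a \<in> carrier A \<Longrightarrow> b \<in> carrier A \<Longrightarrow> a \<otimes>\<^bsub>A\<^esub> b \<in> carrier A \<and> a \<setminus>\<^bsub>A\<^esub> b \<in> carrier A"
  shows "hoop_congruence A (map_kernel A f)"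
proof -
  have "equiv (carrier A) (map_kernel A f)"
    by (rule equivI) (auto simp: map_kernel_def refl_on_def sym_def trans_def)
  moreover have "(x \<otimes>\<^bsub>A\<^esub> y, x' \<otimes>\<^bsub>A\<^esub> y') \<in> map_kernel A f \<and> (x \<setminus>\<^bsub>A\<^esub> y, x' \<setminus>\<^bsub>A\<^esub> y') \<in> map_kernel A f"
    if "(x, x') \<in> map_kernel A f" "(y, y') \<in> map_kernel A f" for x x' y y'
    using that f cl by (simp add: map_kernel_def hoop_hom_real_iff)
  ultimately show ?thesis unfolding hoop_congruence_def by simp
qed

text \<open>The family has to be nonempty, since the intersection of no relations is the universal
  relation on the type, which is not confined to the carrier.\<close>

lemma hoop_congruence_Inter:
  assumes "\<Theta> \<noteq> {}" and cong: "\<And>\<theta>. \<theta> \<in> \<Theta> \<Longrightarrow> hoop_congruence A \<theta>"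
  shows "hoop_congruence A (\<Inter>\<Theta>)"
proof -
  obtain \<theta>0 where "\<theta>0 \<in> \<Theta>" using assms(1) by auto
  have eq: "equiv (carrier A) \<theta>" if "\<theta> \<in> \<Theta>" for \<theta>
    using cong[OF that] by (simp add: hoop_congruence_def)
  have "equiv (carrier A) (\<Inter>\<Theta>)"
  proof (rule equivI)
    show "\<Inter>\<Theta> \<subseteq> carrier A \<times> carrier A" using equiv_type[OF eq[OF \<open>\<theta>0 \<in> \<Theta>\<close>]] \<open>\<theta>0 \<in> \<Theta>\<close> by auto
    show "refl_on (carrier A) (\<Inter>\<Theta>)"
      using eq by (auto simp: refl_on_def equiv_def)
    show "sym (\<Inter>\<Theta>)"
    proof (intro symI InterI)
      fix x y \<theta> assume "(x, y) \<in> \<Inter>\<Theta>" "\<theta> \<in> \<Theta>"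
      then show "(y, x) \<in> \<theta>" using eq[of \<theta>] by (auto simp: equiv_def dest: symD)
    qed
    show "trans (\<Inter>\<Theta>)"
    proof (intro transI InterI)
      fix x y z \<theta> assume "(x, y) \<in> \<Inter>\<Theta>" "(y, z) \<in> \<Inter>\<Theta>" "\<theta> \<in> \<Theta>"
      then show "(x, z) \<in> \<theta>" using eq[of \<theta>] by (auto simp: equiv_def dest: transD)
    qed
  qed
  moreover have "(x \<otimes>\<^bsub>A\<^esub> y, x' \<otimes>\<^bsub>A\<^esub> y') \<in> \<Inter>\<Theta> \<and> (x \<setminus>\<^bsub>A\<^esub> y, x' \<setminus>\<^bsub>A\<^esub> y') \<in> \<Inter>\<Theta>"
    if "(x, x') \<in> \<Inter>\<Theta>" "(y, y') \<in> \<Inter>\<Theta>" for x x' y y'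
    using that cong unfolding hoop_congruence_def by auto
  ultimately show ?thesis unfolding hoop_congruence_def by simp
qed

lemma hoop_hom_factor:
  assumes cong: "hoop_congruence A \<theta>" and f: "f \<in> hoop_hom A nonneg_real_hoop"
    and one: "\<one>\<^bsub>A\<^esub> \<in> carrier A" and ker: "\<And>a b. (a, b) \<in> \<theta> \<Longrightarrow> f a = f b"
  shows "\<exists>g\<in>hoop_hom (hoop_quotient A \<theta>) nonneg_real_hoop. \<forall>a\<in>carrier A. g (\<theta> `` {a}) = f a"
proof -
  have eq: "equiv (carrier A) \<theta>" using cong unfolding hoop_congruence_def by simp
  define g where "g X = f (SOME a. a \<in> X)" for X
  have g: "g (\<theta> `` {a}) = f a" if "a \<in> carrier A" for a
  proof -
    have "(SOME b. b \<in> \<theta> `` {a}) \<in> \<theta> `` {a}"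
      using equiv_class_self[OF eq that] by (rule someI)
    then show ?thesis using ker by (simp add: g_def)
  qed
  have "g \<in> hoop_hom (hoop_quotient A \<theta>) nonneg_real_hoop"
    unfolding hoop_hom_real_iff
  proof (intro conjI ballI)
    show "g \<one>\<^bsub>hoop_quotient A \<theta>\<^esub> = 0"
      using g[OF one] f by (simp add: hoop_quotient_def hoop_hom_real_iff)
    fix X assume "X \<in> carrier (hoop_quotient A \<theta>)"
    then obtain a where a: "a \<in> carrier A" "X = \<theta> `` {a}"
      by (auto simp: hoop_quotient_def quotient_def)
    then show "0 \<le> g X" using g f by (simp add: hoop_hom_real_iff)
    fix Y assume "Y \<in> carrier (hoop_quotient A \<theta>)"
    then obtain b where b: "b \<in> carrier A" "Y = \<theta> `` {b}"
      by (auto simp: hoop_quotient_def quotient_def)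
    note cl = hoop_congruence_closed[OF cong a(1) b(1)]
    show "g (X \<otimes>\<^bsub>hoop_quotient A \<theta>\<^esub> Y) = g X + g Y"
      unfolding a(2) b(2) hoop_quotient_class_ops(1)[OF cong a(1) b(1)]
      using g a(1) b(1) cl f by (simp add: hoop_hom_real_iff)
    show "g (X \<setminus>\<^bsub>hoop_quotient A \<theta>\<^esub> Y) = max 0 (g X - g Y)"
      unfolding a(2) b(2) hoop_quotient_class_ops(2)[OF cong a(1) b(1)]
      using g a(1) b(1) cl f by (simp add: hoop_hom_real_iff)
  qed
  with g show ?thesis by (intro bexI[of _ g]) auto
qed

text \<open>The axioms are equations valid for nonnegative reals, so an injective homomorphism pulls
  them back.\<close>

lemma cancellative_hoop_of_embedding:
  assumes f: "f \<in> hoop_hom Q nonneg_real_hoop" and inj: "inj_on f (carrier Q)"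
    and one: "\<one>\<^bsub>Q\<^esub> \<in> carrier Q"
    and cl: "\<And>a b. a \<in> carrier Q \<Longrightarrow> b \<in> carrier Q \<Longrightarrow> a \<otimes>\<^bsub>Q\<^esub> b \<in> carrier Q \<and> a \<setminus>\<^bsub>Q\<^esub> b \<in> carrier Q"
  shows "cancellative_hoop Q"
proof -
  have fp: "f (a \<otimes>\<^bsub>Q\<^esub> b) = f a + f b" "f (a \<setminus>\<^bsub>Q\<^esub> b) = max 0 (f a - f b)"
    if "a \<in> carrier Q" "b \<in> carrier Q" for a b
    using f that by (simp_all add: hoop_hom_real_iff)
  have f1: "f \<one>\<^bsub>Q\<^esub> = 0" and f0: "\<And>a. a \<in> carrier Q \<Longrightarrow> 0 \<le> f a"
    using f by (simp_all add: hoop_hom_real_iff)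
  have c1: "a \<otimes>\<^bsub>Q\<^esub> b \<in> carrier Q" "a \<setminus>\<^bsub>Q\<^esub> b \<in> carrier Q"
    if "a \<in> carrier Q" "b \<in> carrier Q" for a b using cl that by auto
  have max_monus: "max 0 (max 0 (p - q) - r) = max 0 (p - (q + r))" if "0 \<le> r" for p q r :: real
    using that by (simp add: max_def)
  have max_swap: "p + max 0 (q - p) = q + max 0 (p - q)" for p q :: real
    by (simp add: max_def)
  show ?thesis
    by unfold_locales
      (auto intro!: inj_onD[OF inj] simp: fp f1 f0 c1 one max_monus max_swap)
qed

text \<open>This makes the kernel of every real-valued homomorphism of the term algebra one of the
  congruences that \<open>free_hoop\<close> intersects, so that evaluation at a point factors
  through the free hoop.\<close>

lemma cancellative_hoop_quotient_map_kernel: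
  assumes f: "f \<in> hoop_hom A nonneg_real_hoop" and one: "\<one>\<^bsub>A\<^esub> \<in> carrier A"
    and cl: "\<And>a b. a \<in> carrier A \<Longrightarrow> b \<in> carrier A \<Longrightarrow> a \<otimes>\<^bsub>A\<^esub> b \<in> carrier A \<and> a \<setminus>\<^bsub>A\<^esub> b \<in> carrier A"
  shows "cancellative_hoop (hoop_quotient A (map_kernel A f))"
proof -
  let ?\<theta> = "map_kernel A f" and ?Q = "hoop_quotient A (map_kernel A f)"
  have cong: "hoop_congruence A ?\<theta>" using f cl by (rule hoop_congruence_map_kernel)
  then have eq: "equiv (carrier A) ?\<theta>" unfolding hoop_congruence_def by simp
  obtain g where g: "g \<in> hoop_hom ?Q nonneg_real_hoop" "\<forall>a\<in>carrier A. g (?\<theta> `` {a}) = f a"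
    using hoop_hom_factor[OF cong f one] by (auto simp: map_kernel_def)
  have elem: "\<exists>a\<in>carrier A. X = ?\<theta> `` {a}" if "X \<in> carrier ?Q" for X
    using that by (auto simp: hoop_quotient_def quotient_def)
  have mem: "?\<theta> `` {a} \<in> carrier ?Q" if "a \<in> carrier A" for a
    using that by (auto simp: hoop_quotient_def quotient_def)
  show ?thesis
  proof (rule cancellative_hoop_of_embedding[OF g(1)])
    show "inj_on g (carrier ?Q)"
    proof (rule inj_onI)
      fix X Y assume X: "X \<in> carrier ?Q" and Y: "Y \<in> carrier ?Q" and gXY: "g X = g Y"
      obtain a where a: "a \<in> carrier A" "X = ?\<theta> `` {a}" using elem[OF X] by auto
      obtain b where b: "b \<in> carrier A" "Y = ?\<theta> `` {b}" using elem[OF Y] by auto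
      have "f a = f b" using gXY g(2) a b by simp
      then have "(a, b) \<in> ?\<theta>" using a b by (simp add: map_kernel_def)
      then show "X = Y" using equiv_class_eq[OF eq] a b by simp
    qed
    show "\<one>\<^bsub>?Q\<^esub> \<in> carrier ?Q" using mem[OF one] by (simp add: hoop_quotient_def)
    fix X Y assume X: "X \<in> carrier ?Q" and Y: "Y \<in> carrier ?Q"
    obtain a where a: "a \<in> carrier A" "X = ?\<theta> `` {a}" using elem[OF X] by auto
    obtain b where b: "b \<in> carrier A" "Y = ?\<theta> `` {b}" using elem[OF Y] by auto
    show "X \<otimes>\<^bsub>?Q\<^esub> Y \<in> carrier ?Q \<and> X \<setminus>\<^bsub>?Q\<^esub> Y \<in> carrier ?Q"
      unfolding a(2) b(2) hoop_quotient_class_ops[OF cong a(1) b(1)]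
      using mem cl[OF a(1) b(1)] by simp
  qed
qed

text \<open>All that is used of a finite presentation. \<open>rep\<close> names elements by terms
  and respects \<open>R\<close>; conversely, by \<open>eval_cong\<close>, terms naming the same
  element agree at each point of the cone, so points give real-valued homomorphisms.\<close>

locale presented_hoop = cancellative_hoop H for H :: "'a hoop" (structure) +
  fixes n :: nat and R :: "(hoop_term \<times> hoop_term) set" and rep :: "hoop_term \<Rightarrow> 'a"
  assumes finite_R: "finite R"
    and R_vars: "\<And>s t. (s, t) \<in> R \<Longrightarrow> term_vars s \<subseteq> {..<n} \<and> term_vars t \<subseteq> {..<n}"
    and rep_surj: "rep ` {t. term_vars t \<subseteq> {..<n}} = carrier H"
    and rep_zero: "rep HZero = \<one>"
    and rep_plus: "\<And>s t. term_vars s \<subseteq> {..<n} \<Longrightarrow> term_vars t \<subseteq> {..<n} \<Longrightarrow>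
          rep (HPlus s t) = rep s \<otimes> rep t"
    and rep_monus: "\<And>s t. term_vars s \<subseteq> {..<n} \<Longrightarrow> term_vars t \<subseteq> {..<n} \<Longrightarrow>
          rep (HMonus s t) = rep s \<setminus> rep t"
    and rep_R: "\<And>s t. (s, t) \<in> R \<Longrightarrow> rep s = rep t"
    and eval_cong: "\<And>x s t. x \<in> solution_cone n R \<Longrightarrow> term_vars s \<subseteq> {..<n} \<Longrightarrow>
          term_vars t \<subseteq> {..<n} \<Longrightarrow> rep s = rep t \<Longrightarrow> term_eval x s = term_eval x t"

lemma term_eval_hoop_hom:
  assumes "\<And>i. i < n \<Longrightarrow> 0 \<le> x i"
  shows "term_eval x \<in> hoop_hom (term_algebra n) nonneg_real_hoop"
proof -
  have "0 \<le> term_eval x t" if "term_vars t \<subseteq> {..<n}" for t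
    using that assms by (induction t) auto
  then show ?thesis by (simp add: hoop_hom_real_iff term_algebra_def)
qed

theorem finitely_presented_imp_presented_hoop:
  fixes H :: "'a hoop"
  assumes H: "cancellative_hoop H" and fp: "finitely_presented H"
  shows "\<exists>n R rep. presented_hoop H n R rep"
proof -
  obtain n R0 where R0: "finite R0" "R0 \<subseteq> carrier (free_hoop n) \<times> carrier (free_hoop n)"
    and iso: "hoop_isomorphic H (hoop_quotient (free_hoop n) (generated_congruence (free_hoop n) R0))"
    using fp unfolding finitely_presented_def by (elim exE conjE)
  define T where "T = term_algebra n"
  define \<theta> where "\<theta> = \<Inter>{\<theta>. hoop_congruence T \<theta> \<and> cancellative_hoop (hoop_quotient T \<theta>)}"
  define F where "F = free_hoop n"
  have F: "F = hoop_quotient T \<theta>" by (simp add: F_def free_hoop_def T_def \<theta>_def)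
  define \<kappa> where "\<kappa> = generated_congruence F R0"
  define Q where "Q = hoop_quotient F \<kappa>"
  have carrier_T: "t \<in> carrier T \<longleftrightarrow> term_vars t \<subseteq> {..<n}" for t
    by (simp add: T_def term_algebra_def)
  have ops_T: "s \<otimes>\<^bsub>T\<^esub> t = HPlus s t" "s \<setminus>\<^bsub>T\<^esub> t = HMonus s t" "\<one>\<^bsub>T\<^esub> = HZero" for s t
    by (simp_all add: T_def term_algebra_def)
  have one_T: "\<one>\<^bsub>T\<^esub> \<in> carrier T"
    and cl_T: "\<And>a b. a \<in> carrier T \<Longrightarrow> b \<in> carrier T \<Longrightarrow> a \<otimes>\<^bsub>T\<^esub> b \<in> carrier T \<and> a \<setminus>\<^bsub>T\<^esub> b \<in> carrier T"
    by (auto simp: carrier_T ops_T)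
  have ker: "hoop_congruence T (map_kernel T f) \<and> cancellative_hoop (hoop_quotient T (map_kernel T f))"
    if "f \<in> hoop_hom T nonneg_real_hoop" for f
    using hoop_congruence_map_kernel[OF that cl_T] cancellative_hoop_quotient_map_kernel[OF that one_T cl_T]
    by blast
  have "(\<lambda>_. 0) \<in> hoop_hom T nonneg_real_hoop" by (simp add: hoop_hom_real_iff)
  then have ne: "{\<theta>. hoop_congruence T \<theta> \<and> cancellative_hoop (hoop_quotient T \<theta>)} \<noteq> {}"
    using ker by blast
  have cong\<theta>: "hoop_congruence T \<theta>"
    unfolding \<theta>_def using ne by (rule hoop_congruence_Inter) simp
  have eq\<theta>: "equiv (carrier T) \<theta>" using cong\<theta> unfolding hoop_congruence_def by simp
  have elem_F: "\<exists>t\<in>carrier T. X = \<theta> `` {t}" if "X \<in> carrier F" for X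
    using that by (auto simp: F hoop_quotient_def quotient_def)
  have mem_F: "\<theta> `` {t} \<in> carrier F" if "t \<in> carrier T" for t
    using that by (auto simp: F hoop_quotient_def quotient_def)
  have ops_F: "\<theta> `` {s} \<otimes>\<^bsub>F\<^esub> \<theta> `` {t} = \<theta> `` {HPlus s t}" "\<theta> `` {s} \<setminus>\<^bsub>F\<^esub> \<theta> `` {t} = \<theta> `` {HMonus s t}"
    if "s \<in> carrier T" "t \<in> carrier T" for s t
    using hoop_quotient_class_ops[OF cong\<theta> that] by (simp_all add: F ops_T)
  have one_F: "\<one>\<^bsub>F\<^esub> = \<theta> `` {HZero}" by (simp add: F hoop_quotient_def ops_T)
  have cl_F: "X \<otimes>\<^bsub>F\<^esub> Y \<in> carrier F \<and> X \<setminus>\<^bsub>F\<^esub> Y \<in> carrier F" if X: "X \<in> carrier F" and Y: "Y \<in> carrier F" for X Y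
  proof -
    obtain s where s: "s \<in> carrier T" "X = \<theta> `` {s}" using elem_F[OF X] by auto
    obtain t where t: "t \<in> carrier T" "Y = \<theta> `` {t}" using elem_F[OF Y] by auto
    show ?thesis
      unfolding s(2) t(2) ops_F[OF s(1) t(1)] using cl_T[OF s(1) t(1)] mem_F by (simp add: ops_T)
  qed
  have \<kappa>_sub: "\<kappa> \<subseteq> \<theta>'" if "hoop_congruence F \<theta>'" "R0 \<subseteq> \<theta>'" for \<theta>'
    unfolding \<kappa>_def generated_congruence_def using that by blast
  have "(\<lambda>_. 0) \<in> hoop_hom F nonneg_real_hoop" by (simp add: hoop_hom_real_iff)
  then have "hoop_congruence F (map_kernel F (\<lambda>_. 0))" using cl_F by (rule hoop_congruence_map_kernel)
  moreover have "R0 \<subseteq> map_kernel F (\<lambda>_. 0)" using R0(2) by (auto simp: map_kernel_def F_def)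
  ultimately have ne2: "{\<theta>'. hoop_congruence F \<theta>' \<and> R0 \<subseteq> \<theta>'} \<noteq> {}" by blast
  have cong\<kappa>: "hoop_congruence F \<kappa>"
    unfolding \<kappa>_def generated_congruence_def using ne2 by (rule hoop_congruence_Inter) simp
  have eq\<kappa>: "equiv (carrier F) \<kappa>" using cong\<kappa> unfolding hoop_congruence_def by simp
  have R0_sub: "R0 \<subseteq> \<kappa>" unfolding \<kappa>_def generated_congruence_def by blast
  obtain \<phi> where \<phi>: "\<phi> \<in> hoop_hom H Q" "bij_betw \<phi> (carrier H) (carrier Q)"
    using iso unfolding hoop_isomorphic_def Q_def \<kappa>_def F_def by auto
  interpret cancellative_hoop H by (rule H)
  have \<phi>_ops: "\<phi> (a \<otimes>\<^bsub>H\<^esub> b) = \<phi> a \<otimes>\<^bsub>Q\<^esub> \<phi> b" "\<phi> (a \<setminus>\<^bsub>H\<^esub> b) = \<phi> a \<setminus>\<^bsub>Q\<^esub> \<phi> b" "\<phi> \<one>\<^bsub>H\<^esub> = \<one>\<^bsub>Q\<^esub>"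
    if "a \<in> carrier H" "b \<in> carrier H" for a b
    using \<phi>(1) that by (auto simp: hoop_hom_def hom_def)
  define cl where "cl t = \<kappa> `` {\<theta> `` {t}}" for t
  have cl_Q: "cl t \<in> carrier Q" if "t \<in> carrier T" for t
    using mem_F[OF that] by (auto simp: Q_def cl_def hoop_quotient_def quotient_def)
  have cl_surj: "\<exists>t\<in>carrier T. X = cl t" if X: "X \<in> carrier Q" for X
  proof -
    obtain Y where Y: "Y \<in> carrier F" "X = \<kappa> `` {Y}"
      using X by (auto simp: Q_def hoop_quotient_def quotient_def)
    then show ?thesis using elem_F[OF Y(1)] by (auto simp: cl_def)
  qed
  have ops_Q: "cl s \<otimes>\<^bsub>Q\<^esub> cl t = cl (HPlus s t)" "cl s \<setminus>\<^bsub>Q\<^esub> cl t = cl (HMonus s t)"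
    if "s \<in> carrier T" "t \<in> carrier T" for s t
    using hoop_quotient_class_ops[OF cong\<kappa> mem_F[OF that(1)] mem_F[OF that(2)]] ops_F[OF that]
    by (simp_all add: Q_def cl_def)
  have one_Q: "\<one>\<^bsub>Q\<^esub> = cl HZero" by (simp add: Q_def hoop_quotient_def cl_def one_F)
  define rep where "rep t = inv_into (carrier H) \<phi> (cl t)" for t
  have rep: "rep t \<in> carrier H" "\<phi> (rep t) = cl t" if "t \<in> carrier T" for t
    using cl_Q[OF that] \<phi>(2) by (auto simp: rep_def bij_betw_def inv_into_into f_inv_into_f)
  have inj: "a = b" if "\<phi> a = \<phi> b" "a \<in> carrier H" "b \<in> carrier H" for a b
    using that \<phi>(2) by (auto simp: bij_betw_def inj_on_def)
  \<comment> \<open>The given relations hold between classes of terms; picking a term in each class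
    turns them into the finite set \<open>R\<close> of relations between terms.\<close>
  define tm where "tm X = (SOME t. t \<in> carrier T \<and> X = \<theta> `` {t})" for X
  have tm: "tm X \<in> carrier T" "X = \<theta> `` {tm X}" if "X \<in> carrier F" for X
    using someI_ex[of "\<lambda>t. t \<in> carrier T \<and> X = \<theta> `` {t}"] elem_F[OF that] by (auto simp: tm_def)
  define R where "R = (\<lambda>(X, Y). (tm X, tm Y)) ` R0"
  have R_elim: "\<exists>X Y. (X, Y) \<in> R0 \<and> s = tm X \<and> t = tm Y \<and> X \<in> carrier F \<and> Y \<in> carrier F"
    if "(s, t) \<in> R" for s t
    using that R0(2) unfolding R_def F_def by auto
  \<comment> \<open>Evaluation at \<open>x\<close> factors twice: through the free hoop because its
    kernel contains \<open>\<theta>\<close>, then through the quotient by \<open>R0\<close> because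
    \<open>x\<close> satisfies \<open>R\<close>.\<close>
  have eval: "term_eval x s = term_eval x t"
    if x: "x \<in> solution_cone n R" and s: "s \<in> carrier T" and t: "t \<in> carrier T" and st: "rep s = rep t" for x s t
  proof -
    have ev: "term_eval x \<in> hoop_hom T nonneg_real_hoop"
      unfolding T_def using x by (intro term_eval_hoop_hom) (simp add: solution_cone_def)
    have "\<theta> \<subseteq> map_kernel T (term_eval x)"
      unfolding \<theta>_def using ker[OF ev] by blast
    then have ker\<theta>: "term_eval x a = term_eval x b" if "(a, b) \<in> \<theta>" for a b
      using that by (auto simp: map_kernel_def)
    obtain g where g: "g \<in> hoop_hom F nonneg_real_hoop" "\<forall>t\<in>carrier T. g (\<theta> `` {t}) = term_eval x t"
      using hoop_hom_factor[OF cong\<theta> ev one_T ker\<theta>] unfolding F by auto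
    have "hoop_congruence F (map_kernel F g)" using g(1) cl_F by (rule hoop_congruence_map_kernel)
    moreover have "R0 \<subseteq> map_kernel F g"
    proof (rule subrelI)
      fix X Y assume XY: "(X, Y) \<in> R0"
      then have XF: "X \<in> carrier F" "Y \<in> carrier F" using R0(2) by (auto simp: F_def)
      have "(tm X, tm Y) \<in> R" using XY by (force simp: R_def)
      then have "term_eval x (tm X) = term_eval x (tm Y)" using x by (auto simp: solution_cone_def)
      then have "g X = g Y" using g(2) tm[OF XF(1)] tm[OF XF(2)] by metis
      then show "(X, Y) \<in> map_kernel F g" using XF by (simp add: map_kernel_def)
    qed
    ultimately have "\<kappa> \<subseteq> map_kernel F g" by (rule \<kappa>_sub)
    moreover have "cl s = cl t" using rep(2)[OF s] rep(2)[OF t] st by simp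
    then have "(\<theta> `` {s}, \<theta> `` {t}) \<in> \<kappa>"
      unfolding cl_def using eq_equiv_class[OF _ eq\<kappa> mem_F[OF t]] by blast
    ultimately have "g (\<theta> `` {s}) = g (\<theta> `` {t})" by (auto simp: map_kernel_def)
    then show ?thesis using g(2) s t by simp
  qed
  have "presented_hoop H n R rep"
  proof (intro presented_hoop.intro presented_hoop_axioms.intro H)
    show "finite R" using R0(1) by (simp add: R_def)
    show "rep ` {t. term_vars t \<subseteq> {..<n}} = carrier H"
    proof (intro equalityI subsetI)
      fix a assume "a \<in> rep ` {t. term_vars t \<subseteq> {..<n}}"
      then show "a \<in> carrier H" using rep(1) by (auto simp: carrier_T)
    next
      fix a assume a: "a \<in> carrier H"
      then have "\<phi> a \<in> carrier Q" using \<phi>(2) by (auto simp: bij_betw_def)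
      then obtain t where t: "t \<in> carrier T" "\<phi> a = cl t" using cl_surj by auto
      then have "rep t = a" using inj[OF _ rep(1)[OF t(1)] a] rep(2)[OF t(1)] by simp
      then show "a \<in> rep ` {t. term_vars t \<subseteq> {..<n}}" using t(1) by (auto simp: carrier_T)
    qed
    show "rep HZero = \<one>\<^bsub>H\<^esub>"
      using one_T rep[of HZero] \<phi>_ops(3)[of "\<one>\<^bsub>H\<^esub>" "\<one>\<^bsub>H\<^esub>"] one_Q by (intro inj) (simp_all add: ops_T)
  next
    fix s t assume "(s, t) \<in> R"
    from R_elim[OF this]
    obtain X Y where XY: "(X, Y) \<in> R0" "s = tm X" "t = tm Y" "X \<in> carrier F" "Y \<in> carrier F"
      by (elim exE conjE)
    have s: "s \<in> carrier T" "X = \<theta> `` {s}" using tm[OF XY(4)] XY(2) by simp_all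
    have t: "t \<in> carrier T" "Y = \<theta> `` {t}" using tm[OF XY(5)] XY(3) by simp_all
    show "term_vars s \<subseteq> {..<n} \<and> term_vars t \<subseteq> {..<n}" using s(1) t(1) by (simp add: carrier_T)
    have "cl s = cl t"
      unfolding cl_def s(2)[symmetric] t(2)[symmetric]
      using equiv_class_eq[OF eq\<kappa> subsetD[OF R0_sub XY(1)]] .
    then show "rep s = rep t" by (simp add: rep_def)
  next
    fix s t assume "term_vars s \<subseteq> {..<n}" "term_vars t \<subseteq> {..<n}"
    then have s: "s \<in> carrier T" and t: "t \<in> carrier T" by (simp_all add: carrier_T)
    then have st: "HPlus s t \<in> carrier T" "HMonus s t \<in> carrier T" by (auto simp: carrier_T)
    show "rep (HPlus s t) = rep s \<otimes>\<^bsub>H\<^esub> rep t"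
    proof (rule inj)
      show "\<phi> (rep (HPlus s t)) = \<phi> (rep s \<otimes>\<^bsub>H\<^esub> rep t)"
        unfolding \<phi>_ops(1)[OF rep(1)[OF s] rep(1)[OF t]] rep(2)[OF s] rep(2)[OF t] rep(2)[OF st(1)]
        by (rule ops_Q(1)[OF s t, symmetric])
      show "rep (HPlus s t) \<in> carrier H" by (rule rep(1)[OF st(1)])
      show "rep s \<otimes>\<^bsub>H\<^esub> rep t \<in> carrier H" by (intro m_closed rep(1) s t)
    qed
    show "rep (HMonus s t) = rep s \<setminus>\<^bsub>H\<^esub> rep t"
    proof (rule inj)
      show "\<phi> (rep (HMonus s t)) = \<phi> (rep s \<setminus>\<^bsub>H\<^esub> rep t)"
        unfolding \<phi>_ops(2)[OF rep(1)[OF s] rep(1)[OF t]] rep(2)[OF s] rep(2)[OF t] rep(2)[OF st(2)]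
        by (rule ops_Q(2)[OF s t, symmetric])
      show "rep (HMonus s t) \<in> carrier H" by (rule rep(1)[OF st(2)])
      show "rep s \<setminus>\<^bsub>H\<^esub> rep t \<in> carrier H" by (intro monus_closed rep(1) s t)
    qed
  next
    fix x s t
    assume "x \<in> solution_cone n R" "term_vars s \<subseteq> {..<n}" "term_vars t \<subseteq> {..<n}" "rep s = rep t"
    then show "term_eval x s = term_eval x t" by (intro eval) (simp_all add: carrier_T)
  qed
  then show ?thesis by (intro exI)
qed

text \<open>Needed to write \<open>q * x i\<close> and \<open>p\<close> times the coordinate sum as
  terms; comparing the two with \<open>HMonus\<close> gives the rational half-spaces on the
  base.\<close>

primrec term_mult :: "nat \<Rightarrow> hoop_term \<Rightarrow> hoop_term" where
  "term_mult 0 t = HZero"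
| "term_mult (Suc k) t = HPlus (term_mult k t) t"

primrec term_var_sum :: "nat \<Rightarrow> hoop_term" where
  "term_var_sum 0 = HZero"
| "term_var_sum (Suc k) = HPlus (term_var_sum k) (HVar k)"

lemma term_vars_mult: "term_vars t \<subseteq> V \<Longrightarrow> term_vars (term_mult k t) \<subseteq> V"
  by (induction k) auto

lemma term_eval_mult: "term_eval x (term_mult k t) = real k * term_eval x t"
  by (induction k) (auto simp: algebra_simps)

lemma term_vars_var_sum: "term_vars (term_var_sum k) \<subseteq> {..<k}"
  by (induction k) auto

lemma term_eval_var_sum: "term_eval x (term_var_sum k) = (\<Sum>i<k. x i)"
  by (induction k) auto

lemma term_eval_scale:
  assumes "0 \<le> c"
  shows "term_eval (\<lambda>i. c * x i) t = c * term_eval x t"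
proof (induction t)
  case (HMonus s t)
  have "max 0 (c * p) = c * max 0 p" for p :: real
    using assms by (simp add: max_mult_distrib_left)
  then show ?case using HMonus by (simp flip: right_diff_distrib)
qed (auto simp: algebra_simps)

lemma continuous_on_term_eval: "continuous_on S (\<lambda>x. term_eval x t)"
proof (induction t)
  case (HVar i)
  show ?case by (simp, rule continuous_on_subset[OF continuous_on_product_coordinates]) simp
qed (auto intro!: continuous_intros)

lemma term_eval_nonneg:
  "(\<And>i. i < n \<Longrightarrow> 0 \<le> x i) \<Longrightarrow> term_vars t \<subseteq> {..<n} \<Longrightarrow> 0 \<le> term_eval x t"
  by (induction t) auto

lemma term_eval_Nats:
  "(\<And>i. i < n \<Longrightarrow> x i \<in> \<nat>) \<Longrightarrow> term_vars t \<subseteq> {..<n} \<Longrightarrow> term_eval x t \<in> \<nat>"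
proof (induction t)
  case (HMonus s t)
  then obtain a b :: nat where "term_eval x s = real a" "term_eval x t = real b"
    by (auto elim!: Nats_cases)
  then have "term_eval x (HMonus s t) = real (a - b)" by (simp add: of_nat_diff_real)
  then show ?case by simp
qed auto

text \<open>As values are nonnegative, truncated subtraction never exceeds its first argument, so
  growth is at most linear. Applied to a term for the unit, this bounds the value at the unit of the
  lattice points constructed later.\<close>

lemma term_eval_bound:
  assumes "term_vars t \<subseteq> {..<n}"
  shows "\<exists>B. 0 \<le> B \<and> (\<forall>x. (\<forall>i<n. 0 \<le> x i) \<longrightarrow> term_eval x t \<le> B * (\<Sum>i<n. x i))"
  using assms
proof (induction t)
  case (HVar i)
  then have "x i \<le> (\<Sum>i<n. x i)" if "\<forall>i<n. 0 \<le> x i" for x :: "nat \<Rightarrow> real"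
    using that by (intro member_le_sum) auto
  then show ?case by (intro exI[of _ 1]) simp
next
  case HZero
  show ?case by (intro exI[of _ 0]) simp
next
  case (HPlus s t)
  then obtain B B' where B: "0 \<le> B" "\<forall>x. (\<forall>i<n. 0 \<le> x i) \<longrightarrow> term_eval x s \<le> B * (\<Sum>i<n. x i)"
      and B': "0 \<le> B'" "\<forall>x. (\<forall>i<n. 0 \<le> x i) \<longrightarrow> term_eval x t \<le> B' * (\<Sum>i<n. x i)"
    by auto
  have "term_eval x (HPlus s t) \<le> (B + B') * (\<Sum>i<n. x i)" if "\<forall>i<n. 0 \<le> x i" for x
    using B(2) B'(2) that by (simp add: distrib_right add_mono)
  then show ?case using B(1) B'(1) by (intro exI[of _ "B + B'"]) auto
next
  case (HMonus s t)
  then obtain B where B: "0 \<le> B" "\<forall>x. (\<forall>i<n. 0 \<le> x i) \<longrightarrow> term_eval x s \<le> B * (\<Sum>i<n. x i)"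
    by auto
  have "term_eval x (HMonus s t) \<le> B * (\<Sum>i<n. x i)" if x: "\<forall>i<n. 0 \<le> x i" for x
  proof -
    have "0 \<le> term_eval x t" using x HMonus.prems by (intro term_eval_nonneg[of n]) auto
    moreover have "term_eval x s \<le> B * (\<Sum>i<n. x i)" using B(2) x by blast
    moreover have "0 \<le> B * (\<Sum>i<n. x i)" using B(1) x by (intro mult_nonneg_nonneg sum_nonneg) auto
    ultimately show ?thesis by simp
  qed
  with B(1) show ?case by (intro exI[of _ B]) blast
qed

lemma solution_cone_scale:
  assumes "x \<in> solution_cone n R" "0 \<le> c"
  shows "(\<lambda>i. c * x i) \<in> solution_cone n R"
  using assms by (auto simp: solution_cone_def term_eval_scale)

context presented_hoop
begin

text \<open>Evaluation of an element through some term that names it. For \<open>x\<close> in the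
  cone the choice of the term is immaterial by \<open>eval_cong\<close>; elsewhere the value has no
  meaning.\<close>

definition hval :: "(nat \<Rightarrow> real) \<Rightarrow> 'a \<Rightarrow> real" where
  "hval x h = term_eval x (SOME t. term_vars t \<subseteq> {..<n} \<and> rep t = h)"

definition point :: "('a \<Rightarrow> real) \<Rightarrow> nat \<Rightarrow> real" where
  "point e = (\<lambda>i. if i < n then e (rep (HVar i)) else 0)"

lemma rep_closed: "term_vars t \<subseteq> {..<n} \<Longrightarrow> rep t \<in> carrier H"
  using rep_surj by auto

lemma rep_obtain:
  assumes "h \<in> carrier H"
  obtains t where "term_vars t \<subseteq> {..<n}" "rep t = h"
proof -
  have "h \<in> rep ` {t. term_vars t \<subseteq> {..<n}}" unfolding rep_surj by (rule assms)
  then show ?thesis using that by (elim imageE) simp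
qed

lemma hval_rep:
  assumes "x \<in> solution_cone n R" "term_vars t \<subseteq> {..<n}"
  shows "hval x (rep t) = term_eval x t"
proof -
  have "\<exists>s. term_vars s \<subseteq> {..<n} \<and> rep s = rep t" using assms(2) by blast
  from someI_ex[OF this] show ?thesis
    unfolding hval_def using eval_cong[OF assms(1) _ assms(2)] by blast
qed

lemma hval_hom:
  assumes x: "x \<in> solution_cone n R"
  shows "hval x \<in> hoop_hom H nonneg_real_hoop"
  unfolding hoop_hom_real_iff
proof (intro conjI ballI)
  show "hval x \<one> = 0" using hval_rep[OF x, of HZero] rep_zero by simp
  fix a assume "a \<in> carrier H"
  then obtain s where s: "term_vars s \<subseteq> {..<n}" "rep s = a" by (rule rep_obtain)
  show "0 \<le> hval x a"
    unfolding s(2)[symmetric] hval_rep[OF x s(1)]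
    using x s(1) by (intro term_eval_nonneg) (auto simp: solution_cone_def)
  fix b assume "b \<in> carrier H"
  then obtain t where t: "term_vars t \<subseteq> {..<n}" "rep t = b" by (rule rep_obtain)
  have st: "term_vars (HPlus s t) \<subseteq> {..<n}" "term_vars (HMonus s t) \<subseteq> {..<n}" using s t by auto
  show "hval x (a \<otimes> b) = hval x a + hval x b"
    unfolding s(2)[symmetric] t(2)[symmetric] rep_plus[OF s(1) t(1), symmetric]
    by (simp only: hval_rep[OF x] s(1) t(1) st term_eval.simps)
  show "hval x (a \<setminus> b) = max 0 (hval x a - hval x b)"
    unfolding s(2)[symmetric] t(2)[symmetric] rep_monus[OF s(1) t(1), symmetric]
    by (simp only: hval_rep[OF x] s(1) t(1) st term_eval.simps)
qed

lemma hom_rep: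
  assumes e: "e \<in> hoop_hom H nonneg_real_hoop"
  shows "term_vars t \<subseteq> {..<n} \<Longrightarrow> e (rep t) = term_eval (point e) t"
proof (induction t)
  case (HVar i)
  then show ?case by (simp add: point_def)
next
  case HZero
  then show ?case using e rep_zero by (simp add: hoop_hom_real_iff)
next
  case (HPlus s t)
  then have st: "term_vars s \<subseteq> {..<n}" "term_vars t \<subseteq> {..<n}" by auto
  show ?case
    using HPlus.IH st e rep_closed[OF st(1)] rep_closed[OF st(2)]
    by (simp add: rep_plus hoop_hom_real_iff)
next
  case (HMonus s t)
  then have st: "term_vars s \<subseteq> {..<n}" "term_vars t \<subseteq> {..<n}" by auto
  show ?case
    using HMonus.IH st e rep_closed[OF st(1)] rep_closed[OF st(2)]
    by (simp add: rep_monus hoop_hom_real_iff)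
qed

lemma point_in_cone:
  assumes e: "e \<in> hoop_hom H nonneg_real_hoop"
  shows "point e \<in> solution_cone n R"
proof -
  have "0 \<le> point e i" for i
    using e rep_closed[of "HVar i"] by (auto simp: point_def hoop_hom_real_iff)
  moreover have "term_eval (point e) s = term_eval (point e) t" if "(s, t) \<in> R" for s t
    using hom_rep[OF e, of s] hom_rep[OF e, of t] R_vars[OF that] rep_R[OF that] by simp
  moreover have "point e i = 0" if "n \<le> i" for i using that by (simp add: point_def)
  ultimately show ?thesis by (auto simp: solution_cone_def)
qed

lemma hom_eq_hval:
  assumes e: "e \<in> hoop_hom H nonneg_real_hoop" and h: "h \<in> carrier H"
  shows "e h = hval (point e) h"
proof -
  obtain t where "term_vars t \<subseteq> {..<n}" "rep t = h" using h by (rule rep_obtain)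
  then show ?thesis using hom_rep[OF e] hval_rep[OF point_in_cone[OF e]] by auto
qed

lemma point_hval:
  assumes x: "x \<in> solution_cone n R"
  shows "point (hval x) = x"
proof
  fix i
  show "point (hval x) i = x i"
    using x hval_rep[OF x, of "HVar i"] by (auto simp: point_def solution_cone_def)
qed

lemma hval_scale:
  assumes "x \<in> solution_cone n R" "0 \<le> c" "h \<in> carrier H"
  shows "hval (\<lambda>i. c * x i) h = c * hval x h"
proof -
  obtain t where t: "term_vars t \<subseteq> {..<n}" "rep t = h" using assms(3) by (rule rep_obtain)
  show ?thesis
    unfolding t(2)[symmetric] hval_rep[OF assms(1) t(1)] hval_rep[OF solution_cone_scale[OF assms(1,2)] t(1)]
    using assms(2) by (rule term_eval_scale)
qed

lemma cone_nonneg: "x \<in> solution_cone n R \<Longrightarrow> 0 \<le> x i"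
  by (cases "i < n") (auto simp: solution_cone_def)

lemma hval_nonneg: "x \<in> solution_cone n R \<Longrightarrow> h \<in> carrier H \<Longrightarrow> 0 \<le> hval x h"
  using hval_hom by (simp add: hoop_hom_real_iff)

lemma hval_generator: "x \<in> solution_cone n R \<Longrightarrow> i < n \<Longrightarrow> hval x (rep (HVar i)) = x i"
  using hval_rep[of x "HVar i"] by simp

lemma hval_pow:
  assumes "x \<in> solution_cone n R" "h \<in> carrier H"
  shows "hval x (h [^] (k::nat)) = real k * hval x h"
proof (induction k)
  case 0
  then show ?case using hval_hom[OF assms(1)] by (simp add: hoop_hom_real_iff)
next
  case (Suc k)
  then show ?case using hval_hom[OF assms(1)] assms(2) by (simp add: hoop_hom_real_iff algebra_simps)
qed

text \<open>One \<open>k\<close> serves all points of the cone, because \<open>h \<le> k u\<close>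
  is a relation in \<open>H\<close> itself that every evaluation preserves.\<close>

lemma unit_bound:
  assumes u: "hoop_unit H u" and h: "h \<in> carrier H"
  obtains k :: nat where "1 \<le> k" "\<And>x. x \<in> solution_cone n R \<Longrightarrow> hval x h \<le> real k * hval x u"
proof -
  have uH: "u \<in> carrier H" using u by (simp add: hoop_unit_def)
  obtain k :: nat where k: "1 \<le> k" "hoop_le H h (u [^] k)"
    using u h unfolding hoop_unit_def by auto
  have "hval x h \<le> real k * hval x u" if x: "x \<in> solution_cone n R" for x
  proof -
    have "hval x (h \<setminus> u [^] k) = 0"
      using k(2) hval_hom[OF x] by (simp add: hoop_le_def hoop_hom_real_iff)
    moreover have "hval x (h \<setminus> u [^] k) = max 0 (hval x h - hval x (u [^] k))"
      using hval_hom[OF x] h uH by (simp add: hoop_hom_real_iff)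
    ultimately show ?thesis using hval_pow[OF x uH] by simp
  qed
  with k(1) show ?thesis by (rule that)
qed

lemma unit_pos:
  assumes u: "hoop_unit H u" and x: "x \<in> solution_cone n R" "x i \<noteq> 0"
  shows "0 < hval x u"
proof -
  have i: "i < n" using x by (auto simp: solution_cone_def not_less[symmetric])
  have uH: "u \<in> carrier H" using u by (simp add: hoop_unit_def)
  obtain k :: nat where "\<And>x. x \<in> solution_cone n R \<Longrightarrow> hval x (rep (HVar i)) \<le> real k * hval x u"
    using unit_bound[OF u, of "rep (HVar i)"] rep_closed[of "HVar i"] i by auto
  then have "x i \<le> real k * hval x u" using x(1) hval_generator[OF x(1) i] by metis
  moreover have "0 < x i" using cone_nonneg[OF x(1), of i] x(2) by simp
  ultimately have "hval x u \<noteq> 0" by auto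
  then show ?thesis using hval_nonneg[OF x(1) uH] by simp
qed

text \<open>Normalised by the coordinate sum and not by the value at a unit, so that it depends on
  the presentation alone.\<close>

definition base :: "(nat \<Rightarrow> real) set" where
  "base = {x \<in> solution_cone n R. (\<Sum>i<n. x i) = 1}"

lemma normalized_in_base:
  assumes "x \<in> solution_cone n R" "x i \<noteq> 0"
  shows "0 < (\<Sum>i<n. x i)" "(\<lambda>i. 1 / (\<Sum>i<n. x i) * x i) \<in> base"
proof -
  have i: "i < n" using assms by (auto simp: solution_cone_def not_less[symmetric])
  have "0 < x i" using cone_nonneg[OF assms(1), of i] assms(2) by simp
  then show pos: "0 < (\<Sum>i<n. x i)"
    using i cone_nonneg[OF assms(1)] by (intro sum_pos2[of _ i]) auto
  have "(\<Sum>i<n. 1 / (\<Sum>i<n. x i) * x i) = 1 / (\<Sum>i<n. x i) * (\<Sum>i<n. x i)"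
    by (rule sum_distrib_left[symmetric])
  then have "(\<Sum>i<n. 1 / (\<Sum>i<n. x i) * x i) = 1" using pos by simp
  moreover have "(\<lambda>j. 1 / (\<Sum>i<n. x i) * x j) \<in> solution_cone n R"
    using pos by (intro solution_cone_scale assms(1)) auto
  ultimately show "(\<lambda>i. 1 / (\<Sum>i<n. x i) * x i) \<in> base" by (simp add: base_def)
qed

end

section \<open>Existence of states\<close>

abbreviation (in cancellative_hoop) hle (infix "\<preceq>" 50) where "x \<preceq> y \<equiv> hoop_le H x y"

lemma (in cancellative_hoop) monus_one [simp]: "x \<in> carrier H \<Longrightarrow> x \<setminus> \<one> = x"
  using add_monus_cancel[of x \<one>] by simp

lemma (in cancellative_hoop) one_monus [simp]:
  assumes "x \<in> carrier H"
  shows "\<one> \<setminus> x = \<one>"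
proof -
  have "x \<otimes> (\<one> \<setminus> x) = x"
    using add_monus_swap[of x \<one>] assms by simp
  then have "(\<one> \<setminus> x) \<otimes> x = x"
    using assms monus_closed m_comm by simp
  then have "((\<one> \<setminus> x) \<otimes> x) \<setminus> x = \<one>"
    using assms monus_self by simp
  then show ?thesis
    using add_monus_cancel[of "\<one> \<setminus> x" x] assms monus_closed by simp
qed

lemma (in cancellative_hoop) hle_residual:
  assumes "x \<in> carrier H" "y \<in> carrier H" "z \<in> carrier H"
  shows "x \<setminus> y \<preceq> z \<longleftrightarrow> x \<preceq> y \<otimes> z"
  using monus_monus[OF assms] by (simp add: hoop_le_def)

lemma (in cancellative_hoop) hle_refl: "x \<in> carrier H \<Longrightarrow> x \<preceq> x"
  by (simp add: hoop_le_def monus_self)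

lemma (in cancellative_hoop) one_hle: "x \<in> carrier H \<Longrightarrow> \<one> \<preceq> x"
  by (simp add: hoop_le_def)

lemma (in cancellative_hoop) hle_iff:
  assumes "x \<in> carrier H" "y \<in> carrier H"
  shows "x \<preceq> y \<longleftrightarrow> (\<exists>z\<in>carrier H. y = x \<otimes> z)"
proof
  assume "x \<preceq> y"
  then have "y = x \<otimes> (y \<setminus> x)"
    using add_monus_swap[OF assms] assms by (simp add: hoop_le_def)
  then show "\<exists>z\<in>carrier H. y = x \<otimes> z"
    using monus_closed assms by auto
next
  assume "\<exists>z\<in>carrier H. y = x \<otimes> z"
  then obtain z where "z \<in> carrier H" "y = x \<otimes> z" by auto
  then show "x \<preceq> y"
    using monus_monus[of x x z] assms by (simp add: hoop_le_def monus_self)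
qed

lemma (in cancellative_hoop) hle_add: "x \<in> carrier H \<Longrightarrow> y \<in> carrier H \<Longrightarrow> x \<preceq> x \<otimes> y"
  using hle_iff by auto

lemma (in cancellative_hoop) hle_trans:
  assumes "x \<preceq> y" "y \<preceq> z" "x \<in> carrier H" "y \<in> carrier H" "z \<in> carrier H"
  shows "x \<preceq> z"
proof -
  obtain a b where "a \<in> carrier H" "b \<in> carrier H" "y = x \<otimes> a" "z = y \<otimes> b"
    using assms hle_iff by auto
  then have "z = x \<otimes> (a \<otimes> b)" "a \<otimes> b \<in> carrier H"
    using assms(3) by (simp_all add: m_assoc)
  then show ?thesis using hle_iff assms by auto
qed

lemma (in cancellative_hoop) hle_mono:
  assumes "x \<preceq> y" "x' \<preceq> y'" "x \<in> carrier H" "y \<in> carrier H" "x' \<in> carrier H" "y' \<in> carrier H"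
  shows "x \<otimes> x' \<preceq> y \<otimes> y'"
proof -
  obtain a b where ab: "a \<in> carrier H" "b \<in> carrier H" "y = x \<otimes> a" "y' = x' \<otimes> b"
    using assms hle_iff by auto
  have "(x \<otimes> a) \<otimes> (x' \<otimes> b) = (x \<otimes> x') \<otimes> (a \<otimes> b)"
    using assms(3,5) ab(1,2) by (simp add: m_ac)
  then show ?thesis unfolding ab(3,4) using assms(3,5) ab(1,2) by (simp add: hle_add)
qed

lemma (in cancellative_hoop) hoop_cancel:
  assumes "x \<otimes> z = y \<otimes> z" "x \<in> carrier H" "y \<in> carrier H" "z \<in> carrier H"
  shows "x = y"
proof -
  have "(x \<otimes> z) \<setminus> z = (y \<otimes> z) \<setminus> z" using assms(1) by (rule arg_cong)
  then show ?thesis using add_monus_cancel assms(2-4) by simp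
qed

lemma (in cancellative_hoop) hle_one: "x \<preceq> \<one> \<Longrightarrow> x \<in> carrier H \<Longrightarrow> x = \<one>"
  by (simp add: hoop_le_def)

lemma (in cancellative_hoop) monus_hle: "x \<in> carrier H \<Longrightarrow> y \<in> carrier H \<Longrightarrow> x \<setminus> y \<preceq> x"
  using hle_residual[of x y x] hle_add[of x y] by (simp add: m_comm)

lemma (in cancellative_hoop) hle_cancel:
  assumes "x \<otimes> z \<preceq> y \<otimes> z" "x \<in> carrier H" "y \<in> carrier H" "z \<in> carrier H"
  shows "x \<preceq> y"
proof -
  have "\<exists>a\<in>carrier H. y \<otimes> z = (x \<otimes> z) \<otimes> a"
    by (rule hle_iff[THEN iffD1]) (use assms in auto)
  then obtain a where a: "a \<in> carrier H" "y \<otimes> z = (x \<otimes> z) \<otimes> a" by (rule bexE)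
  have "(x \<otimes> z) \<otimes> a = (x \<otimes> a) \<otimes> z" using assms(2-4) a(1) by (simp add: m_ac)
  with a(2) have "y \<otimes> z = (x \<otimes> a) \<otimes> z" by (rule trans)
  then have "y = x \<otimes> a" by (rule hoop_cancel) (use assms(2-4) a(1) in auto)
  then show ?thesis using hle_iff assms a(1) by auto
qed

text \<open>Disjointness of positive elements, stated through lower bounds and thus without
  meets.\<close>

definition (in cancellative_hoop) hperp :: "'a \<Rightarrow> 'a \<Rightarrow> bool" where
  "hperp a b \<longleftrightarrow> (\<forall>c\<in>carrier H. c \<preceq> a \<longrightarrow> c \<preceq> b \<longrightarrow> c = \<one>)"

lemma (in cancellative_hoop) hperp_sym: "hperp a b \<Longrightarrow> hperp b a"
  by (auto simp: hperp_def)

text \<open>Positive and negative part of a difference are disjoint. A common lower bound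
  \<open>c\<close> cancels from \<open>x \<otimes> (y \<setminus> x) = y \<otimes> (x \<setminus>
  y)\<close>, which leaves \<open>x \<preceq> y \<otimes> a\<close> with
  \<open>x \<setminus> y = c \<otimes> a\<close>; hence \<open>c \<otimes> a \<preceq> a\<close>,
  and \<open>c = \<one>\<close>.\<close>

lemma (in cancellative_hoop) hperp_monus:
  assumes "x \<in> carrier H" "y \<in> carrier H"
  shows "hperp (x \<setminus> y) (y \<setminus> x)"
  unfolding hperp_def
proof (intro ballI impI)
  fix c assume c: "c \<in> carrier H" "c \<preceq> x \<setminus> y" "c \<preceq> y \<setminus> x"
  have mc: "x \<setminus> y \<in> carrier H" "y \<setminus> x \<in> carrier H" using assms monus_closed by auto
  obtain a where a: "a \<in> carrier H" "x \<setminus> y = c \<otimes> a" using c mc hle_iff by auto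
  obtain b where b: "b \<in> carrier H" "y \<setminus> x = c \<otimes> b" using c mc hle_iff by auto
  have "(x \<otimes> b) \<otimes> c = x \<otimes> (c \<otimes> b)" "y \<otimes> (c \<otimes> a) = (y \<otimes> a) \<otimes> c"
    using assms a(1) b(1) c(1) by (simp_all add: m_ac)
  moreover have "x \<otimes> (c \<otimes> b) = y \<otimes> (c \<otimes> a)" using add_monus_swap[OF assms] a(2) b(2) by simp
  ultimately have "(x \<otimes> b) \<otimes> c = (y \<otimes> a) \<otimes> c" by (simp only:)
  then have "x \<otimes> b = y \<otimes> a" by (rule hoop_cancel) (use assms a(1) b(1) c(1) in auto)
  moreover have "x \<preceq> x \<otimes> b" using assms b(1) by (intro hle_add)
  ultimately have "x \<preceq> y \<otimes> a" by simp
  then have "x \<setminus> y \<preceq> a" using hle_residual[OF assms a(1)] by blast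
  then have "c \<otimes> a \<preceq> \<one> \<otimes> a" using a by simp
  then have "c \<preceq> \<one>" by (rule hle_cancel) (use a(1) c(1) in auto)
  then show "c = \<one>" using hle_one c(1) by blast
qed

text \<open>Riesz decomposition: \<open>c2 = c \<setminus> a\<close> is the part of \<open>c\<close>
  beyond \<open>a\<close>, and \<open>c1 = c \<setminus> (c \<setminus> a)\<close> is the meet of
  \<open>c\<close> and \<open>a\<close>.\<close>

lemma (in cancellative_hoop) hle_Riesz:
  assumes "c \<preceq> a \<otimes> b" "a \<in> carrier H" "b \<in> carrier H" "c \<in> carrier H"
  obtains c1 c2 where "c1 \<in> carrier H" "c2 \<in> carrier H" "c = c1 \<otimes> c2" "c1 \<preceq> a" "c2 \<preceq> b"
proof -
  have c2: "c \<setminus> a \<in> carrier H" "c \<setminus> a \<preceq> b" "c \<setminus> a \<preceq> c"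
    using assms monus_closed hle_residual[of c a b] monus_hle by auto
  have c1: "c \<setminus> (c \<setminus> a) \<in> carrier H" using assms c2 monus_closed by auto
  have "c \<preceq> (c \<setminus> a) \<otimes> a"
  proof -
    have "c \<preceq> a \<otimes> (c \<setminus> a)"
      using hle_residual[of c a "c \<setminus> a"] hle_refl[OF c2(1)] assms c2(1) by simp
    then show ?thesis using m_comm[of a "c \<setminus> a"] assms c2(1) by simp
  qed
  then have "c \<setminus> (c \<setminus> a) \<preceq> a" using hle_residual[of c "c \<setminus> a" a] assms c2 by simp
  moreover have "c = (c \<setminus> (c \<setminus> a)) \<otimes> (c \<setminus> a)"
  proof -
    have "(c \<setminus> a) \<otimes> (c \<setminus> (c \<setminus> a)) = c"
      using add_monus_swap[of "c \<setminus> a" c] c2 assms by (simp add: hoop_le_def)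
    then show ?thesis using m_comm[of "c \<setminus> a" "c \<setminus> (c \<setminus> a)"] c2(1) c1 by simp
  qed
  ultimately show ?thesis using that[OF c1 c2(1)] c2(2) by simp
qed

lemma (in cancellative_hoop) hperp_add:
  assumes "hperp a b" "hperp a b'" "a \<in> carrier H" "b \<in> carrier H" "b' \<in> carrier H"
  shows "hperp a (b \<otimes> b')"
  unfolding hperp_def
proof (intro ballI impI)
  fix c assume c: "c \<in> carrier H" "c \<preceq> a" "c \<preceq> b \<otimes> b'"
  obtain c1 c2 where c12: "c1 \<in> carrier H" "c2 \<in> carrier H" "c = c1 \<otimes> c2" "c1 \<preceq> b" "c2 \<preceq> b'"
    by (rule hle_Riesz[OF c(3) assms(4,5) c(1)])
  have "c1 \<preceq> c" unfolding c12(3) using c12(1,2) by (rule hle_add)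
  have "c2 \<preceq> c" unfolding c12(3) m_comm[OF c12(1,2)] using c12(2,1) by (rule hle_add)
  have "c1 \<preceq> a" "c2 \<preceq> a"
    by (rule hle_trans[OF \<open>c1 \<preceq> c\<close> c(2) c12(1) c(1) assms(3)],
        rule hle_trans[OF \<open>c2 \<preceq> c\<close> c(2) c12(2) c(1) assms(3)])
  then have "c1 = \<one>" "c2 = \<one>"
    using assms(1)[unfolded hperp_def] assms(2)[unfolded hperp_def] c12(1,2,4,5) by blast+
  then show "c = \<one>" using c12(3) by simp
qed

lemma (in cancellative_hoop) hperp_pow:
  assumes "hperp a b" "a \<in> carrier H" "b \<in> carrier H"
  shows "hperp a (b [^] (k::nat))"
proof (induction k)
  case 0
  show ?case unfolding hperp_def by (auto dest: hle_one)
next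
  case (Suc k)
  then show ?case using hperp_add[OF Suc assms(1)] assms by simp
qed

section \<open>Ideals and the construction of a state\<close>

definition (in cancellative_hoop) hoop_ideal :: "'a set \<Rightarrow> bool" where
  "hoop_ideal I \<longleftrightarrow> I \<subseteq> carrier H \<and> \<one> \<in> I \<and> (\<forall>x\<in>I. \<forall>y\<in>I. x \<otimes> y \<in> I) \<and>
     (\<forall>x\<in>I. \<forall>y\<in>carrier H. y \<preceq> x \<longrightarrow> y \<in> I)"

lemma (in cancellative_hoop) maximal_ideal_avoiding:
  assumes "u \<in> carrier H" "u \<noteq> \<one>"
  shows "\<exists>I. hoop_ideal I \<and> u \<notin> I \<and> (\<forall>J. hoop_ideal J \<longrightarrow> I \<subseteq> J \<longrightarrow> u \<notin> J \<longrightarrow> J = I)"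
proof -
  define A where "A = {I. hoop_ideal I \<and> u \<notin> I}"
  have "hoop_ideal {\<one>}" by (auto simp: hoop_ideal_def dest: hle_one)
  then have "{\<one>} \<in> A" using assms by (simp add: A_def)
  have "\<exists>U\<in>A. \<forall>X\<in>C. X \<subseteq> U" if C: "subset.chain A C" for C
  proof (cases "C = {}")
    case True
    then show ?thesis using \<open>{\<one>} \<in> A\<close> by auto
  next
    case False
    have CA: "hoop_ideal X" "u \<notin> X" if "X \<in> C" for X
      using C that by (auto simp: subset_chain_def A_def)
    have "hoop_ideal (\<Union>C)"
      unfolding hoop_ideal_def
    proof (intro conjI ballI impI)
      show "\<Union>C \<subseteq> carrier H"
      proof (rule Union_least)
        show "X \<subseteq> carrier H" if "X \<in> C" for X using CA(1)[OF that] by (simp add: hoop_ideal_def)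
      qed
      obtain X where X: "X \<in> C" using False by auto
      then show "\<one> \<in> \<Union>C" using CA(1)[OF X] by (auto simp: hoop_ideal_def)
      fix x assume "x \<in> \<Union>C"
      then obtain X where X: "X \<in> C" "x \<in> X" by (rule UnionE)
      {
        fix y assume "y \<in> \<Union>C"
        then obtain Y where Y: "Y \<in> C" "y \<in> Y" by (rule UnionE)
        have "X \<subseteq> Y \<or> Y \<subseteq> X" using C X(1) Y(1) unfolding subset_chain_def by blast
        then show "x \<otimes> y \<in> \<Union>C"
        proof
          assume "X \<subseteq> Y"
          then have "x \<otimes> y \<in> Y" using CA(1)[OF Y(1)] X(2) Y(2) unfolding hoop_ideal_def by blast
          with Y(1) show ?thesis by (rule UnionI)
        next
          assume "Y \<subseteq> X"
          then have "x \<otimes> y \<in> X" using CA(1)[OF X(1)] X(2) Y(2) unfolding hoop_ideal_def by blast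
          with X(1) show ?thesis by (rule UnionI)
        qed
      }
      fix y assume "y \<in> carrier H" "y \<preceq> x"
      then have "y \<in> X" using CA(1)[OF X(1)] X(2) unfolding hoop_ideal_def by blast
      with X(1) show "y \<in> \<Union>C" by (rule UnionI)
    qed
    moreover have "u \<notin> \<Union>C" using CA(2) by blast
    ultimately have "\<Union>C \<in> A" by (simp add: A_def)
    then show ?thesis by (intro bexI[of _ "\<Union>C"]) auto
  qed
  then have "\<exists>M\<in>A. \<forall>X\<in>A. M \<subseteq> X \<longrightarrow> X = M"
    by (rule subset_Zorn)
  then obtain M where M: "M \<in> A" "\<forall>X\<in>A. M \<subseteq> X \<longrightarrow> X = M"
    by (elim bexE)
  then show ?thesis by (intro exI[of _ M]) (simp add: A_def)
qed

text \<open>Modulo a maximal ideal avoiding \<open>u\<close> the order is total, since of two orthogonal elements one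
  must lie in the ideal, and archimedean; the state measures an element against \<open>u\<close> as in
  Hoelder's theorem.\<close>

theorem (in cancellative_hoop) exists_state:
  assumes unit: "hoop_unit H u" and ne: "carrier H \<noteq> {\<one>}"
  obtains e where "e \<in> hoop_hom H nonneg_real_hoop" "e u = 1"
proof -
  have uH: "u \<in> carrier H" and unit': "\<And>h. h \<in> carrier H \<Longrightarrow> \<exists>k::nat. h \<preceq> u [^] k"
    using unit unfolding hoop_unit_def by auto
  have "u \<noteq> \<one>"
  proof
    assume "u = \<one>"
    then have "h = \<one>" if "h \<in> carrier H" for h using unit'[OF that] that by (auto dest: hle_one)
    then show False using ne one_closed by blast
  qed
  from maximal_ideal_avoiding[OF uH this] obtain I where I: "hoop_ideal I" "u \<notin> I"
    and max0: "\<forall>J. hoop_ideal J \<longrightarrow> I \<subseteq> J \<longrightarrow> u \<notin> J \<longrightarrow> J = I"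
    by (elim exE conjE)
  have max: "J = I" if "hoop_ideal J" "I \<subseteq> J" "u \<notin> J" for J
    using max0 that by blast
  have IH: "I \<subseteq> carrier H" and I1: "\<one> \<in> I" and Iadd: "\<And>x y. x \<in> I \<Longrightarrow> y \<in> I \<Longrightarrow> x \<otimes> y \<in> I"
    and Idown: "\<And>x y. x \<in> I \<Longrightarrow> y \<in> carrier H \<Longrightarrow> y \<preceq> x \<Longrightarrow> y \<in> I"
    using I(1) unfolding hoop_ideal_def by auto
  have archimedean: "\<exists>k::nat. \<exists>i\<in>I. u \<preceq> h [^] k \<otimes> i" if h: "h \<in> carrier H" "h \<notin> I" for h
  proof (rule ccontr)
    assume no: "\<not> ?thesis"
    \<comment> \<open>The ideal generated by \<open>I\<close> and \<open>h\<close>. If it missed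
      \<open>u\<close>, maximality would make it equal to \<open>I\<close>, although it contains
      \<open>h\<close>.\<close>
    define J where "J = {x\<in>carrier H. \<exists>k::nat. \<exists>i\<in>I. x \<preceq> h [^] k \<otimes> i}"
    have "hoop_ideal J"
      unfolding hoop_ideal_def
    proof (intro conjI ballI impI)
      show "J \<subseteq> carrier H" by (auto simp: J_def)
      have "\<one> \<preceq> h [^] (0::nat) \<otimes> \<one>" by (simp add: one_hle)
      then show "\<one> \<in> J" unfolding J_def using I1 by blast
      fix x assume "x \<in> J"
      then obtain k :: nat and i where x: "x \<in> carrier H" "i \<in> I" "x \<preceq> h [^] k \<otimes> i"
        by (auto simp: J_def)
      {
        fix y assume "y \<in> J"
        then obtain k' :: nat and i' where y: "y \<in> carrier H" "i' \<in> I" "y \<preceq> h [^] k' \<otimes> i'"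
          by (auto simp: J_def)
        have ic: "i \<in> carrier H" "i' \<in> carrier H" using x y IH by auto
        have "x \<otimes> y \<preceq> (h [^] k \<otimes> i) \<otimes> (h [^] k' \<otimes> i')"
          using x y ic h by (intro hle_mono) auto
        also have "(h [^] k \<otimes> i) \<otimes> (h [^] k' \<otimes> i') = h [^] (k + k') \<otimes> (i \<otimes> i')"
          using ic h by (simp add: m_ac flip: nat_pow_mult)
        finally show "x \<otimes> y \<in> J" using x y Iadd[OF x(2) y(2)] by (auto simp: J_def)
      }
      fix y assume y: "y \<in> carrier H" "y \<preceq> x"
      have "y \<preceq> h [^] k \<otimes> i" using hle_trans[OF y(2) x(3)] x y h IH by auto
      then show "y \<in> J" using y x(2) by (auto simp: J_def)
    qed
    moreover have "I \<subseteq> J"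
    proof
      fix i assume i: "i \<in> I"
      then have "i \<preceq> h [^] (0::nat) \<otimes> i" using IH hle_refl by auto
      then show "i \<in> J" using i IH unfolding J_def by blast
    qed
    moreover have "u \<notin> J" using no by (auto simp: J_def)
    ultimately have "J = I" by (rule max)
    have "h \<preceq> h [^] (1::nat) \<otimes> \<one>" using h(1) hle_refl by simp
    then have "h \<in> J" using h(1) I1 unfolding J_def by blast
    with \<open>J = I\<close> h(2) show False by simp
  qed
  define pl where "pl x y \<longleftrightarrow> x \<setminus> y \<in> I" for x y
  have plI: "pl x y" if "x \<preceq> y \<otimes> i" "i \<in> I" "x \<in> carrier H" "y \<in> carrier H" for x y i
    using that hle_residual[of x y i] Idown[of i "x \<setminus> y"] IH monus_closed by (auto simp: pl_def)
  have plD: "\<exists>i\<in>I. x \<preceq> y \<otimes> i" if "pl x y" "x \<in> carrier H" "y \<in> carrier H" for x y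
    using that hle_residual[of x y "x \<setminus> y"] hle_refl monus_closed by (auto simp: pl_def)
  have pl_hle: "pl x y" if "x \<preceq> y" "x \<in> carrier H" "y \<in> carrier H" for x y
    using plI[of x y \<one>] I1 that by simp
  have pl_trans: "pl x z" if xy: "pl x y" and yz: "pl y z"
    and c: "x \<in> carrier H" "y \<in> carrier H" "z \<in> carrier H" for x y z
  proof -
    obtain i where i: "i \<in> I" "x \<preceq> y \<otimes> i" using plD[OF xy c(1,2)] by auto
    obtain j where j: "j \<in> I" "y \<preceq> z \<otimes> j" using plD[OF yz c(2,3)] by auto
    have ic: "i \<in> carrier H" "j \<in> carrier H" using i j IH by auto
    have "y \<otimes> i \<preceq> (z \<otimes> j) \<otimes> i" using j c ic hle_refl by (intro hle_mono) auto
    then have "x \<preceq> (z \<otimes> j) \<otimes> i" using hle_trans[OF i(2)] c ic by auto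
    then have "x \<preceq> z \<otimes> (j \<otimes> i)" using c ic by (simp add: m_assoc)
    then show ?thesis using plI Iadd i(1) j(1) c by blast
  qed
  have pl_add: "pl (x \<otimes> x') (y \<otimes> y')" if xy: "pl x y" and xy': "pl x' y'"
    and c: "x \<in> carrier H" "y \<in> carrier H" "x' \<in> carrier H" "y' \<in> carrier H" for x y x' y'
  proof -
    obtain i where i: "i \<in> I" "x \<preceq> y \<otimes> i" using plD[OF xy c(1,2)] by auto
    obtain j where j: "j \<in> I" "x' \<preceq> y' \<otimes> j" using plD[OF xy' c(3,4)] by auto
    have ic: "i \<in> carrier H" "j \<in> carrier H" using i j IH by auto
    have "x \<otimes> x' \<preceq> (y \<otimes> i) \<otimes> (y' \<otimes> j)" using i j c ic by (intro hle_mono) auto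
    also have "(y \<otimes> i) \<otimes> (y' \<otimes> j) = (y \<otimes> y') \<otimes> (i \<otimes> j)" using c ic by (simp add: m_ac)
    finally show ?thesis using plI Iadd i(1) j(1) c by auto
  qed
  have pl_pow: "pl (x [^] k) (y [^] k)" if "pl x y" "x \<in> carrier H" "y \<in> carrier H" for x y and k :: nat
  proof (induction k)
    case 0
    then show ?case using pl_hle[of \<one> \<one>] hle_refl by simp
  next
    case (Suc k)
    then show ?case using pl_add[OF Suc that(1)] that by simp
  qed
  have pl_total: "pl x y \<or> pl y x" if c: "x \<in> carrier H" "y \<in> carrier H" for x y
  proof (rule ccontr)
    let ?a = "x \<setminus> y" and ?b = "y \<setminus> x"
    assume "\<not> (pl x y \<or> pl y x)"
    then have ab: "?a \<in> carrier H" "?b \<in> carrier H" "?a \<notin> I" "?b \<notin> I"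
      using c monus_closed by (auto simp: pl_def)
    obtain k :: nat and i where i: "i \<in> I" "u \<preceq> ?a [^] k \<otimes> i" using archimedean[OF ab(1,3)] by auto
    obtain l :: nat and j where j: "j \<in> I" "u \<preceq> ?b [^] l \<otimes> j" using archimedean[OF ab(2,4)] by auto
    have ic: "i \<in> carrier H" "j \<in> carrier H" using i j IH by auto
    have kl: "?a [^] k \<in> carrier H" "?b [^] l \<in> carrier H" using ab by auto
    \<comment> \<open>The excess of \<open>u\<close> over \<open>i \<otimes> j\<close> lies below a
      multiple of \<open>?a\<close> and below one of \<open>?b\<close>. These are disjoint, so the
      excess vanishes and \<open>u\<close> falls into \<open>I\<close>.\<close>
    let ?v = "u \<setminus> (i \<otimes> j)"
    have "?a [^] k \<otimes> i \<preceq> (?a [^] k \<otimes> i) \<otimes> j" "?b [^] l \<otimes> j \<preceq> (?b [^] l \<otimes> j) \<otimes> i"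
      using ic kl by (auto intro!: hle_add)
    then have "u \<preceq> (?a [^] k \<otimes> i) \<otimes> j" "u \<preceq> (?b [^] l \<otimes> j) \<otimes> i"
      using hle_trans[OF i(2)] hle_trans[OF j(2)] ic kl uH by auto
    then have "u \<preceq> (i \<otimes> j) \<otimes> ?a [^] k" "u \<preceq> (i \<otimes> j) \<otimes> ?b [^] l"
      using ic kl by (simp_all add: m_ac)
    then have "?v \<preceq> ?a [^] k" "?v \<preceq> ?b [^] l"
      using hle_residual[of u "i \<otimes> j"] uH ic kl by auto
    moreover have "hperp (?a [^] k) (?b [^] l)"
      by (rule hperp_sym, rule hperp_pow, rule hperp_sym, rule hperp_pow, rule hperp_monus[OF c])
        (rule ab kl)+
    ultimately have "?v = \<one>" using monus_closed uH ic by (auto simp: hperp_def)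
    then have "u \<preceq> i \<otimes> j" by (simp add: hoop_le_def)
    then show False using Idown[OF Iadd[OF i(1) j(1)] uH] I(2) by blast
  qed
  have pl_u: "p \<le> q" if pq: "pl (u [^] p) (u [^] q)" for p q :: nat
  proof (rule ccontr)
    assume "\<not> p \<le> q"
    then obtain d where d: "p = q + Suc d" using less_imp_Suc_add[of q p] by auto
    obtain i where i: "i \<in> I" "u [^] p \<preceq> u [^] q \<otimes> i" using plD[OF pq] uH by auto
    have pd: "u [^] p = (u [^] d \<otimes> u) \<otimes> u [^] q"
      unfolding d using nat_pow_mult[OF uH, of "Suc d" q] by (simp add: add.commute)
    have iH: "i \<in> carrier H" using i(1) IH by blast
    then have "u [^] q \<otimes> i = i \<otimes> u [^] q" using uH by (intro m_comm) auto
    then have "(u [^] d \<otimes> u) \<otimes> u [^] q \<preceq> i \<otimes> u [^] q" using i(2) unfolding pd by simp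
    then have 1: "u [^] d \<otimes> u \<preceq> i" by (rule hle_cancel) (use uH iH in auto)
    have "u \<preceq> u \<otimes> u [^] d" using uH by (intro hle_add) auto
    also have "u \<otimes> u [^] d = u [^] d \<otimes> u" using uH by (intro m_comm) auto
    finally have "u \<preceq> i" using 1 by (rule hle_trans) (use uH iH in auto)
    then show False using Idown[OF i(1) uH] I(2) by blast
  qed
  \<comment> \<open>The upper Dedekind cut of the ratio of \<open>h\<close> to \<open>u\<close>:
    fractions \<open>p / q\<close> with \<open>q h\<close> at most \<open>p u\<close> modulo
    \<open>I\<close>.\<close>
  define S where "S h = {real p / real q | p q::nat. 0 < q \<and> pl (h [^] q) (u [^] p)}" for h
  define e where "e h = Inf (S h)" for h
  have S_bdd: "bdd_below (S h)" for h
    by (rule bdd_belowI[of _ 0]) (auto simp: S_def)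
  have S_ne: "S h \<noteq> {}" if h: "h \<in> carrier H" for h
  proof -
    obtain k :: nat where "h \<preceq> u [^] k" using unit'[OF h] by auto
    then have "pl (h [^] (1::nat)) (u [^] k)" using pl_hle h uH by simp
    then have "real k / real 1 \<in> S h" unfolding S_def by blast
    then show ?thesis by auto
  qed
  have e_le: "e h \<le> real p / real q" if "0 < q" "pl (h [^] q) (u [^] p)" for h and p q :: nat
    unfolding e_def by (rule cInf_lower) (use that S_bdd in \<open>auto simp: S_def\<close>)
  have e_ge: "real p / real q \<le> e h" if q: "0 < q" and p: "pl (u [^] p) (h [^] q)" and h: "h \<in> carrier H"
    for h and p q :: nat
    unfolding e_def
  proof (rule cInf_greatest[OF S_ne[OF h]])
    fix r assume "r \<in> S h"
    then obtain p' q' :: nat where r: "r = real p' / real q'" "0 < q'" "pl (h [^] q') (u [^] p')"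
      by (auto simp: S_def)
    have 1: "pl (u [^] (p * q')) (h [^] (q * q'))"
      using pl_pow[OF p, of q'] h uH by (simp add: nat_pow_pow)
    have "pl (h [^] (q' * q)) (u [^] (p' * q))"
      using pl_pow[OF r(3), of q] h uH by (simp add: nat_pow_pow)
    then have 2: "pl (h [^] (q * q')) (u [^] (p' * q))"
      by (subst mult.commute)
    have "pl (u [^] (p * q')) (u [^] (p' * q))"
      using pl_trans[OF 1 2] h uH by simp
    then have "p * q' \<le> p' * q" by (rule pl_u)
    then have "real p * real q' \<le> real p' * real q" by (metis of_nat_le_iff of_nat_mult)
    then show "real p / real q \<le> r" using q r(2) unfolding r(1) by (simp add: divide_simps)
  qed
  \<comment> \<open>By totality, the last multiple of \<open>u\<close> below \<open>q h\<close>
    traps \<open>q h\<close> modulo \<open>I\<close> between \<open>p u\<close> and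
    \<open>(p + 1) u\<close>, and hence \<open>e h\<close> in an interval of length
    \<open>1 / q\<close>. Additivity follows as \<open>q\<close> grows.\<close>
  have approx: "\<exists>p::nat. pl (u [^] p) (h [^] q) \<and> pl (h [^] q) (u [^] Suc p)"
    if h: "h \<in> carrier H" for h and q :: nat
  proof -
    obtain k :: nat where "h [^] q \<preceq> u [^] k" using unit'[of "h [^] q"] h by auto
    then have k: "pl (h [^] q) (u [^] k)" using pl_hle h uH by simp
    have bound: "p \<le> k" if "pl (u [^] p) (h [^] q)" for p
      using pl_trans[OF that k] h uH pl_u by simp
    have "pl (u [^] (0::nat)) (h [^] q)" using pl_hle[OF one_hle] h by simp
    then have "pl (u [^] (GREATEST p::nat. pl (u [^] p) (h [^] q))) (h [^] q)"
      by (rule GreatestI_nat[where P = "\<lambda>p::nat. pl (u [^] p) (h [^] q)" and b = k]) (use bound in simp)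
    moreover have "p' \<le> (GREATEST p::nat. pl (u [^] p) (h [^] q))" if "pl (u [^] p') (h [^] q)" for p'
      using that by (rule Greatest_le_nat[where P = "\<lambda>p::nat. pl (u [^] p) (h [^] q)" and b = k]) (use bound in simp)
    ultimately obtain p :: nat where p: "pl (u [^] p) (h [^] q)" "\<forall>p'. pl (u [^] p') (h [^] q) \<longrightarrow> p' \<le> p"
      by blast
    then have "\<not> pl (u [^] Suc p) (h [^] q)" using Suc_n_not_le_n by blast
    then have "pl (h [^] q) (u [^] Suc p)" using pl_total[of "u [^] Suc p" "h [^] q"] h uH by auto
    with p(1) show ?thesis by blast
  qed
  have e_nonneg: "0 \<le> e h" if "h \<in> carrier H" for h
    using e_ge[of 1 0 h] pl_hle[OF one_hle, of h] that by simp
  have e_add: "e (x \<otimes> y) = e x + e y" if c: "x \<in> carrier H" "y \<in> carrier H" for x y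
  proof -
    have close: "\<bar>e (x \<otimes> y) - (e x + e y)\<bar> \<le> 2 * (1 / real q)" if q: "0 < q" for q :: nat
    proof -
      obtain p where p: "pl (u [^] p) (x [^] q)" "pl (x [^] q) (u [^] Suc p)" using approx[OF c(1)] by blast
      obtain r where r: "pl (u [^] r) (y [^] q)" "pl (y [^] q) (u [^] Suc r)" using approx[OF c(2)] by blast
      have xy: "(x \<otimes> y) [^] q = x [^] q \<otimes> y [^] q" using c by (rule nat_pow_distrib)
      have "pl (u [^] (p + r)) ((x \<otimes> y) [^] q)"
        using pl_add[OF p(1) r(1)] c uH unfolding xy by (simp add: nat_pow_mult)
      then have 1: "real (p + r) / real q \<le> e (x \<otimes> y)" by (rule e_ge[OF q]) (use c in simp)
      have "pl ((x \<otimes> y) [^] q) (u [^] (Suc p + Suc r))"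
        using pl_add[OF p(2) r(2)] c uH unfolding xy by (simp only: nat_pow_mult nat_pow_closed)
      then have 2: "e (x \<otimes> y) \<le> real (Suc p + Suc r) / real q" using e_le q by blast
      have 3: "real p / real q \<le> e x" "e x \<le> real (Suc p) / real q"
        using e_ge[OF q p(1) c(1)] e_le[OF q p(2)] by auto
      have 4: "real r / real q \<le> e y" "e y \<le> real (Suc r) / real q"
        using e_ge[OF q r(1) c(2)] e_le[OF q r(2)] by auto
      have s: "real (p + r) / real q = real p / real q + real r / real q"
        "real (Suc p + Suc r) / real q = real p / real q + real r / real q + 2 * (1 / real q)"
        "real (Suc p) / real q = real p / real q + 1 / real q"
        "real (Suc r) / real q = real r / real q + 1 / real q"
        by (simp_all add: add_divide_distrib)
      show ?thesis using 1 2 3 4 unfolding s by linarith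
    qed
    show ?thesis
    proof (rule ccontr)
      assume "e (x \<otimes> y) \<noteq> e x + e y"
      then have "0 < \<bar>e (x \<otimes> y) - (e x + e y)\<bar> / 2" by simp
      then obtain m where "1 / real (Suc m) < \<bar>e (x \<otimes> y) - (e x + e y)\<bar> / 2"
        using nat_approx_posE by blast
      with close[of "Suc m"] show False by simp
    qed
  qed
  have e_I: "e i = 0" if "i \<in> I" for i
  proof -
    have ic: "i \<in> carrier H" using that IH by auto
    have "pl (i [^] (1::nat)) (u [^] (0::nat))" using that ic by (simp add: pl_def)
    then show ?thesis using e_le[of 1 i 0] e_nonneg[OF ic] by simp
  qed
  have e_monus: "e (x \<setminus> y) = max 0 (e x - e y)" if c: "x \<in> carrier H" "y \<in> carrier H" for x y
  proof -
    have mc: "x \<setminus> y \<in> carrier H" "y \<setminus> x \<in> carrier H" using c monus_closed by auto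
    \<comment> \<open>Additivity turns the swap axiom into this equation, and totality modulo
      \<open>I\<close> kills one of the two differences; the other is then determined.\<close>
    have eq: "e x + e (y \<setminus> x) = e y + e (x \<setminus> y)"
      using arg_cong[OF add_monus_swap[OF c], of e] c mc by (simp add: e_add)
    from pl_total[OF c] have "e (x \<setminus> y) = 0 \<or> e (y \<setminus> x) = 0" using e_I by (auto simp: pl_def)
    then show ?thesis using eq e_nonneg[OF mc(1)] e_nonneg[OF mc(2)] by auto
  qed
  have "e u = 1"
  proof (rule antisym)
    have "pl u u" using pl_hle hle_refl uH by blast
    then show "e u \<le> 1" "1 \<le> e u" using e_le[of 1 u 1] e_ge[of 1 1 u] uH by auto
  qed
  moreover have "e \<in> hoop_hom H nonneg_real_hoop"
    using e_nonneg e_add e_monus e_I[OF I1] by (simp add: hoop_hom_real_iff)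
  ultimately show ?thesis using that by blast
qed

section \<open>Growth of counting functions\<close>

text \<open>Euclid's argument: the least positive numerator \<open>g\<close> divides all others,
  because remainders modulo \<open>g\<close> are truncated differences of elements of
  \<open>S\<close>. With \<open>k = g\<close> the true denominator is \<open>d = b / g\<close>,
  possibly a proper divisor of \<open>b\<close>.\<close>

lemma real_subhoop_discrete:
  fixes S :: "real set" and b :: nat
  assumes b: "0 < b" and S: "S \<subseteq> range (\<lambda>k::nat. real k / real b)"
    and add: "\<And>x y. x \<in> S \<Longrightarrow> y \<in> S \<Longrightarrow> x + y \<in> S"
    and diff: "\<And>x y. x \<in> S \<Longrightarrow> y \<in> S \<Longrightarrow> max 0 (x - y) \<in> S"
    and one: "1 \<in> S"
  obtains d k :: nat where "0 < d" "0 < k" "b = k * d" "S = range (\<lambda>j::nat. real j / real d)"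
proof -
  define Q where "Q j \<longleftrightarrow> 0 < j \<and> real j / real b \<in> S" for j :: nat
  have "Q b" using one b by (simp add: Q_def)
  define g where "g = (LEAST j. Q j)"
  have "Q g" unfolding g_def using \<open>Q b\<close> by (rule LeastI)
  then have g: "0 < g" "real g / real b \<in> S" by (simp_all add: Q_def)
  have g_le: "g \<le> j" if "Q j" for j unfolding g_def using that by (rule Least_le)
  have zero: "0 \<in> S" using diff[OF one one] by simp
  have mult: "real j * (real g / real b) \<in> S" for j :: nat
  proof (induction j)
    case (Suc j)
    then show ?case using add[OF Suc g(2)] by (simp add: algebra_simps add_divide_distrib)
  qed (simp add: zero)
  have dvd: "g dvd j" if j: "real j / real b \<in> S" for j
  proof (rule ccontr)
    assume "\<not> g dvd j"
    then have r: "0 < j mod g" "j mod g < g" using g(1) by (auto simp: mod_greater_zero_iff_not_dvd)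
    have "real j = real (j div g) * real g + real (j mod g)"
      by (metis div_mult_mod_eq of_nat_add of_nat_mult)
    then have "real j / real b - real (j div g) * (real g / real b) = real (j mod g) / real b"
      by (simp add: add_divide_distrib)
    then have "real (j mod g) / real b \<in> S"
      using diff[OF j mult[of "j div g"]] by simp
    then show False using g_le[of "j mod g"] r by (simp add: Q_def)
  qed
  have "g dvd b" using dvd[of b] one b by simp
  then obtain d where d: "b = g * d" by (rule dvdE)
  then have d0: "0 < d" using b by simp
  have gb: "real (g * j) / real b = real j / real d" for j using d g(1) by simp
  have "S = range (\<lambda>j::nat. real j / real d)"
  proof (intro equalityI subsetI)
    fix x assume x: "x \<in> S"
    then obtain j :: nat where j: "x = real j / real b" using S by auto
    then obtain i where "j = g * i" using dvd x by (auto elim: dvdE)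
    then have "x = real i / real d" using gb j by simp
    then show "x \<in> range (\<lambda>j::nat. real j / real d)" by (rule range_eqI)
  next
    fix x assume "x \<in> range (\<lambda>j::nat. real j / real d)"
    then obtain j :: nat where "x = real j / real d" by auto
    then have "x = real j * (real g / real b)" using gb[of j] by (simp add: mult.commute)
    then show "x \<in> S" using mult by simp
  qed
  with d0 g(1) d show ?thesis by (rule that)
qed

lemma card_le_of_nat_coordinates:
  fixes v :: "'e \<Rightarrow> 's \<Rightarrow> real"
  assumes S: "finite S" and M: "0 \<le> M"
    and v: "\<And>e s. e \<in> A \<Longrightarrow> s \<in> S \<Longrightarrow> v e s \<in> \<nat> \<and> v e s \<le> M"
    and inj: "\<And>e e'. e \<in> A \<Longrightarrow> e' \<in> A \<Longrightarrow> (\<And>s. s \<in> S \<Longrightarrow> v e s = v e' s) \<Longrightarrow> e = e'"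
  shows "finite A" "real (card A) \<le> (M + 1) ^ card S"
proof -
  define c where "c e = (\<lambda>s\<in>S. nat \<lfloor>v e s\<rfloor>)" for e
  define B where "B = S \<rightarrow>\<^sub>E {..nat \<lfloor>M\<rfloor>}"
  have "finite B" unfolding B_def using S by (intro finite_PiE) auto
  have cB: "c ` A \<subseteq> B"
  proof (rule image_subsetI)
    fix e assume "e \<in> A"
    then have "nat \<lfloor>v e s\<rfloor> \<le> nat \<lfloor>M\<rfloor>" if "s \<in> S" for s
      using v[OF _ that] by (intro nat_mono floor_mono) auto
    then show "c e \<in> B" by (simp add: B_def c_def)
  qed
  have "inj_on c A"
  proof (rule inj_onI)
    fix e e' assume e: "e \<in> A" "e' \<in> A" "c e = c e'"
    have "v e s = v e' s" if s: "s \<in> S" for s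
    proof -
      obtain i j where ij: "v e s = real i" "v e' s = real j"
        using v[OF e(1) s] v[OF e(2) s] by (auto elim!: Nats_cases)
      moreover have "nat \<lfloor>v e s\<rfloor> = nat \<lfloor>v e' s\<rfloor>"
        using fun_cong[OF e(3), of s] s by (simp add: c_def)
      ultimately show ?thesis by simp
    qed
    then show "e = e'" using inj e(1,2) by simp
  qed
  then show "finite A" using cB \<open>finite B\<close> by (meson finite_imageD finite_subset)
  have "card A \<le> card B"
    using \<open>inj_on c A\<close> cB \<open>finite B\<close> by (rule card_inj_on_le)
  also have "card B = (nat \<lfloor>M\<rfloor> + 1) ^ card S"
    using S by (simp add: B_def card_PiE)
  finally have "real (card A) \<le> (real (nat \<lfloor>M\<rfloor>) + 1) ^ card S"
    by (metis of_nat_le_iff of_nat_power of_nat_add of_nat_1)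
  also have "\<dots> \<le> (M + 1) ^ card S"
    using M by (intro power_mono) linarith+
  finally show "real (card A) \<le> (M + 1) ^ card S" .
qed

text \<open>Telescoping, from \<open>1 / (M + 1)^2 \<le> 1 / M - 1 / (M + 1)\<close>.\<close>

lemma sum_inverse_squares_tail:
  fixes K M :: nat
  assumes "0 < K" "K \<le> M"
  shows "(\<Sum>k\<in>{K<..M}. 1 / real k ^ 2) \<le> 1 / real K - 1 / real M"
  using assms(2)
proof (induction M rule: dec_induct)
  case (step M)
  have "{K<..Suc M} = insert (Suc M) {K<..M}" using step by auto
  then have "(\<Sum>k\<in>{K<..Suc M}. 1 / real k ^ 2) = 1 / real (Suc M) ^ 2 + (\<Sum>k\<in>{K<..M}. 1 / real k ^ 2)"
    by simp
  also have "\<dots> \<le> 1 / real (Suc M) ^ 2 + (1 / real K - 1 / real M)" using step by simp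
  also have "1 / real (Suc M) ^ 2 \<le> 1 / real M - 1 / real (Suc M)"
  proof -
    have M: "0 < real M" using step assms(1) by simp
    have "1 / real (Suc M) ^ 2 \<le> 1 / (real M * real (Suc M))"
      using M by (intro divide_left_mono) (auto simp: power2_eq_square)
    also have "\<dots> = 1 / real M - 1 / real (Suc M)" using M by (simp add: field_simps)
    finally show ?thesis .
  qed
  finally show ?case by simp
qed simp

text \<open>Here \<open>N\<close> counts primitive lattice points, and the sum in \<open>lower\<close> all of them, sorted by their
  largest integral factor. Since the exponent is at least \<open>2\<close>, the points with a large factor are a
  small proportion, so the primitive ones have the same order of growth.\<close>

lemma growth_of_primitive_count:
  fixes N :: "real \<Rightarrow> real"
  assumes m: "2 \<le> m" and A: "0 < A" and c: "0 < c"
    and mono: "\<And>s t. s \<le> t \<Longrightarrow> N s \<le> N t" and nonneg: "\<And>t. 0 \<le> N t"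
    and upper: "\<And>t. 1 \<le> t \<Longrightarrow> N t \<le> A * t ^ m"
    and lower: "\<And>T::nat. 1 \<le> T \<Longrightarrow> real T ^ m \<le> (\<Sum>k\<in>{1..nat \<lfloor>c * real T\<rfloor>}. N (c * real T / real k))"
  obtains c' where "0 < c'" "\<And>t. c \<le> t \<Longrightarrow> c' * t ^ m \<le> N t"
proof -
  \<comment> \<open>Chosen such that the terms with factor above \<open>K\<close>, at most
    \<open>A * s ^ m / K\<close> in total for \<open>s = c * T\<close>, take up no more than half of
    \<open>T ^ m\<close>.\<close>
  define K where "K = nat \<lceil>2 * A * c ^ m\<rceil> + 1"
  have K: "0 < K" "2 * A * c ^ m \<le> real K" unfolding K_def by linarith+
  have main: "real T ^ m / 2 \<le> real K * N (c * real T)" if T: "1 \<le> T" for T :: nat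
  proof -
    define s where "s = c * real T"
    define M where "M = nat \<lfloor>s\<rfloor>"
    have s0: "0 \<le> s" using c by (simp add: s_def)
    \<comment> \<open>Factors up to \<open>K\<close> are estimated by \<open>N s\<close> through
      monotonicity. The range is enlarged to \<open>max K M\<close> so that the split at
      \<open>K\<close> makes sense also when \<open>M < K\<close>; the added terms are
      nonnegative.\<close>
    have "(\<Sum>k\<in>{1..M}. N (s / real k)) \<le> (\<Sum>k\<in>{1..K} \<union> {K<..max K M}. if k \<le> K then N s else
        (if k \<le> M then N (s / real k) else 0))"
    proof (rule sum_le_included[where i = "\<lambda>k. k"])
      show "\<forall>k\<in>{1..M}. \<exists>k'\<in>{1..K} \<union> {K<..max K M}. k' = k \<and> N (s / real k) \<le>
          (if k' \<le> K then N s else (if k' \<le> M then N (s / real k') else 0))"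
      proof
        fix k assume k: "k \<in> {1..M}"
        have "s / real k \<le> s" using k s0 by (simp add: divide_le_eq mult_le_cancel_left1)
        then show "\<exists>k'\<in>{1..K} \<union> {K<..max K M}. k' = k \<and> N (s / real k) \<le>
            (if k' \<le> K then N s else (if k' \<le> M then N (s / real k') else 0))"
          using k mono by (intro bexI[of _ k]) auto
      qed
    qed (use nonneg in auto)
    also have "\<dots> = (\<Sum>k\<in>{1..K}. N s) + (\<Sum>k\<in>{K<..max K M}. if k \<le> M then N (s / real k) else 0)"
      by (subst sum.union_disjoint) (auto intro!: arg_cong2[where f = "(+)"] sum.cong)
    also have "(\<Sum>k\<in>{K<..max K M}. if k \<le> M then N (s / real k) else 0) \<le>
        (\<Sum>k\<in>{K<..max K M}. A * s ^ m * (1 / real k ^ 2))"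
    proof (rule sum_mono)
      fix k assume k: "k \<in> {K<..max K M}"
      then have k0: "1 \<le> real k" by simp
      show "(if k \<le> M then N (s / real k) else 0) \<le> A * s ^ m * (1 / real k ^ 2)"
      proof (cases "k \<le> M")
        case True
        then have "real k \<le> s" unfolding M_def using s0 by linarith
        then have "N (s / real k) \<le> A * (s / real k) ^ m" using k0 by (intro upper) (simp add: le_divide_eq)
        also have "\<dots> = A * s ^ m * (1 / real k ^ m)" by (simp add: power_divide)
        also have "\<dots> \<le> A * s ^ m * (1 / real k ^ 2)"
          using A s0 k0 m by (intro mult_left_mono divide_left_mono power_increasing) auto
        finally show ?thesis using True by simp
      next
        case False
        then show ?thesis using A s0 by simp
      qed
    qed
    also have "(\<Sum>k\<in>{K<..max K M}. A * s ^ m * (1 / real k ^ 2)) =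
        A * s ^ m * (\<Sum>k\<in>{K<..max K M}. 1 / real k ^ 2)"
      by (rule sum_distrib_left[symmetric])
    also have "\<dots> \<le> A * s ^ m * (1 / real K)"
    proof -
      have "(\<Sum>k\<in>{K<..max K M}. 1 / real k ^ 2) \<le> 1 / real K - 1 / real (max K M)"
        using K(1) by (intro sum_inverse_squares_tail) auto
      also have "\<dots> \<le> 1 / real K" by simp
      finally show ?thesis using A s0 by (intro mult_left_mono) auto
    qed
    finally have "(\<Sum>k\<in>{1..M}. N (s / real k)) \<le> real K * N s + A * s ^ m * (1 / real K)" by simp
    moreover have "real T ^ m \<le> (\<Sum>k\<in>{1..M}. N (s / real k))"
      using lower[OF T] by (simp add: M_def s_def)
    moreover have "A * s ^ m * (1 / real K) \<le> real T ^ m / 2"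
    proof -
      have "2 * A * c ^ m * real T ^ m \<le> real K * real T ^ m"
        using K(2) by (intro mult_right_mono) auto
      then show ?thesis using K(1) by (simp add: s_def power_mult_distrib field_simps)
    qed
    ultimately show ?thesis unfolding s_def by linarith
  qed
  \<comment> \<open>Comes from \<open>T = \<lfloor>t / c\<rfloor> \<ge> t / (2 c)\<close>, valid as
    \<open>t \<ge> c\<close>, and from the estimate
    \<open>T ^ m / 2 \<le> K * N (c T)\<close>.\<close>
  define c' where "c' = 1 / ((2 * c) ^ m * 2 * real K)"
  have "0 < c'" using c K(1) by (simp add: c'_def)
  moreover have "c' * t ^ m \<le> N t" if t: "c \<le> t" for t
  proof -
    define T where "T = nat \<lfloor>t / c\<rfloor>"
    have "1 \<le> t / c" using c t by simp
    then have T: "1 \<le> T" "real T \<le> t / c" "t / c < real T + 1" unfolding T_def by linarith+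
    have "t / c \<le> 2 * real T" using T by linarith
    then have "t / (2 * c) \<le> real T" using c by (simp add: field_simps)
    then have "(t / (2 * c)) ^ m \<le> real T ^ m" using c t by (intro power_mono) auto
    also have "\<dots> \<le> 2 * real K * N (c * real T)" using main[OF T(1)] by simp
    also have "\<dots> \<le> 2 * real K * N t"
      using T(2) c by (intro mult_left_mono mono) (auto simp: field_simps)
    finally have "t ^ m / (2 * c) ^ m \<le> 2 * real K * N t" by (simp add: power_divide)
    then show ?thesis using c K(1) by (simp add: c'_def field_simps)
  qed
  ultimately show ?thesis by (rule that)
qed

lemma tendsto_ln_const_power_ratio:
  fixes A :: real
  assumes "0 < A"
  shows "((\<lambda>t. ln (A * t ^ m) / ln t) \<longlongrightarrow> real m) at_top"
proof -
  have "((\<lambda>t. ln A / ln t + real m) \<longlongrightarrow> 0 + real m) at_top"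
    by (intro tendsto_add tendsto_const real_tendsto_divide_at_top[OF tendsto_const ln_at_top])
  moreover have "\<forall>\<^sub>F t in at_top. ln A / ln t + real m = ln (A * t ^ m) / ln t"
    using eventually_gt_at_top[of 1]
  proof eventually_elim
    case (elim t)
    then have "ln (A * t ^ m) = ln A + real m * ln t"
      using assms by (simp add: ln_mult ln_realpow)
    then show ?case using elim by (simp add: add_divide_distrib)
  qed
  ultimately show ?thesis by (simp add: filterlim_cong)
qed

lemma tendsto_ln_ratio:
  fixes N :: "real \<Rightarrow> real"
  assumes c: "0 < c" "\<forall>\<^sub>F t in at_top. c * t ^ m \<le> N t"
    and A: "0 < A" "\<forall>\<^sub>F t in at_top. N t \<le> A * t ^ m"
  shows "((\<lambda>t. ln (N t) / ln t) \<longlongrightarrow> real m) at_top"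
proof (rule tendsto_sandwich[OF _ _ tendsto_ln_const_power_ratio[OF c(1)] tendsto_ln_const_power_ratio[OF A(1)]])
  show "\<forall>\<^sub>F t in at_top. ln (c * t ^ m) / ln t \<le> ln (N t) / ln t"
    using c(2) eventually_gt_at_top[of 1]
  proof eventually_elim
    case (elim t)
    then have "0 < c * t ^ m" using c(1) by simp
    then show ?case using elim by (intro divide_right_mono) auto
  qed
  show "\<forall>\<^sub>F t in at_top. ln (N t) / ln t \<le> ln (A * t ^ m) / ln t"
    using c(2) A(2) eventually_gt_at_top[of 1]
  proof eventually_elim
    case (elim t)
    then have "0 < c * t ^ m" using c(1) by simp
    then show ?case using elim by (intro divide_right_mono) auto
  qed
qed

section \<open>The maximal spectrum as a polyhedron\<close>

context presented_hoop
begin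

definition zero_ideal :: "(nat \<Rightarrow> real) \<Rightarrow> 'a set" where
  "zero_ideal x = {h \<in> carrier H. hval x h = 0}"

lemma base_in_cone: "x \<in> base \<Longrightarrow> x \<in> solution_cone n R"
  by (simp add: base_def)

lemma zero_ideal_kernel: "zero_ideal x = kernel H nonneg_real_hoop (hval x)"
  by (simp add: zero_ideal_def kernel_def nonneg_real_hoop_def)

lemma zero_ideal_in_max_spec:
  assumes x: "x \<in> base"
  shows "zero_ideal x \<in> max_spec H"
proof -
  have "\<exists>i<n. x i \<noteq> 0"
  proof (rule ccontr)
    assume "\<not> ?thesis"
    then have "(\<Sum>i<n. x i) = 0" by (intro sum.neutral) auto
    with x show False by (simp add: base_def)
  qed
  then obtain i where "i < n" "x i \<noteq> 0" by auto
  then have "hval x (rep (HVar i)) \<noteq> 0" "rep (HVar i) \<in> carrier H"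
    using hval_generator base_in_cone[OF x] rep_closed[of "HVar i"] by auto
  then show ?thesis
    unfolding max_spec_def zero_ideal_kernel using hval_hom[OF base_in_cone[OF x]] by blast
qed

lemma max_spec_elim:
  assumes "I \<in> max_spec H"
  shows "\<exists>x\<in>base. I = zero_ideal x"
proof -
  obtain e h where e: "e \<in> hoop_hom H nonneg_real_hoop" "I = kernel H nonneg_real_hoop e"
      and h: "h \<in> carrier H" "e h \<noteq> 0"
    using assms unfolding max_spec_def by auto
  define x where "x = point e"
  have x: "x \<in> solution_cone n R" unfolding x_def using e(1) by (rule point_in_cone)
  have eq: "e a = hval x a" if "a \<in> carrier H" for a
    unfolding x_def using e(1) that by (rule hom_eq_hval)
  have "\<exists>i. x i \<noteq> 0"
  proof (rule ccontr)
    assume "\<not> ?thesis"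
    then have "x = (\<lambda>i. 0 * x i)" by auto
    then have "hval x h = 0 * hval x h" using hval_scale[OF x, of 0 h] h(1) by simp
    with h eq show False by simp
  qed
  then obtain i where i: "x i \<noteq> 0" by blast
  define c where "c = 1 / (\<Sum>i<n. x i)"
  have c: "0 < c" using normalized_in_base(1)[OF x i] by (simp add: c_def)
  have "I = zero_ideal (\<lambda>i. c * x i)"
    using e(2) eq c hval_scale[OF x, of c]
    by (auto simp: kernel_def zero_ideal_def nonneg_real_hoop_def)
  moreover have "(\<lambda>i. c * x i) \<in> base" using normalized_in_base(2)[OF x i] by (simp add: c_def)
  ultimately show ?thesis by blast
qed

lemma in_zero_ideal_rep:
  "x \<in> base \<Longrightarrow> term_vars t \<subseteq> {..<n} \<Longrightarrow> rep t \<in> zero_ideal x \<longleftrightarrow> term_eval x t = 0"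
  using hval_rep[OF base_in_cone] rep_closed by (simp add: zero_ideal_def)

text \<open>On the base, where the coordinate sum is 1, the value is the positive part of
  \<open>q * x i - p\<close>. The hull-kernel open set of this element is therefore the half-space
  \<open>x i > p / q\<close>; \<open>below\<close> gives the opposite one.\<close>

definition above :: "nat \<Rightarrow> nat \<Rightarrow> nat \<Rightarrow> hoop_term" where
  "above i p q = HMonus (term_mult q (HVar i)) (term_mult p (term_var_sum n))"

definition below :: "nat \<Rightarrow> nat \<Rightarrow> nat \<Rightarrow> hoop_term" where
  "below i p q = HMonus (term_mult p (term_var_sum n)) (term_mult q (HVar i))"

lemma above_below_vars:
  assumes "i < n"
  shows "term_vars (above i p q) \<subseteq> {..<n}" "term_vars (below i p q) \<subseteq> {..<n}"
proof -
  have "term_vars (term_mult q (HVar i)) \<subseteq> {..<n}" "term_vars (term_mult p (term_var_sum n)) \<subseteq> {..<n}"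
    using assms term_vars_var_sum by (auto intro!: term_vars_mult)
  then show "term_vars (above i p q) \<subseteq> {..<n}" "term_vars (below i p q) \<subseteq> {..<n}"
    by (simp_all add: above_def below_def)
qed

lemma above_iff:
  assumes "x \<in> base" "i < n" "0 < q"
  shows "rep (above i p q) \<notin> zero_ideal x \<longleftrightarrow> real p / real q < x i"
proof -
  have "term_eval x (above i p q) = max 0 (real q * x i - real p)"
    using assms(1) by (simp add: above_def term_eval_mult term_eval_var_sum base_def)
  moreover have max_pos: "max 0 (a - b) \<noteq> 0 \<longleftrightarrow> b < a" for a b :: real by auto
  ultimately show ?thesis
    using in_zero_ideal_rep[OF assms(1) above_below_vars(1)[OF assms(2)]] assms(3)
      max_pos[of "real q * x i" "real p"]
    by (simp add: divide_less_eq mult.commute)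
qed

lemma below_iff:
  assumes "x \<in> base" "i < n" "0 < q"
  shows "rep (below i p q) \<notin> zero_ideal x \<longleftrightarrow> x i < real p / real q"
proof -
  have "term_eval x (below i p q) = max 0 (real p - real q * x i)"
    using assms(1) by (simp add: below_def term_eval_mult term_eval_var_sum base_def)
  moreover have max_pos: "max 0 (a - b) \<noteq> 0 \<longleftrightarrow> b < a" for a b :: real by auto
  ultimately show ?thesis
    using in_zero_ideal_rep[OF assms(1) above_below_vars(2)[OF assms(2)]] assms(3)
      max_pos[of "real p" "real q * x i"]
    by (simp add: less_divide_eq mult.commute)
qed

lemma nonneg_rational_between:
  fixes a b :: real
  assumes "0 \<le> a" "a < b"
  obtains p q :: nat where "0 < q" "a < real p / real q" "real p / real q < b"
proof -
  obtain r where r: "r \<in> \<rat>" "a < r" "r < b" using Rats_dense_in_real[OF assms(2)] by auto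
  then have "0 \<le> r" using assms(1) by simp
  obtain p :: int and q :: int where pq: "q > 0" "r = of_int p / of_int q" using r(1) by (rule Rats_cases')
  then have "0 \<le> p" using \<open>0 \<le> r\<close> by (simp add: zero_le_divide_iff)
  then have "r = real (nat p) / real (nat q)" using pq by simp
  then show ?thesis using that[of "nat q" "nat p"] r pq(1) by simp
qed

text \<open>A rational number strictly between two different coordinates separates the
  ideals.\<close>

lemma inj_on_zero_ideal: "inj_on zero_ideal base"
proof -
  have le: "x i \<le> y i" if xy: "x \<in> base" "y \<in> base" "zero_ideal x = zero_ideal y" and i: "i < n" for x y i
  proof (rule ccontr)
    assume "\<not> x i \<le> y i"
    then have yx: "y i < x i" by simp
    have y0: "0 \<le> y i" using cone_nonneg[OF base_in_cone[OF xy(2)]] .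
    obtain p q :: nat where pq: "0 < q" "y i < real p / real q" "real p / real q < x i"
      by (rule nonneg_rational_between[OF y0 yx])
    then have "rep (above i p q) \<notin> zero_ideal x" using above_iff[OF xy(1) i] by simp
    moreover have "rep (above i p q) \<in> zero_ideal y" using above_iff[OF xy(2) i pq(1), of p] pq(2) by simp
    ultimately show False using xy(3) by simp
  qed
  show ?thesis
  proof (rule inj_onI)
    fix x y assume xy: "x \<in> base" "y \<in> base" "zero_ideal x = zero_ideal y"
    show "x = y"
    proof
      fix i show "x i = y i"
        using le[OF xy] le[OF xy(2,1) xy(3)[symmetric]] xy(1,2)
        by (cases "i < n") (auto simp: base_def solution_cone_def intro: antisym)
    qed
  qed
qed

lemma openin_max_spec_basic:
  "h \<in> carrier H \<Longrightarrow> openin (max_spec_topology H) {I \<in> max_spec H. h \<notin> I}"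
  unfolding max_spec_topology_def by (rule topology_generated_by_Basis) blast

lemma continuous_map_zero_ideal:
  "continuous_map (top_of_set base) (max_spec_topology H) zero_ideal"
  unfolding max_spec_topology_def
proof (rule continuous_on_generated_topo)
  fix U assume "U \<in> {{m \<in> max_spec H. h \<notin> m} |h. h \<in> carrier H}"
  then obtain h where h: "h \<in> carrier H" "U = {m \<in> max_spec H. h \<notin> m}" by auto
  obtain t where t: "term_vars t \<subseteq> {..<n}" "rep t = h" using h(1) by (rule rep_obtain)
  have "zero_ideal -` U \<inter> topspace (top_of_set base) = base \<inter> {x. term_eval x t \<noteq> 0}"
    using zero_ideal_in_max_spec in_zero_ideal_rep[OF _ t(1)] t(2) h(2) by auto
  moreover have "open {x. term_eval x t \<noteq> 0}"
    by (intro open_Collect_neq continuous_on_term_eval continuous_on_const)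
  ultimately show "openin (top_of_set base) (zero_ideal -` U \<inter> topspace (top_of_set base))"
    by (simp add: openin_open_Int)
next
  have "\<Union>{{m \<in> max_spec H. h \<notin> m} |h. h \<in> carrier H} = max_spec H"
    using topspace_max_spec_topology[of H] by (simp add: max_spec_topology_def)
  then show "zero_ideal ` topspace (top_of_set base) \<subseteq> \<Union>{{m \<in> max_spec H. h \<notin> m} |h. h \<in> carrier H}"
    using zero_ideal_in_max_spec by auto
qed

text \<open>The coordinates of the inverse are continuous because the sets where they lie above or
  below a rational level are subbasic open sets of the spectrum. Levels are quotients of natural
  numbers; a negative lower bound is satisfied on the whole space.\<close>

lemma continuous_map_inv_zero_ideal:
  "continuous_map (max_spec_topology H) (top_of_set base) (inv_into base zero_ideal)"
proof -
  let ?f = "inv_into base zero_ideal"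
  have img: "zero_ideal ` base = max_spec H"
    using zero_ideal_in_max_spec max_spec_elim by auto
  have f: "?f m \<in> base" "zero_ideal (?f m) = m" if "m \<in> max_spec H" for m
    using that unfolding img[symmetric] by (simp_all add: inv_into_into f_inv_into_f)
  have nn: "0 \<le> ?f m i" if "m \<in> max_spec H" for m i
    using cone_nonneg[OF base_in_cone[OF f(1)[OF that]]] .
  have "continuous_map (max_spec_topology H) euclideanreal (\<lambda>m. ?f m i)" for i
  proof (cases "i < n")
    case False
    then have z: "0 = ?f m i" if "m \<in> topspace (max_spec_topology H)" for m
      using f(1)[of m] that by (simp add: topspace_max_spec_topology base_def solution_cone_def)
    have "continuous_map (max_spec_topology H) euclideanreal (\<lambda>_. 0)" by simp
    then show ?thesis by (rule continuous_map_eq) (rule z)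
  next
    case i: True
    have "openin (max_spec_topology H) {m \<in> topspace (max_spec_topology H). a < ?f m i}" for a
    proof (subst openin_subopen, intro ballI)
      fix m assume "m \<in> {m \<in> topspace (max_spec_topology H). a < ?f m i}"
      then have m: "m \<in> max_spec H" "a < ?f m i" by (auto simp: topspace_max_spec_topology)
      show "\<exists>T. openin (max_spec_topology H) T \<and> m \<in> T \<and> T \<subseteq> {m \<in> topspace (max_spec_topology H). a < ?f m i}"
      proof (cases "0 \<le> a")
        case True
        obtain p q :: nat where pq: "0 < q" "a < real p / real q" "real p / real q < ?f m i"
          by (rule nonneg_rational_between[OF True m(2)])
        let ?T = "{I \<in> max_spec H. rep (above i p q) \<notin> I}"
        have iff: "rep (above i p q) \<notin> I \<longleftrightarrow> real p / real q < ?f I i" if "I \<in> max_spec H" for I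
          using above_iff[OF f(1)[OF that] i pq(1), of p] f(2)[OF that] by simp
        have "openin (max_spec_topology H) ?T"
          by (rule openin_max_spec_basic[OF rep_closed[OF above_below_vars(1)[OF i]]])
        moreover have "m \<in> ?T" using iff[OF m(1)] m(1) pq(3) by simp
        moreover have "?T \<subseteq> {m \<in> topspace (max_spec_topology H). a < ?f m i}"
          using iff pq(2) by (auto simp: topspace_max_spec_topology)
        ultimately show ?thesis by blast
      next
        case False
        have "a < ?f I i" if "I \<in> max_spec H" for I using nn[OF that, of i] False by simp
        then have "{m \<in> topspace (max_spec_topology H). a < ?f m i} = topspace (max_spec_topology H)"
          by (auto simp: topspace_max_spec_topology)
        moreover have "m \<in> topspace (max_spec_topology H)"
          using m(1) by (simp add: topspace_max_spec_topology)
        ultimately show ?thesis using openin_topspace[of "max_spec_topology H"] by auto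
      qed
    qed
    moreover have "openin (max_spec_topology H) {m \<in> topspace (max_spec_topology H). ?f m i < a}" for a
    proof (subst openin_subopen, intro ballI)
      fix m assume "m \<in> {m \<in> topspace (max_spec_topology H). ?f m i < a}"
      then have m: "m \<in> max_spec H" "?f m i < a" by (auto simp: topspace_max_spec_topology)
      obtain p q :: nat where pq: "0 < q" "?f m i < real p / real q" "real p / real q < a"
        by (rule nonneg_rational_between[OF nn[OF m(1)] m(2)])
      let ?T = "{I \<in> max_spec H. rep (below i p q) \<notin> I}"
      have iff: "rep (below i p q) \<notin> I \<longleftrightarrow> ?f I i < real p / real q" if "I \<in> max_spec H" for I
        using below_iff[OF f(1)[OF that] i pq(1), of p] f(2)[OF that] by simp
      have "openin (max_spec_topology H) ?T"
        by (rule openin_max_spec_basic[OF rep_closed[OF above_below_vars(2)[OF i]]])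
      moreover have "m \<in> ?T" using iff[OF m(1)] m(1) pq(2) by simp
      moreover have "?T \<subseteq> {m \<in> topspace (max_spec_topology H). ?f m i < a}"
        using iff pq(3) by (auto simp: topspace_max_spec_topology)
      ultimately show "\<exists>T. openin (max_spec_topology H) T \<and> m \<in> T \<and>
          T \<subseteq> {m \<in> topspace (max_spec_topology H). ?f m i < a}" by blast
    qed
    ultimately show ?thesis
      by (simp add: continuous_map_upper_lower_semicontinuous_lt)
  qed
  then have "continuous_map (max_spec_topology H) (product_topology (\<lambda>_::nat. euclideanreal) UNIV) ?f"
    by (simp add: continuous_map_componentwise_UNIV)
  then have "continuous_map (max_spec_topology H) euclidean ?f"
    by (simp add: euclidean_product_topology)
  moreover have "?f \<in> topspace (max_spec_topology H) \<rightarrow> base"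
    using f(1) by (simp add: topspace_max_spec_topology)
  ultimately show ?thesis by (simp add: continuous_map_in_subtopology image_subset_iff_funcset)
qed

theorem base_homeomorphic_max_spec: "top_of_set base homeomorphic_space max_spec_topology H"
proof -
  have img: "zero_ideal ` base = max_spec H"
    using zero_ideal_in_max_spec max_spec_elim by auto
  have "homeomorphic_maps (top_of_set base) (max_spec_topology H) zero_ideal (inv_into base zero_ideal)"
    unfolding homeomorphic_maps_def
    using continuous_map_zero_ideal continuous_map_inv_zero_ideal inj_on_zero_ideal
    by (simp add: topspace_max_spec_topology inv_into_f_f f_inv_into_f img)
  then show ?thesis unfolding homeomorphic_space_def by blast
qed

end

section \<open>Dimension of the base\<close>

lemma section_on_sum:
  assumes "section_on n J s" "j \<in> J"
  shows "(\<Sum>i\<in>J. s j i * z i) = z j"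
proof -
  have "finite J" using assms(1) finite_subset unfolding section_on_def by blast
  have "(\<Sum>i\<in>J. s j i * z i) = (\<Sum>i\<in>J. if j = i then z i else 0)"
    using assms by (intro sum.cong) (auto simp: section_on_def)
  then show ?thesis using \<open>finite J\<close> assms(2) by simp
qed

lemma rank_le_0_unique:
  assumes "rank_le 0 A" "x \<in> A" "y \<in> A"
  shows "x = y"
proof -
  obtain J c s where "finite J" "card J \<le> 0"
    and x: "\<forall>x\<in>A. \<forall>i. x i = c i + (\<Sum>j\<in>J. s i j * x j)"
    using assms(1) unfolding rank_le_def by (elim exE conjE)
  then have "J = {}" by simp
  have z: "z i = c i" if "z \<in> A" for z i
    using x that unfolding \<open>J = {}\<close> by simp
  have "x i = y i" for i unfolding z[OF assms(2)] z[OF assms(3)] by (rule refl)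
  then show ?thesis by (rule ext)
qed

text \<open>A nonempty slice shows that the coordinate sum, written in the parameters of the cell,
  is not the zero form. The hyperplane then costs one parameter.\<close>

lemma rank_le_cell_slice:
  assumes "is_cell n m' D" "m' \<le> m" "D \<inter> {x. (\<Sum>i<n. x i) = 1} \<noteq> {}"
  shows "1 \<le> m" "rank_le (m - 1) (D \<inter> {x. (\<Sum>i<n. x i) = 1})"
proof -
  obtain J s B where D: "section_on n J s" "card J = m'" "D = cell_of J s B"
    using assms(1) unfolding is_cell_def by (elim exE conjE)
  have finJ: "finite J" using D(1) finite_subset unfolding section_on_def by blast
  define b where "b j = (\<Sum>i<n. s i j)" for j
  have b: "(\<Sum>j\<in>J. b j * x j) = 1" if "x \<in> D \<inter> {x. (\<Sum>i<n. x i) = 1}" for x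
  proof -
    have x: "x i = (\<Sum>j\<in>J. s i j * x j)" for i using that unfolding D(3) by (intro cell_ofD) blast
    have "(\<Sum>j\<in>J. b j * x j) = (\<Sum>j\<in>J. \<Sum>i<n. s i j * x j)"
      by (simp add: b_def sum_distrib_right)
    also have "\<dots> = (\<Sum>i<n. \<Sum>j\<in>J. s i j * x j)" by (rule sum.swap)
    also have "\<dots> = (\<Sum>i<n. x i)" by (intro sum.cong refl x[symmetric])
    finally show ?thesis using that by simp
  qed
  have "\<exists>j0\<in>J. b j0 \<noteq> 0"
  proof (rule ccontr)
    assume "\<not> ?thesis"
    then have "(\<Sum>j\<in>J. b j * x j) = 0" for x by (intro sum.neutral) auto
    then show False using b assms(3) by auto
  qed
  then obtain j0 where j0: "j0 \<in> J" "b j0 \<noteq> 0" by (rule bexE)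
  have x: "x i = (\<lambda>_. 0) i + (\<Sum>j\<in>J. s i j * x j)" if "x \<in> D \<inter> {x. (\<Sum>i<n. x i) = 1}" for x i
    using that cell_ofD[of x J s B i] unfolding D(3) by simp
  have card: "card J \<le> m" using D(2) assms(2) by simp
  show "1 \<le> m" by (rule rank_le_affine_slice(1)[where c = "\<lambda>_. 0" and s = s and b = b and r = 1, OF finJ card x b j0])
  show "rank_le (m - 1) (D \<inter> {x. (\<Sum>i<n. x i) = 1})"
    by (rule rank_le_affine_slice(2)[where c = "\<lambda>_. 0" and s = s and b = b and r = 1, OF finJ card x b j0])
qed

context presented_hoop
begin

lemma cone_zero: "(\<lambda>_. 0) \<in> solution_cone n R"
proof -
  have "(\<lambda>_. 0) = point (\<lambda>_. 0)" by (auto simp: point_def)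
  moreover have "(\<lambda>_. 0) \<in> hoop_hom H nonneg_real_hoop" by (simp add: hoop_hom_real_iff)
  ultimately show ?thesis using point_in_cone by metis
qed

text \<open>Empty cells are excluded because they could carry any number of parameters; this way
  \<open>m\<close>, the largest number of parameters, is the dimension of the cone.\<close>

definition cone_cells :: "nat \<Rightarrow> (nat \<Rightarrow> real) set set \<Rightarrow> bool" where
  "cone_cells m F \<longleftrightarrow> finite F \<and> solution_cone n R = \<Union>F \<and>
     (\<forall>D\<in>F. D \<noteq> {} \<and> (\<exists>m'\<le>m. is_cell n m' D)) \<and> (\<exists>D\<in>F. is_cell n m D)"

lemma cone_cells_exists: "\<exists>m F. cone_cells m F"
proof -
  have "\<exists>F. finite F \<and> (\<forall>D\<in>F. cell n D) \<and> solution_cone n R = \<Union>F"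
    using finite_R R_vars by (rule solution_cone_cells)
  then obtain F where F: "finite F" "\<forall>D\<in>F. cell n D" "solution_cone n R = \<Union>F"
    by (elim exE conjE)
  define G where "G = F - {{}}"
  have "\<forall>D\<in>G. \<exists>m. is_cell n m D" using F(2) by (auto simp: G_def cell_def)
  from bchoice[OF this] obtain d where d: "\<forall>D\<in>G. is_cell n (d D) D" by (rule exE)
  have fin: "finite (d ` G)" using F(1) by (simp add: G_def)
  have G: "solution_cone n R = \<Union>G" unfolding F(3) G_def by blast
  then have "G \<noteq> {}" using cone_zero by auto
  then have "Max (d ` G) \<in> d ` G" using fin by (intro Max_in) auto
  then obtain D0 where "D0 \<in> G" "Max (d ` G) = d D0" by (rule imageE) simp
  then have "\<exists>D\<in>G. is_cell n (Max (d ` G)) D" using d by auto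
  moreover have "D \<noteq> {} \<and> (\<exists>m'\<le>Max (d ` G). is_cell n m' D)" if "D \<in> G" for D
  proof -
    have "d D \<le> Max (d ` G)" using that fin by (intro Max_ge) auto
    then show ?thesis using that d by (auto simp: G_def)
  qed
  moreover have "finite G" using F(1) by (simp add: G_def)
  ultimately have "cone_cells (Max (d ` G)) G" unfolding cone_cells_def using G by simp
  then show ?thesis by blast
qed

text \<open>The clause \<open>1 \<le> m\<close> is also used backwards: a nonempty base needs a
  slice, so it forces \<open>m\<close> to be positive.\<close>

lemma base_slices:
  assumes F: "cone_cells m F"
  shows "\<exists>G. finite G \<and> base \<subseteq> \<Union>G \<and> (\<forall>A\<in>G. 1 \<le> m \<and> rank_le (m - 1) A)"
proof -
  define G where "G = (\<lambda>D. D \<inter> {x. (\<Sum>i<n. x i) = 1}) ` F - {{}}"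
  have fin: "finite G" using F by (simp add: G_def cone_cells_def)
  have cov: "base \<subseteq> \<Union>G"
  proof
    fix x assume x: "x \<in> base"
    then have "x \<in> \<Union>F" using F by (simp add: base_def cone_cells_def)
    then obtain D where D: "D \<in> F" "x \<in> D" by (rule UnionE)
    then have "x \<in> D \<inter> {x. (\<Sum>i<n. x i) = 1}" using x by (simp add: base_def)
    moreover from this have "D \<inter> {x. (\<Sum>i<n. x i) = 1} \<in> G" using D(1) unfolding G_def by blast
    ultimately show "x \<in> \<Union>G" by (rule UnionI[rotated])
  qed
  have "1 \<le> m \<and> rank_le (m - 1) A" if A: "A \<in> G" for A
  proof -
    obtain D where D: "D \<in> F" "A = D \<inter> {x. (\<Sum>i<n. x i) = 1}" "A \<noteq> {}"
      using A unfolding G_def by blast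
    obtain m' where "m' \<le> m" "is_cell n m' D" using F D(1) unfolding cone_cells_def by blast
    then show ?thesis using rank_le_cell_slice[of n m' D m] D(2,3) by simp
  qed
  with fin cov show ?thesis by (intro exI[of _ G]) simp
qed

lemma base_dim_le:
  assumes "cone_cells m F" "1 \<le> m"
  shows "top_of_set base dim_le int m - 1"
proof -
  obtain G where G: "finite G" "base \<subseteq> \<Union>G" "\<forall>A\<in>G. 1 \<le> m \<and> rank_le (m - 1) A"
    using base_slices[OF assms(1)] by (elim exE conjE)
  have "top_of_set base dim_le int (m - 1)"
    using G by (intro dim_le_finite_Union_rank_le[of G]) auto
  then show ?thesis using assms(2) by (simp add: of_nat_diff)
qed

lemma finite_base:
  assumes "cone_cells 1 F"
  shows "finite base"
proof -
  obtain G where G: "finite G" "base \<subseteq> \<Union>G" "\<forall>A\<in>G. 1 \<le> (1::nat) \<and> rank_le (1 - 1) A"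
    using base_slices[OF assms] by (elim exE conjE)
  have "finite A" if "A \<in> G" for A
  proof (cases "A = {}")
    case False
    then obtain x where "x \<in> A" by auto
    then have "A \<subseteq> {x}" using rank_le_0_unique[of A] G(3) that by auto
    then show ?thesis by (rule finite_subset) simp
  qed simp
  then show ?thesis using G(1,2) finite_subset by blast
qed

text \<open>With \<open>T = 1\<close>, displacing \<open>w\<close> by the points of a simplex stays
  inside a top cell; dividing by the coordinate sum projects the simplex radially to the
  base.\<close>

lemma fsimplex_embeds_base:
  assumes F: "cone_cells m F" and m: "1 \<le> m"
  obtains g where "continuous_on (fsimplex m) g" "inj_on g (fsimplex m)" "g ` fsimplex m \<subseteq> base"
proof -
  obtain D where D: "D \<in> F" "is_cell n m D" using F unfolding cone_cells_def by blast
  have DC: "D \<subseteq> solution_cone n R" and Dne: "D \<noteq> {}" using F D(1) unfolding cone_cells_def by blast+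
  have nonneg: "\<forall>x\<in>D. \<forall>i. 0 \<le> x i" using DC cone_nonneg by blast
  obtain J s and w :: "nat \<Rightarrow> nat" where J: "section_on n J s" "card J = m"
    and inD0: "\<forall>T a. 0 < T \<longrightarrow> (\<forall>j\<in>J. 0 \<le> a j \<and> a j \<le> T) \<longrightarrow>
       (\<lambda>i. \<Sum>j\<in>J. s i j * (T * real (w j) + a j)) \<in> D"
    using is_cell_inner[OF D(2) Dne nonneg] by (elim exE conjE)
  have finJ: "finite J" using J(1) finite_subset unfolding section_on_def by blast
  obtain h where h: "bij_betw h J {..<m}" using finJ J(2) by (metis atLeast0LessThan ex_bij_betw_finite_nat)
  define X where "X a = (\<lambda>i. \<Sum>j\<in>J. s i j * (real (w j) + a (h j)))" for a :: "nat \<Rightarrow> real"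
  define S where "S a = (\<Sum>i<n. X a i)" for a
  define g where "g a = (\<lambda>i. 1 / S a * X a i)" for a
  have sum_a: "(\<Sum>j\<in>J. a (h j)) = 1" if "a \<in> fsimplex m" for a
    using sum.reindex_bij_betw[OF h, of a] that by (simp add: fsimplex_def)
  have hm: "h j < m" if "j \<in> J" for j using h that by (auto simp: bij_betw_def)
  have X: "X a \<in> solution_cone n R" if a: "a \<in> fsimplex m" for a
  proof -
    have "0 \<le> a (h j) \<and> a (h j) \<le> 1" if "j \<in> J" for j
      using a fsimplex_subset_fcube[of m] hm[OF that] by (auto simp: fcube_def)
    then have "(\<lambda>i. \<Sum>j\<in>J. s i j * (1 * real (w j) + a (h j))) \<in> D"
      using inD0[THEN spec[of _ 1], THEN spec[of _ "\<lambda>j. a (h j)"]] by simp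
    then show ?thesis using DC by (auto simp: X_def)
  qed
  have Xj: "X a j = real (w j) + a (h j)" if "j \<in> J" for a j
    unfolding X_def using J(1) that by (rule section_on_sum)
  have X_nz: "\<exists>i. X a i \<noteq> 0" if a: "a \<in> fsimplex m" for a
  proof (rule ccontr)
    assume "\<not> ?thesis"
    then have "(\<Sum>j\<in>J. real (w j) + a (h j)) = 0" using Xj[of _ a] by (intro sum.neutral) auto
    moreover have "0 \<le> (\<Sum>j\<in>J. real (w j))" by (simp add: sum_nonneg)
    ultimately show False using sum_a[OF a] by (simp add: sum.distrib)
  qed
  have S_pos: "0 < S a" if a: "a \<in> fsimplex m" for a
  proof -
    obtain i where "X a i \<noteq> 0" using X_nz[OF a] by blast
    then show ?thesis unfolding S_def by (rule normalized_in_base(1)[OF X[OF a]])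
  qed
  have "g a \<in> base" if a: "a \<in> fsimplex m" for a
  proof -
    obtain i where "X a i \<noteq> 0" using X_nz[OF a] by blast
    then show ?thesis unfolding g_def S_def by (rule normalized_in_base(2)[OF X[OF a]])
  qed
  then have "g ` fsimplex m \<subseteq> base" by blast
  moreover have "continuous_on (fsimplex m) g"
  proof (rule continuous_on_coordinatewise_then_product)
    fix i
    have cX: "continuous_on (fsimplex m) (\<lambda>a. X a i)" for i
      unfolding X_def by (intro continuous_intros)
    then have "continuous_on (fsimplex m) S" unfolding S_def by (intro continuous_intros)
    then show "continuous_on (fsimplex m) (\<lambda>a. g a i)"
      unfolding g_def using cX S_pos by (intro continuous_intros) (auto dest: S_pos)
  qed
  moreover have "inj_on g (fsimplex m)"
  proof (rule inj_onI)
    fix a a' assume a: "a \<in> fsimplex m" "a' \<in> fsimplex m" "g a = g a'"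
    have eq: "1 / S a * (real (w j) + a (h j)) = 1 / S a' * (real (w j) + a' (h j))" if "j \<in> J" for j
      using fun_cong[OF a(3), of j] Xj[OF that] by (simp add: g_def)
    then have "(\<Sum>j\<in>J. 1 / S a * (real (w j) + a (h j))) = (\<Sum>j\<in>J. 1 / S a' * (real (w j) + a' (h j)))"
      by (rule sum.cong[OF refl])
    then have "1 / S a * (\<Sum>j\<in>J. real (w j) + a (h j)) = 1 / S a' * (\<Sum>j\<in>J. real (w j) + a' (h j))"
      by (simp only: sum_distrib_left)
    \<comment> \<open>All displaced points have the same sum over \<open>J\<close>, that of
      \<open>w\<close> plus 1, because coordinates in a simplex add up to 1. Hence equal projections
      have equal scaling factors.\<close>
    then have "1 / S a * ((\<Sum>j\<in>J. real (w j)) + 1) = 1 / S a' * ((\<Sum>j\<in>J. real (w j)) + 1)"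
      using sum_a[OF a(1)] sum_a[OF a(2)] by (simp add: sum.distrib)
    moreover have "0 \<le> (\<Sum>j\<in>J. real (w j))" by (simp add: sum_nonneg)
    ultimately have SS: "S a = S a'" by simp
    have aj: "a (h j) = a' (h j)" if "j \<in> J" for j
      using eq[OF that] S_pos[OF a(2)] unfolding SS by simp
    show "a = a'"
    proof
      fix i
      show "a i = a' i"
      proof (cases "i < m")
        case True
        then have "i \<in> h ` J" using h by (simp add: bij_betw_def)
        then show ?thesis using aj by auto
      next
        case False
        then show ?thesis using a(1,2) by (simp add: fsimplex_def)
      qed
    qed
  qed
  ultimately show ?thesis by (intro that[of g])
qed

lemma not_base_dim_le:
  assumes F: "cone_cells m F" and m: "1 \<le> m"
  shows "\<not> top_of_set base dim_le int m - 2"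
proof
  assume dim: "top_of_set base dim_le int m - 2"
  obtain g where g: "continuous_on (fsimplex m) g" "inj_on g (fsimplex m)" "g ` fsimplex m \<subseteq> base"
    by (rule fsimplex_embeds_base[OF F m])
  obtain g' where "homeomorphism (fsimplex m) (g ` fsimplex m) g g'"
    using homeomorphism_compact[OF compact_fsimplex g(1) refl g(2)] by blast
  then have "homeomorphic_maps (top_of_set (fsimplex m)) (top_of_set (g ` fsimplex m)) g g'"
    unfolding homeomorphic_maps_def homeomorphism_def by (auto simp: continuous_map_in_subtopology)
  then have "top_of_set (fsimplex m) homeomorphic_space top_of_set (g ` fsimplex m)"
    unfolding homeomorphic_space_def by blast
  moreover have "top_of_set (g ` fsimplex m) dim_le int m - 2"
    using dimension_le_subtopologies[OF dim g(3)] .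
  ultimately have "top_of_set (fsimplex m) dim_le int m - 2"
    using homeomorphic_space_dimension_le by blast
  moreover obtain k where "m = Suc k" using m by (cases m) auto
  ultimately show False using not_dim_le_fsimplex[of k] by simp
qed

lemma base_has_dimension_iff:
  assumes "cone_cells m F" "1 \<le> m"
  shows "has_dimension (max_spec_topology H) d \<longleftrightarrow> d = int m - 1"
proof -
  have hs: "max_spec_topology H dim_le d \<longleftrightarrow> top_of_set base dim_le d" for d
    using homeomorphic_space_dimension_le base_homeomorphic_max_spec homeomorphic_space_sym by blast
  have iff: "top_of_set base dim_le d \<longleftrightarrow> int m - 1 \<le> d" for d
  proof
    show "top_of_set base dim_le d" if "int m - 1 \<le> d"
      using dimension_le_mono[OF base_dim_le[OF assms] that] .
    show "int m - 1 \<le> d" if d: "top_of_set base dim_le d"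
    proof (rule ccontr)
      assume "\<not> int m - 1 \<le> d"
      then have "d \<le> int m - 2" by simp
      then show False using dimension_le_mono[OF d] not_base_dim_le[OF assms] by blast
    qed
  qed
  show ?thesis unfolding has_dimension_def hs iff by auto
qed

text \<open>A finite set is a finite union of sets of rank 0, so its dimension is at most 0, which
  rules out \<open>m \<ge> 2\<close>.\<close>

lemma finite_base_iff:
  assumes F: "cone_cells m F" and m: "1 \<le> m"
  shows "finite base \<longleftrightarrow> m = 1"
proof
  assume "finite base"
  have "rank_le 0 {x}" for x :: "nat \<Rightarrow> real"
    unfolding rank_le_def by (intro exI[of _ "{}"] exI[of _ x]) simp
  then have "top_of_set base dim_le int 0"
    using \<open>finite base\<close> by (intro dim_le_finite_Union_rank_le[of "(\<lambda>x. {x}) ` base"]) auto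
  then have "\<not> 0 \<le> int m - 2"
    using dimension_le_mono[of "top_of_set base" "int 0" "int m - 2"] not_base_dim_le[OF F m] by auto
  then show "m = 1" using m by simp
qed (use F finite_base in simp)

end

section \<open>Counting discrete states\<close>

lemma has_denominator_unique:
  assumes "has_denominator H e b" "has_denominator H e b'"
  shows "b = b'"
proof -
  have dvd: "b' dvd b" if "has_denominator H e b" "has_denominator H e b'" for b b'
  proof -
    have b: "1 \<le> b" "1 \<le> b'" and eq: "range (\<lambda>k::nat. real k / real b) = range (\<lambda>k::nat. real k / real b')"
      using that by (auto simp: has_denominator_def)
    have "1 / real b' \<in> range (\<lambda>k::nat. real k / real b)"
      unfolding eq by (rule range_eqI[of _ _ 1]) simp
    then obtain k :: nat where k: "1 / real b' = real k / real b" by auto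
    then have "real b = real k * real b'" using b by (simp add: field_simps)
    then have "b = k * b'" by (metis of_nat_eq_iff of_nat_mult)
    then show ?thesis by simp
  qed
  show ?thesis using dvd[OF assms] dvd[OF assms(2,1)] by (rule dvd_antisym[rotated])
qed

lemma denominator_eq: "has_denominator H e b \<Longrightarrow> denominator H e = b"
  unfolding denominator_def by (rule the_equality) (auto intro: has_denominator_unique)

lemma discrete_states_upto_iff:
  "e \<in> discrete_states_upto H u t \<longleftrightarrow>
     e \<in> extremal_states H u \<and> has_denominator H e (denominator H e) \<and> real (denominator H e) \<le> t"
proof -
  have "(\<exists>b. has_denominator H e b) \<longleftrightarrow> has_denominator H e (denominator H e)"
  proof
    assume "\<exists>b. has_denominator H e b"
    then obtain b where b: "has_denominator H e b" by (rule exE)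
    then show "has_denominator H e (denominator H e)" unfolding denominator_eq[OF b] .
  qed (rule exI)
  then show ?thesis by (simp add: discrete_states_upto_def discrete_state_def)
qed

context presented_hoop
begin

definition state :: "(nat \<Rightarrow> real) \<Rightarrow> 'a \<Rightarrow> real" where
  "state x = restrict (hval x) (carrier H)"

lemma state_apply: "h \<in> carrier H \<Longrightarrow> state x h = hval x h"
  by (simp add: state_def)

lemma extremal_statesD:
  assumes "e \<in> extremal_states H u"
  shows "e \<in> hoop_hom H nonneg_real_hoop" "e u = 1" "point e \<in> solution_cone n R" "e = state (point e)"
proof -
  show e: "e \<in> hoop_hom H nonneg_real_hoop" "e u = 1"
    using assms by (simp_all add: extremal_states_def)
  show "point e \<in> solution_cone n R" using e(1) by (rule point_in_cone)
  have "e \<in> extensional (carrier H)" using assms by (simp add: extremal_states_def)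
  then show "e = state (point e)"
    using hom_eq_hval[OF e(1)] by (intro extensionalityI[of _ "carrier H"]) (auto simp: state_def)
qed

lemma state_in_extremal:
  assumes "x \<in> solution_cone n R" "u \<in> carrier H" "hval x u = 1"
  shows "state x \<in> extremal_states H u"
  using assms hval_hom[OF assms(1)]
  by (simp add: extremal_states_def state_def hoop_hom_real_iff monus_closed)

lemma point_state:
  assumes x: "x \<in> solution_cone n R"
  shows "point (state x) = x"
proof -
  have "rep (HVar i) \<in> carrier H" if "i < n" for i using rep_closed[of "HVar i"] that by simp
  then have "point (state x) = point (hval x)" by (auto simp: point_def state_def)
  then show ?thesis using point_hval[OF x] by simp
qed

lemma unit_closed: "hoop_unit H u \<Longrightarrow> u \<in> carrier H"
  by (simp add: hoop_unit_def)

lemma normalized_state: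
  assumes u: "hoop_unit H u" and x: "x \<in> solution_cone n R" "x i \<noteq> 0"
  shows "(\<lambda>i. 1 / hval x u * x i) \<in> solution_cone n R"
    "state (\<lambda>i. 1 / hval x u * x i) \<in> extremal_states H u"
proof -
  have pos: "0 < hval x u" using unit_pos[OF u x] .
  show c: "(\<lambda>i. 1 / hval x u * x i) \<in> solution_cone n R"
    using pos by (intro solution_cone_scale x(1)) auto
  show "state (\<lambda>i. 1 / hval x u * x i) \<in> extremal_states H u"
  proof (rule state_in_extremal[OF c unit_closed[OF u]])
    have "hval (\<lambda>i. 1 / hval x u * x i) u = 1 / hval x u * hval x u"
      using pos by (intro hval_scale x(1) unit_closed[OF u]) auto
    then show "hval (\<lambda>i. 1 / hval x u * x i) u = 1" using pos by simp
  qed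
qed

lemma cone_nonzero_elim:
  assumes "x \<in> solution_cone n R" "h \<in> carrier H" "hval x h \<noteq> 0"
  obtains i where "x i \<noteq> 0"
proof -
  have "\<exists>i. x i \<noteq> 0"
  proof (rule ccontr)
    assume "\<not> ?thesis"
    then have "x = (\<lambda>i. 0 * x i)" by auto
    then have "hval x h = 0 * hval x h" using hval_scale[OF assms(1), of 0 h] assms(2) by simp
    with assms(3) show False by simp
  qed
  then show ?thesis using that by blast
qed

lemma base_nonzero_elim:
  assumes "x \<in> base"
  obtains i where "x i \<noteq> 0"
proof -
  have "\<exists>i. x i \<noteq> 0"
  proof (rule ccontr)
    assume "\<not> ?thesis"
    then have "(\<Sum>i<n. x i) = 0" by (intro sum.neutral) auto
    with assms show False by (simp add: base_def)
  qed
  then show ?thesis using that by blast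
qed

lemma extremal_point_nonzero:
  assumes u: "hoop_unit H u" and e: "e \<in> extremal_states H u"
  obtains i where "point e i \<noteq> 0"
proof -
  note d = extremal_statesD[OF e]
  have "hval (point e) u \<noteq> 0" using hom_eq_hval[OF d(1) unit_closed[OF u]] d(2) by simp
  then show ?thesis by (rule cone_nonzero_elim[OF d(3) unit_closed[OF u]]) (rule that)
qed

text \<open>Extremal states and the base are two sections of the same cone, by value 1 at
  \<open>u\<close> and by coordinate sum 1; positivity of \<open>u\<close> off the origin makes the
  rescaling go both ways.\<close>

lemma finite_extremal_iff:
  assumes u: "hoop_unit H u"
  shows "finite (extremal_states H u) \<longleftrightarrow> finite base"
proof
  assume fin: "finite (extremal_states H u)"
  have "base \<subseteq> (\<lambda>e. (\<lambda>i. 1 / (\<Sum>i<n. point e i) * point e i)) ` extremal_states H u"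
  proof
    fix x assume x: "x \<in> base"
    then obtain i where i: "x i \<noteq> 0" by (rule base_nonzero_elim)
    define c where "c = 1 / hval x u"
    have c: "0 < c" using unit_pos[OF u base_in_cone[OF x] i] by (simp add: c_def)
    note s = normalized_state[OF u base_in_cone[OF x] i, folded c_def]
    have p: "point (state (\<lambda>i. c * x i)) = (\<lambda>i. c * x i)" by (rule point_state[OF s(1)])
    have "(\<Sum>i<n. c * x i) = c" using x by (simp add: base_def flip: sum_distrib_left)
    then have "x = (\<lambda>i. 1 / (\<Sum>i<n. point (state (\<lambda>i. c * x i)) i) * point (state (\<lambda>i. c * x i)) i)"
      unfolding p using c by simp
    then show "x \<in> (\<lambda>e. (\<lambda>i. 1 / (\<Sum>i<n. point e i) * point e i)) ` extremal_states H u"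
      using s(2) by (rule image_eqI)
  qed
  then show "finite base" using fin finite_surj by blast
next
  assume fin: "finite base"
  have "extremal_states H u \<subseteq> (\<lambda>x. state (\<lambda>i. 1 / hval x u * x i)) ` base"
  proof
    fix e assume e: "e \<in> extremal_states H u"
    note d = extremal_statesD[OF e]
    obtain i where i: "point e i \<noteq> 0" by (rule extremal_point_nonzero[OF u e])
    define S where "S = (\<Sum>i<n. point e i)"
    have S: "0 < S" "(\<lambda>i. 1 / S * point e i) \<in> base"
      using normalized_in_base[OF d(3) i] by (simp_all add: S_def)
    have "hval (\<lambda>i. 1 / S * point e i) u = 1 / S * hval (point e) u"
      using S(1) by (intro hval_scale d(3) unit_closed[OF u]) auto
    also have "hval (point e) u = 1" using hom_eq_hval[OF d(1) unit_closed[OF u]] d(2) by simp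
    finally have "(\<lambda>i. 1 / hval (\<lambda>i. 1 / S * point e i) u * (1 / S * point e i)) = point e"
      using S(1) by simp
    then have "e = state (\<lambda>i. 1 / hval (\<lambda>i. 1 / S * point e i) u * (1 / S * point e i))"
      using d(4) by simp
    then show "e \<in> (\<lambda>x. state (\<lambda>i. 1 / hval x u * x i)) ` base"
      using S(2) by (rule image_eqI)
  qed
  then show "finite (extremal_states H u)" using fin finite_surj by blast
qed

text \<open>A state provides a nonzero point of the cone, which excludes
  \<open>m = 0\<close>.\<close>

lemma cone_cells_pos:
  assumes u: "hoop_unit H u" and ne: "carrier H \<noteq> {\<one>}" and F: "cone_cells m F"
  shows "1 \<le> m"
proof -
  obtain e where e: "e \<in> hoop_hom H nonneg_real_hoop" "e u = 1" by (rule exists_state[OF u ne])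
  have "hval (point e) u \<noteq> 0" using hom_eq_hval[OF e(1) unit_closed[OF u]] e(2) by simp
  then obtain i where i: "point e i \<noteq> 0"
    by (rule cone_nonzero_elim[OF point_in_cone[OF e(1)] unit_closed[OF u]])
  have "base \<noteq> {}" using normalized_in_base(2)[OF point_in_cone[OF e(1)] i] by auto
  then show ?thesis using base_slices[OF F] by auto
qed

section \<open>Upper and lower bounds for the number of discrete states\<close>

lemma denominator_mult_Nats:
  assumes "has_denominator H e b" "h \<in> carrier H"
  shows "real b * e h \<in> \<nat>"
proof -
  have "e h \<in> range (\<lambda>k::nat. real k / real b)" "1 \<le> b"
    using assms unfolding has_denominator_def by auto
  then show ?thesis by auto
qed

text \<open>The elements on which the scaled homomorphisms agree form a subhoop, as a nonnegative
  factor passes through truncated subtraction. The factors will be the denominators of two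
  states.\<close>

lemma generated_hom_eq:
  assumes S: "generates H S" and f: "f \<in> hoop_hom H nonneg_real_hoop" and g: "g \<in> hoop_hom H nonneg_real_hoop"
    and c: "0 \<le> c" "0 \<le> c'" and eq: "\<And>s. s \<in> S \<Longrightarrow> c * f s = c' * g s" and h: "h \<in> carrier H"
  shows "c * f h = c' * g h"
proof -
  let ?T = "{h \<in> carrier H. c * f h = c' * g h}"
  have scale: "c * max 0 (p - q) = max 0 (c * p - c * q)" if "0 \<le> c" for c p q :: real
    using that by (simp add: max_mult_distrib_left right_diff_distrib)
  have "subhoop H ?T"
    using f g c by (auto simp: subhoop_def hoop_hom_real_iff monus_closed distrib_left scale)
  moreover have "S \<subseteq> ?T" using S eq by (auto simp: generates_def)
  ultimately have "carrier H \<subseteq> ?T" using S unfolding generates_def by blast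
  then show ?thesis using h by auto
qed

lemma extremal_bound:
  assumes u: "hoop_unit H u" and S: "finite S" "S \<subseteq> carrier H"
  shows "\<exists>K::nat. \<forall>e\<in>extremal_states H u. \<forall>h\<in>S. e h \<le> real K"
proof -
  have "\<forall>h\<in>S. \<exists>k::nat. \<forall>x\<in>solution_cone n R. hval x h \<le> real k * hval x u"
  proof
    fix h assume "h \<in> S"
    then obtain k :: nat where "\<And>x. x \<in> solution_cone n R \<Longrightarrow> hval x h \<le> real k * hval x u"
      using unit_bound[OF u, of h] S(2) by blast
    then show "\<exists>k::nat. \<forall>x\<in>solution_cone n R. hval x h \<le> real k * hval x u" by blast
  qed
  from bchoice[OF this] obtain k :: "'a \<Rightarrow> nat"
    where k: "\<forall>h\<in>S. \<forall>x\<in>solution_cone n R. hval x h \<le> real (k h) * hval x u" by (rule exE)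
  have "e h \<le> real (\<Sum>h\<in>S. k h)" if e: "e \<in> extremal_states H u" and h: "h \<in> S" for e h
  proof -
    note d = extremal_statesD[OF e]
    have hH: "h \<in> carrier H" using h S(2) by blast
    have "hval (point e) h \<le> real (k h) * hval (point e) u" using k h d(3) by blast
    then have "e h \<le> real (k h) * 1"
      unfolding hom_eq_hval[OF d(1) hH, symmetric] hom_eq_hval[OF d(1) unit_closed[OF u], symmetric] d(2) .
    moreover have "k h \<le> (\<Sum>h\<in>S. k h)" using S(1) h by (intro member_le_sum) auto
    ultimately show ?thesis by (metis mult.right_neutral of_nat_le_iff order_trans)
  qed
  then show ?thesis by blast
qed

lemma discrete_state_scaled:
  assumes "e \<in> discrete_states_upto H u t"
  shows "e \<in> extremal_states H u" "1 \<le> denominator H e" "real (denominator H e) \<le> t"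
    "\<And>h. h \<in> carrier H \<Longrightarrow> real (denominator H e) * e h \<in> \<nat>"
proof -
  have e: "e \<in> extremal_states H u" "has_denominator H e (denominator H e)" "real (denominator H e) \<le> t"
    using assms by (auto simp: discrete_states_upto_iff)
  then show "e \<in> extremal_states H u" "real (denominator H e) \<le> t" by simp_all
  show "1 \<le> denominator H e" using e(2) by (simp add: has_denominator_def)
  show "\<And>h. h \<in> carrier H \<Longrightarrow> real (denominator H e) * e h \<in> \<nat>"
    using denominator_mult_Nats[OF e(2)] .
qed

text \<open>A discrete state is recovered from the integral homomorphism obtained by clearing its
  denominator, because the latter takes the denominator itself as its value at the unit.\<close>

lemma discrete_state_eqI:
  assumes e: "e \<in> extremal_states H u" "1 \<le> b" and e': "e' \<in> extremal_states H u" "1 \<le> b'"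
    and u: "u \<in> carrier H"
    and eq: "\<And>h. h \<in> carrier H \<Longrightarrow> real b * e h = real b' * e' h"
  shows "e = e'"
proof -
  have bb: "b = b'" using eq[OF u] extremal_statesD(2)[OF e(1)] extremal_statesD(2)[OF e'(1)] by simp
  have "e h = e' h" if "h \<in> carrier H" for h using eq[OF that] e(2) unfolding bb by simp
  then show ?thesis
    using e(1) e'(1) by (intro extensionalityI[of e "carrier H"]) (auto simp: extremal_states_def)
qed

text \<open>The generating set is left open: the generators of the presentation give finiteness of
  the counting sets, a smallest generating set the comparison with
  \<open>min_generators\<close>.\<close>

lemma card_discrete_le_generators:
  assumes u: "hoop_unit H u" and S: "finite S" "generates H S"
  shows "\<exists>K::nat. \<forall>t\<ge>0. finite (discrete_states_upto H u t) \<and>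
    real (card (discrete_states_upto H u t)) \<le> (real K * t + 1) ^ card S"
proof -
  have SH: "S \<subseteq> carrier H" using S(2) by (simp add: generates_def)
  obtain K :: nat where K: "\<forall>e\<in>extremal_states H u. \<forall>h\<in>S. e h \<le> real K"
    using extremal_bound[OF u S(1) SH] by (rule exE)
  have "finite (discrete_states_upto H u t) \<and>
      real (card (discrete_states_upto H u t)) \<le> (real K * t + 1) ^ card S" if t: "0 \<le> t" for t
  proof -
    let ?v = "\<lambda>e h. real (denominator H e) * e h"
    have "?v e h \<in> \<nat> \<and> ?v e h \<le> real K * t" if e: "e \<in> discrete_states_upto H u t" and h: "h \<in> S" for e h
    proof -
      note d = discrete_state_scaled[OF e]
      have "0 \<le> e h" using extremal_statesD(1)[OF d(1)] h SH by (auto simp: hoop_hom_real_iff)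
      then have "?v e h \<le> t * real K" using d(3) K d(1) h t by (intro mult_mono) auto
      then show ?thesis using d(4)[of h] h SH by (auto simp: mult.commute)
    qed
    moreover have "e = e'" if e: "e \<in> discrete_states_upto H u t" and e': "e' \<in> discrete_states_upto H u t"
      and eq: "\<And>s. s \<in> S \<Longrightarrow> ?v e s = ?v e' s" for e e'
    proof -
      note d = discrete_state_scaled[OF e] and d' = discrete_state_scaled[OF e']
      have "real (denominator H e) * e h = real (denominator H e') * e' h" if "h \<in> carrier H" for h
        by (rule generated_hom_eq[OF S(2) extremal_statesD(1)[OF d(1)] extremal_statesD(1)[OF d'(1)] _ _ eq that])
          auto
      then show ?thesis by (intro discrete_state_eqI[OF d(1,2) d'(1,2) unit_closed[OF u]])
    qed
    ultimately show ?thesis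
      using card_le_of_nat_coordinates[OF S(1), of "real K * t" "discrete_states_upto H u t" ?v] t by simp
  qed
  then show ?thesis by blast
qed

lemma generates_generators: "generates H ((\<lambda>i. rep (HVar i)) ` {..<n})"
  unfolding generates_def
proof (intro conjI equalityI)
  let ?S = "(\<lambda>i. rep (HVar i)) ` {..<n}"
  show "?S \<subseteq> carrier H" using rep_closed by auto
  then have "carrier H \<in> {T. subhoop H T \<and> ?S \<subseteq> T}" by (auto simp: subhoop_def monus_closed)
  then show "\<Inter>{T. subhoop H T \<and> ?S \<subseteq> T} \<subseteq> carrier H" by blast
  have "rep t \<in> T" if T: "subhoop H T" "?S \<subseteq> T" and t: "term_vars t \<subseteq> {..<n}" for T t
    using t
  proof (induction t)
    case (HVar i)
    then show ?case using T(2) by auto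
  next
    case HZero
    then show ?case using T(1) rep_zero by (simp add: subhoop_def)
  next
    case (HPlus s t)
    then show ?case using T(1) rep_plus[of s t] by (auto simp: subhoop_def)
  next
    case (HMonus s t)
    then show ?case using T(1) rep_monus[of s t] by (auto simp: subhoop_def)
  qed
  then show "carrier H \<subseteq> \<Inter>{T. subhoop H T \<and> ?S \<subseteq> T}"
    unfolding rep_surj[symmetric] by blast
qed

lemma min_generators_attained:
  obtains S where "finite S" "card S = min_generators H" "generates H S"
proof -
  have "\<exists>k. \<exists>S. finite S \<and> card S = k \<and> generates H S"
    using generates_generators by blast
  then have "\<exists>S. finite S \<and> card S = min_generators H \<and> generates H S"
    unfolding min_generators_def by (rule LeastI_ex)
  then show ?thesis using that by blast
qed

lemma finite_discrete_states:
  assumes u: "hoop_unit H u"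
  shows "finite (discrete_states_upto H u t)"
proof (cases "0 \<le> t")
  case True
  then show ?thesis using card_discrete_le_generators[OF u _ generates_generators] by auto
next
  case False
  then have "discrete_states_upto H u t = {}" by (auto simp: discrete_states_upto_def)
  then show ?thesis by simp
qed

text \<open>Within a cell only the parameters in \<open>J\<close> have to be counted, since
  \<open>s\<close> recovers the other coordinates; this brings the exponent down to
  \<open>m\<close>. Cells with fewer parameters are absorbed because \<open>K * t + 1\<close> is at
  least 1.\<close>

lemma card_discrete_le_cells:
  assumes u: "hoop_unit H u" and F: "cone_cells m F"
  shows "\<exists>A>0. \<forall>t\<ge>1. real (card (discrete_states_upto H u t)) \<le> A * t ^ m"
proof -
  have "\<exists>K::nat. \<forall>e\<in>extremal_states H u. \<forall>h\<in>(\<lambda>i. rep (HVar i)) ` {..<n}. e h \<le> real K"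
    by (rule extremal_bound[OF u]) (use rep_closed in auto)
  then obtain K :: nat where K: "\<forall>e\<in>extremal_states H u. \<forall>h\<in>(\<lambda>i. rep (HVar i)) ` {..<n}. e h \<le> real K"
    by (rule exE)
  have pK: "point e i \<le> real K" if "e \<in> extremal_states H u" for e i
    using K that by (auto simp: point_def)
  let ?y = "\<lambda>e i. real (denominator H e) * point e i"
  have finF: "finite F" and cov: "solution_cone n R = \<Union>F" using F by (auto simp: cone_cells_def)
  have bound: "real (card {e \<in> discrete_states_upto H u t. ?y e \<in> D}) \<le> (real K + 1) ^ m * t ^ m"
    if D: "D \<in> F" and t: "1 \<le> t" for D t
  proof -
    obtain m' where m': "m' \<le> m" "is_cell n m' D" using F D unfolding cone_cells_def by blast
    obtain J s B where J: "section_on n J s" "card J = m'" "D = cell_of J s B"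
      using m'(2) unfolding is_cell_def by (elim exE conjE)
    have finJ: "finite J" using J(1) finite_subset unfolding section_on_def by blast
    let ?A = "{e \<in> discrete_states_upto H u t. ?y e \<in> D}"
    have v: "?y e i \<in> \<nat> \<and> ?y e i \<le> real K * t" if e: "e \<in> ?A" for e i
    proof -
      have e': "e \<in> discrete_states_upto H u t" using e by simp
      note d = discrete_state_scaled[OF e']
      have "?y e i \<in> \<nat>" using d(4)[of "rep (HVar i)"] rep_closed[of "HVar i"] by (auto simp: point_def)
      moreover have "?y e i \<le> t * real K"
        using d(3) pK[OF d(1), of i] cone_nonneg[OF extremal_statesD(3)[OF d(1)], of i] t
        by (intro mult_mono) auto
      ultimately show ?thesis by (simp add: mult.commute)
    qed
    have inj: "e = e'" if e: "e \<in> ?A" and e': "e' \<in> ?A" and eq: "\<And>j. j \<in> J \<Longrightarrow> ?y e j = ?y e' j" for e e'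
    proof -
      have eD: "e \<in> discrete_states_upto H u t" "?y e \<in> cell_of J s B"
        and eD': "e' \<in> discrete_states_upto H u t" "?y e' \<in> cell_of J s B"
        using e e' unfolding J(3) by simp_all
      note d = discrete_state_scaled[OF eD(1)] and d' = discrete_state_scaled[OF eD'(1)]
      have yy: "?y e = ?y e'"
      proof
        fix i
        have "(\<Sum>j\<in>J. s i j * ?y e j) = (\<Sum>j\<in>J. s i j * ?y e' j)"
          by (intro sum.cong refl) (simp only: eq)
        then show "?y e i = ?y e' i" using cell_ofD[OF eD(2), of i] cell_ofD[OF eD'(2), of i] by argo
      qed
      have "real (denominator H e) * e h = real (denominator H e') * e' h" if h: "h \<in> carrier H" for h
        using hval_scale[OF extremal_statesD(3)[OF d(1)] _ h, of "real (denominator H e)"]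
          hval_scale[OF extremal_statesD(3)[OF d'(1)] _ h, of "real (denominator H e')"]
          hom_eq_hval[OF extremal_statesD(1)[OF d(1)] h] hom_eq_hval[OF extremal_statesD(1)[OF d'(1)] h] yy
        by simp
      then show ?thesis by (intro discrete_state_eqI[OF d(1,2) d'(1,2) unit_closed[OF u]])
    qed
    have Kt: "0 \<le> real K * t" using t by simp
    have "real (card ?A) \<le> (real K * t + 1) ^ card J"
      by (rule card_le_of_nat_coordinates(2)[OF finJ Kt v inj])
    also have "\<dots> \<le> (real K * t + 1) ^ m" using J(2) m'(1) Kt by (intro power_increasing) auto
    also have "\<dots> \<le> ((real K + 1) * t) ^ m" using t by (intro power_mono) (auto simp: algebra_simps)
    finally show ?thesis by (simp add: power_mult_distrib)
  qed
  have "real (card (discrete_states_upto H u t)) \<le> (real (card F) * (real K + 1) ^ m) * t ^ m" if t: "1 \<le> t" for t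
  proof -
    have "discrete_states_upto H u t \<subseteq> (\<Union>D\<in>F. {e \<in> discrete_states_upto H u t. ?y e \<in> D})"
    proof
      fix e assume e: "e \<in> discrete_states_upto H u t"
      have "?y e \<in> solution_cone n R"
        using extremal_statesD(3)[OF discrete_state_scaled(1)[OF e]] by (rule solution_cone_scale) simp
      then show "e \<in> (\<Union>D\<in>F. {e \<in> discrete_states_upto H u t. ?y e \<in> D})" using e unfolding cov by blast
    qed
    then have "card (discrete_states_upto H u t) \<le> card (\<Union>D\<in>F. {e \<in> discrete_states_upto H u t. ?y e \<in> D})"
      using finF finite_discrete_states[OF u] by (intro card_mono finite_UN_I) simp_all
    also have "\<dots> \<le> (\<Sum>D\<in>F. card {e \<in> discrete_states_upto H u t. ?y e \<in> D})"
      using finF by (rule card_UN_le)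
    finally have "real (card (discrete_states_upto H u t)) \<le>
        (\<Sum>D\<in>F. real (card {e \<in> discrete_states_upto H u t. ?y e \<in> D}))"
      unfolding of_nat_sum[symmetric] of_nat_le_iff .
    also have "\<dots> \<le> (\<Sum>D\<in>F. (real K + 1) ^ m * t ^ m)" using bound[OF _ t] by (rule sum_mono)
    finally show ?thesis by simp
  qed
  moreover have "F \<noteq> {}" using F by (auto simp: cone_cells_def)
  then have "0 < real (card F) * (real K + 1) ^ m" using finF by (simp add: card_gt_0_iff)
  ultimately show ?thesis by blast
qed

text \<open>An integral point gives values in multiples of \<open>1 / b\<close>, with
  \<open>b\<close> its value at \<open>u\<close>; the denominator \<open>d\<close> is smaller by the
  common factor \<open>k\<close> of the values of \<open>hval y\<close>. So \<open>k\<close>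
  measures how far the point is from being primitive.\<close>

lemma integer_point_state:
  assumes u: "hoop_unit H u" and y: "y \<in> solution_cone n R" "y i \<noteq> 0" and int: "\<And>i. y i \<in> \<nat>"
  shows "\<exists>d k. 0 < d \<and> 0 < k \<and> hval y u = real (k * d) \<and>
    has_denominator H (state (\<lambda>i. 1 / hval y u * y i)) d"
proof -
  have uH: "u \<in> carrier H" using u by (rule unit_closed)
  have yN: "hval y h \<in> \<nat>" if "h \<in> carrier H" for h
  proof -
    obtain t where t: "term_vars t \<subseteq> {..<n}" "rep t = h" using \<open>h \<in> carrier H\<close> by (rule rep_obtain)
    then show ?thesis using term_eval_Nats[OF int t(1)] hval_rep[OF y(1) t(1)] by simp
  qed
  obtain b :: nat where b: "hval y u = real b" using yN[OF uH] by (rule Nats_cases)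
  have b0: "0 < b" using unit_pos[OF u y] b by simp
  let ?e = "state (\<lambda>i. 1 / hval y u * y i)"
  have eE: "?e \<in> extremal_states H u" by (rule normalized_state(2)[OF u y])
  note d = extremal_statesD[OF eE]
  have e: "?e h = hval y h / real b" if "h \<in> carrier H" for h
    using state_apply[OF that] hval_scale[OF y(1), of "1 / hval y u" h] that b by simp
  define S where "S = ?e ` carrier H"
  have "S \<subseteq> range (\<lambda>k::nat. real k / real b)"
    unfolding S_def
  proof (rule image_subsetI)
    fix h assume h: "h \<in> carrier H"
    obtain k :: nat where "hval y h = real k" using yN[OF h] by (rule Nats_cases)
    then have "?e h = real k / real b" using e[OF h] by simp
    then show "?e h \<in> range (\<lambda>k::nat. real k / real b)" by (rule range_eqI)
  qed
  moreover have "p + q \<in> S" if pq: "p \<in> S" "q \<in> S" for p q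
  proof -
    obtain a where a: "a \<in> carrier H" "p = ?e a" using pq(1) unfolding S_def by (elim imageE)
    obtain c where c: "c \<in> carrier H" "q = ?e c" using pq(2) unfolding S_def by (elim imageE)
    have "p + q = ?e (a \<otimes> c)" using d(1) a c by (simp add: hoop_hom_real_iff)
    then show ?thesis unfolding S_def by (rule image_eqI) (use a c in simp)
  qed
  moreover have "max 0 (p - q) \<in> S" if pq: "p \<in> S" "q \<in> S" for p q
  proof -
    obtain a where a: "a \<in> carrier H" "p = ?e a" using pq(1) unfolding S_def by (elim imageE)
    obtain c where c: "c \<in> carrier H" "q = ?e c" using pq(2) unfolding S_def by (elim imageE)
    have "max 0 (p - q) = ?e (a \<setminus> c)" using d(1) a c by (simp add: hoop_hom_real_iff)
    then show ?thesis unfolding S_def by (rule image_eqI) (use a c monus_closed in simp)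
  qed
  moreover have "1 \<in> S" unfolding S_def using d(2) uH by (intro image_eqI[of _ _ u]) auto
  ultimately obtain d k :: nat where dk: "0 < d" "0 < k" "b = k * d" "S = range (\<lambda>j::nat. real j / real d)"
    using real_subhoop_discrete[OF b0, of S] by metis
  then have "has_denominator H ?e d" by (simp add: has_denominator_def S_def)
  then show ?thesis using dk b by blast
qed

text \<open>Integer points of a top cell are sent to pairs of their common factor \<open>k\<close>
  and their state. The state has denominator at most \<open>c T / k\<close>, and the pair determines
  the point, so the sum over \<open>k\<close> is at least the number \<open>T ^ m\<close> of points
  constructed.\<close>

lemma lattice_points_le:
  assumes u: "hoop_unit H u" and F: "cone_cells m F" and m: "1 \<le> m"
  shows "\<exists>c>0. \<forall>T::nat. 1 \<le> T \<longrightarrow> real T ^ m \<le>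
    (\<Sum>k\<in>{1..nat \<lfloor>c * real T\<rfloor>}. real (card (discrete_states_upto H u (c * real T / real k))))"
proof -
  have uH: "u \<in> carrier H" using u by (rule unit_closed)
  obtain D where D: "D \<in> F" "is_cell n m D" using F unfolding cone_cells_def by blast
  have DC: "D \<subseteq> solution_cone n R" and Dne: "D \<noteq> {}" using F D(1) unfolding cone_cells_def by blast+
  have nonneg: "\<forall>x\<in>D. \<forall>i. 0 \<le> x i" using DC cone_nonneg by blast
  obtain J s N and w :: "nat \<Rightarrow> nat" where J: "section_on n J s" "card J = m" and N: "0 < (N::nat)"
    and Ns: "\<forall>i. \<forall>j\<in>J. real N * s i j \<in> \<int>"
    and inD0: "\<forall>T a. 0 < T \<longrightarrow> (\<forall>j\<in>J. 0 \<le> a j \<and> a j \<le> T) \<longrightarrow>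
       (\<lambda>i. \<Sum>j\<in>J. s i j * (T * real (w j) + a j)) \<in> D"
    using is_cell_inner[OF D(2) Dne nonneg] by (elim exE conjE)
  have finJ: "finite J" using J(1) finite_subset unfolding section_on_def by blast
  obtain tu where tu: "term_vars tu \<subseteq> {..<n}" "rep tu = u" using uH by (rule rep_obtain)
  obtain B where B: "0 \<le> B" "\<forall>x. (\<forall>i<n. 0 \<le> x i) \<longrightarrow> term_eval x tu \<le> B * (\<Sum>i<n. x i)"
    using term_eval_bound[OF tu(1)] by (elim exE conjE)
  define q where "q i = real N * (\<Sum>j\<in>J. \<bar>s i j\<bar> * (real (w j) + 1))" for i
  have q0: "0 \<le> q i" for i unfolding q_def by (intro mult_nonneg_nonneg sum_nonneg) auto
  \<comment> \<open>\<open>q i * T\<close> bounds coordinate \<open>i\<close> of the points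
    \<open>y a\<close> below, where the factor \<open>N\<close> makes these points integral.
    \<open>B\<close> turns this into a bound for the value at \<open>u\<close>, and the summand 1
    makes \<open>c\<close> positive.\<close>
  define c where "c = B * (\<Sum>i<n. q i) + 1"
  have c: "0 < c" unfolding c_def using B(1) q0 by (intro add_nonneg_pos mult_nonneg_nonneg sum_nonneg) auto
  have main: "real T ^ m \<le> (\<Sum>k\<in>{1..nat \<lfloor>c * real T\<rfloor>}. real (card (discrete_states_upto H u (c * real T / real k))))"
    if T: "1 \<le> T" for T :: nat
  proof -
    \<comment> \<open>Displacements start at 1 and not at 0: there are exactly \<open>T\<close>
      choices for each parameter, and the resulting point is nonzero even where \<open>w\<close>
      vanishes.\<close>
    define P where "P = J \<rightarrow>\<^sub>E {1..T}"
    define y where "y a = (\<lambda>i. real N * (\<Sum>j\<in>J. s i j * (real T * real (w j) + real (a j))))" for a :: "nat \<Rightarrow> nat"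
    have y: "y a \<in> solution_cone n R" if a: "a \<in> P" for a
    proof -
      have "a j \<in> {1..T}" if "j \<in> J" for j using a that by (auto simp: P_def)
      then have "(\<lambda>i. \<Sum>j\<in>J. s i j * (real T * real (w j) + real (a j))) \<in> D"
        using inD0[THEN spec[of _ "real T"], THEN spec[of _ "\<lambda>j. real (a j)"]] T by auto
      then show ?thesis unfolding y_def using DC by (intro solution_cone_scale) auto
    qed
    have yj: "y a j = real N * (real T * real (w j) + real (a j))" if "j \<in> J" for a j
      unfolding y_def section_on_sum[OF J(1) that] ..
    have yN: "y a i \<in> \<nat>" if a: "a \<in> P" for a i
    proof -
      have "y a i = (\<Sum>j\<in>J. (real N * s i j) * real (T * w j + a j))"
        by (simp add: y_def sum_distrib_left mult.assoc)
      also have "\<dots> \<in> \<int>"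
      proof (rule Ints_sum)
        fix j assume "j \<in> J"
        then show "(real N * s i j) * real (T * w j + a j) \<in> \<int>"
          using Ns by (intro Ints_mult[OF _ Ints_of_nat]) blast
      qed
      finally obtain z where z: "y a i = of_int z" by (rule Ints_cases)
      then have "0 \<le> z" using cone_nonneg[OF y[OF a], of i] by simp
      then have "y a i = real (nat z)" using z by simp
      then show ?thesis by simp
    qed
    have "\<exists>j. y a j \<noteq> 0" if a: "a \<in> P" for a
    proof -
      have "J \<noteq> {}" using J(2) m by auto
      then obtain j where j: "j \<in> J" by auto
      then have "1 \<le> a j" using a by (auto simp: P_def)
      then have "0 < y a j" unfolding yj[OF j] using N by (intro mult_pos_pos add_nonneg_pos) auto
      then show ?thesis by (intro exI[of _ j]) simp
    qed
    then have ynz: "\<forall>a\<in>P. \<exists>j. y a j \<noteq> 0" by blast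
    have ybound: "hval (y a) u \<le> c * real T" if a: "a \<in> P" for a
    proof -
      have yi: "y a i \<le> q i * real T" for i
      proof -
        have "(\<Sum>j\<in>J. s i j * (real T * real (w j) + real (a j))) \<le> (\<Sum>j\<in>J. \<bar>s i j\<bar> * (real (w j) + 1) * real T)"
        proof (rule sum_mono)
          fix j assume "j \<in> J"
          then have "a j \<le> T" using a by (auto simp: P_def)
          then have "real T * real (w j) + real (a j) \<le> (real (w j) + 1) * real T" by (simp add: algebra_simps)
          then have "\<bar>s i j\<bar> * (real T * real (w j) + real (a j)) \<le> \<bar>s i j\<bar> * ((real (w j) + 1) * real T)"
            by (rule mult_left_mono) simp
          moreover have "s i j * (real T * real (w j) + real (a j)) \<le> \<bar>s i j\<bar> * (real T * real (w j) + real (a j))"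
            by (intro mult_right_mono) auto
          ultimately show "s i j * (real T * real (w j) + real (a j)) \<le> \<bar>s i j\<bar> * (real (w j) + 1) * real T"
            by (simp add: mult.assoc)
        qed
        then have "y a i \<le> real N * (\<Sum>j\<in>J. \<bar>s i j\<bar> * (real (w j) + 1) * real T)"
          unfolding y_def by (rule mult_left_mono) simp
        then show ?thesis by (simp add: q_def sum_distrib_right mult.assoc)
      qed
      have "hval (y a) u = term_eval (y a) tu" using hval_rep[OF y[OF a] tu(1)] tu(2) by simp
      also have "\<dots> \<le> B * (\<Sum>i<n. y a i)" using B(2) cone_nonneg[OF y[OF a]] by blast
      also have "\<dots> \<le> B * (\<Sum>i<n. q i * real T)" using yi B(1) by (intro mult_left_mono sum_mono) auto
      also have "\<dots> = (B * (\<Sum>i<n. q i)) * real T" by (simp add: sum_distrib_right)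
      also have "\<dots> \<le> c * real T" unfolding c_def by (intro mult_right_mono) auto
      finally show ?thesis .
    qed
    define e where "e a = state (\<lambda>i. 1 / hval (y a) u * y a i)" for a
    have "\<forall>a\<in>P. \<exists>k. 0 < k \<and> hval (y a) u = real (k * denominator H (e a)) \<and> has_denominator H (e a) (denominator H (e a))"
    proof
      fix a assume a: "a \<in> P"
      obtain i where i: "y a i \<noteq> 0" using ynz a by blast
      obtain d k where k: "0 < k" "hval (y a) u = real (k * d)" "has_denominator H (e a) d"
        using integer_point_state[OF u y[OF a] i yN[OF a]] unfolding e_def by (elim exE conjE)
      show "\<exists>k. 0 < k \<and> hval (y a) u = real (k * denominator H (e a)) \<and> has_denominator H (e a) (denominator H (e a))"
        unfolding denominator_eq[OF k(3)] using k by (intro exI[of _ k] conjI)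
    qed
    from bchoice[OF this] obtain k where
      k: "\<forall>a\<in>P. 0 < k a \<and> hval (y a) u = real (k a * denominator H (e a)) \<and> has_denominator H (e a) (denominator H (e a))"
      by (rule exE)
    let ?M = "nat \<lfloor>c * real T\<rfloor>"
    let ?Q = "SIGMA k:{1..?M}. discrete_states_upto H u (c * real T / real k)"
    have "(\<lambda>a. (k a, e a)) ` P \<subseteq> ?Q"
    proof (rule image_subsetI)
      fix a assume a: "a \<in> P"
      then have ka: "0 < k a" "hval (y a) u = real (k a) * real (denominator H (e a))"
        and hd: "has_denominator H (e a) (denominator H (e a))" using k by auto
      obtain i where i: "y a i \<noteq> 0" using ynz a by blast
      have "1 \<le> denominator H (e a)" using hd by (simp add: has_denominator_def)
      then have "real (k a) * 1 \<le> real (k a) * real (denominator H (e a))" by (intro mult_left_mono) auto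
      then have "real (k a) \<le> c * real T" using ybound[OF a] ka(2) by simp
      then have "k a \<le> ?M" by (simp add: le_nat_floor)
      moreover have "real (denominator H (e a)) \<le> c * real T / real (k a)"
        using ybound[OF a] ka by (simp add: pos_le_divide_eq mult.commute)
      moreover have "e a \<in> extremal_states H u" unfolding e_def by (rule normalized_state(2)[OF u y[OF a] i])
      ultimately show "(k a, e a) \<in> ?Q" using ka(1) hd by (simp add: discrete_states_upto_iff)
    qed
    moreover have "inj_on (\<lambda>a. (k a, e a)) P"
    proof (rule inj_onI)
      fix a a' assume a: "a \<in> P" "a' \<in> P" and eq: "(k a, e a) = (k a', e a')"
      \<comment> \<open>The value at \<open>u\<close> is the common factor times the denominator, so
        the pair determines it; multiplying by it undoes the normalisation of the state.\<close>
      have v: "hval (y a) u = hval (y a') u" using k a eq by auto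
      obtain i where i: "y a i \<noteq> 0" using ynz a(1) by blast
      obtain i' where i': "y a' i' \<noteq> 0" using ynz a(2) by blast
      have vpos: "0 < hval (y a) u" by (rule unit_pos[OF u y[OF a(1)] i])
      have "point (e a) = point (e a')" using eq by simp
      then have "(\<lambda>i. 1 / hval (y a) u * y a i) = (\<lambda>i. 1 / hval (y a') u * y a' i)"
        unfolding e_def point_state[OF normalized_state(1)[OF u y[OF a(1)] i]]
          point_state[OF normalized_state(1)[OF u y[OF a(2)] i']] .
      then have yy: "y a j = y a' j" for j using vpos v by (simp add: fun_eq_iff)
      have "a j = a' j" if "j \<in> J" for j using yy[of j] N unfolding yj[OF that] by simp
      then show "a = a'" by (rule PiE_ext[OF a[unfolded P_def]])
    qed
    moreover have "finite ?Q" using finite_discrete_states[OF u] by (intro finite_SigmaI) auto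
    ultimately have "card P \<le> card ?Q" by (intro card_inj_on_le)
    moreover have "card P = T ^ m" using finJ J(2) by (simp add: P_def card_PiE)
    moreover have "card ?Q = (\<Sum>k\<in>{1..?M}. card (discrete_states_upto H u (c * real T / real k)))"
      using finite_discrete_states[OF u] by (intro card_SigmaI) auto
    ultimately have "T ^ m \<le> (\<Sum>k\<in>{1..?M}. card (discrete_states_upto H u (c * real T / real k)))" by simp
    then show ?thesis by (metis of_nat_le_iff of_nat_power of_nat_sum)
  qed
  with c show ?thesis by blast
qed

section \<open>Asymptotics of the counting function\<close>

lemma discrete_states_mono: "s \<le> t \<Longrightarrow> discrete_states_upto H u s \<subseteq> discrete_states_upto H u t"
  by (auto simp: discrete_states_upto_def)

text \<open>Guards the logarithm: for an empty set it would be taken at 0, where it has only a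
  conventional value. A single lattice point, from \<open>T = 1\<close>, and monotonicity in
  \<open>t\<close> suffice.\<close>

lemma eventually_discrete_states:
  assumes u: "hoop_unit H u" and F: "cone_cells m F" and m: "1 \<le> m"
  shows "\<forall>\<^sub>F t in at_top. discrete_states_upto H u t \<noteq> {}"
proof -
  obtain c where c: "0 < c" "\<forall>T::nat. 1 \<le> T \<longrightarrow> real T ^ m \<le>
    (\<Sum>k\<in>{1..nat \<lfloor>c * real T\<rfloor>}. real (card (discrete_states_upto H u (c * real T / real k))))"
    using lattice_points_le[OF assms] by (elim exE conjE)
  have "real 1 ^ m \<le> (\<Sum>k\<in>{1..nat \<lfloor>c * real 1\<rfloor>}. real (card (discrete_states_upto H u (c * real 1 / real k))))"
    using c(2) by blast
  moreover have "\<exists>k. discrete_states_upto H u (c * real 1 / real k) \<noteq> {}"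
  proof (rule ccontr)
    assume "\<not> ?thesis"
    then have "(\<Sum>k\<in>{1..nat \<lfloor>c * real 1\<rfloor>}. real (card (discrete_states_upto H u (c * real 1 / real k)))) = 0"
      by (intro sum.neutral) simp
    with calculation show False by simp
  qed
  then obtain t0 where "discrete_states_upto H u t0 \<noteq> {}" by blast
  then show ?thesis
    using discrete_states_mono unfolding eventually_at_top_linorder by (metis subset_empty)
qed

text \<open>The second claim follows from the first: counting in the coordinates of a smallest
  generating set bounds the same quotient by one that tends to \<open>min_generators H\<close>, and
  limits preserve the inequality.\<close>

lemma tendsto_growth:
  assumes u: "hoop_unit H u" and F: "cone_cells m F" and m: "2 \<le> m"
  shows "((\<lambda>t::real. ln (real (card (discrete_states_upto H u t))) / ln t) \<longlongrightarrow> real m) at_top"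
    and "m \<le> min_generators H"
proof -
  let ?N = "\<lambda>t. real (card (discrete_states_upto H u t))"
  obtain A where A: "0 < A" "\<forall>t\<ge>1. ?N t \<le> A * t ^ m" using card_discrete_le_cells[OF u F] by (elim exE conjE)
  obtain c where c: "0 < c" "\<forall>T::nat. 1 \<le> T \<longrightarrow> real T ^ m \<le>
    (\<Sum>k\<in>{1..nat \<lfloor>c * real T\<rfloor>}. ?N (c * real T / real k))"
    using lattice_points_le[OF u F] m by auto
  have mono: "?N s \<le> ?N t" if "s \<le> t" for s t
    using card_mono[OF finite_discrete_states[OF u] discrete_states_mono[OF that]] by simp
  have "\<exists>c'>0. \<forall>t\<ge>c. c' * t ^ m \<le> ?N t"
    using growth_of_primitive_count[OF m A(1) c(1), of ?N] mono A(2) c(2) by (metis of_nat_0_le_iff)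
  then obtain c' where c': "0 < c'" "\<forall>t\<ge>c. c' * t ^ m \<le> ?N t" by (elim exE conjE)
  have ev_low: "\<forall>\<^sub>F t in at_top. c' * t ^ m \<le> ?N t" 
    by (rule eventually_mono[OF eventually_ge_at_top[of c]]) (use c'(2) in simp)
  have ev_up: "\<forall>\<^sub>F t in at_top. ?N t \<le> A * t ^ m" 
    by (rule eventually_mono[OF eventually_ge_at_top[of 1]]) (use A(2) in simp)
  show lim: "((\<lambda>t::real. ln (?N t) / ln t) \<longlongrightarrow> real m) at_top"
    by (rule tendsto_ln_ratio[OF c'(1) ev_low A(1) ev_up])
  obtain S where S: "finite S" "card S = min_generators H" "generates H S" by (rule min_generators_attained)
  obtain K :: nat where K: "\<forall>t\<ge>0. finite (discrete_states_upto H u t) \<and> ?N t \<le> (real K * t + 1) ^ card S"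
    using card_discrete_le_generators[OF u S(1,3)] by (rule exE)
  let ?k = "min_generators H"
  have "\<forall>\<^sub>F t in at_top. ln (?N t) / ln t \<le> ln ((real K + 1) ^ ?k * t ^ ?k) / ln t"
    using ev_low eventually_gt_at_top[of 1]
  proof eventually_elim
    case (elim t)
    have "0 < c' * t ^ m" using c'(1) elim(2) by simp
    then have pos: "0 < ?N t" using elim(1) by linarith
    have "?N t \<le> (real K * t + 1) ^ ?k" using K elim(2) S(2) by simp
    also have "\<dots> \<le> ((real K + 1) * t) ^ ?k" using elim(2) by (intro power_mono) (auto simp: algebra_simps)
    finally have "?N t \<le> (real K + 1) ^ ?k * t ^ ?k" by (simp add: power_mult_distrib)
    then have "ln (?N t) \<le> ln ((real K + 1) ^ ?k * t ^ ?k)" using pos by (intro ln_mono) linarith+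
    then show ?case using elim(2) by (intro divide_right_mono) auto
  qed
  then have "real m \<le> real ?k"
    using lim tendsto_ln_const_power_ratio[of "(real K + 1) ^ ?k" ?k] by (intro tendsto_le[OF _ _ lim]) auto
  then show "m \<le> ?k" by simp
qed

text \<open>The sandwich with exponent 0, between 1 and the number of extremal states; the summand 1
  in \<open>?E\<close> keeps the upper constant positive.\<close>

lemma tendsto_growth_finite:
  assumes u: "hoop_unit H u" and fin: "finite (extremal_states H u)"
    and ne: "\<forall>\<^sub>F t in at_top. discrete_states_upto H u t \<noteq> {}"
  shows "((\<lambda>t::real. ln (real (card (discrete_states_upto H u t))) / ln t) \<longlongrightarrow> 0) at_top"
proof -
  let ?N = "\<lambda>t. real (card (discrete_states_upto H u t))"
  let ?E = "real (card (extremal_states H u)) + 1"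
  have "\<forall>\<^sub>F t in at_top. 1 * t ^ 0 \<le> ?N t"
    using ne
  proof eventually_elim
    case (elim t)
    then have "0 < card (discrete_states_upto H u t)" using finite_discrete_states[OF u] by (simp add: card_gt_0_iff)
    then show ?case by simp
  qed
  moreover have "\<forall>\<^sub>F t in at_top. ?N t \<le> ?E * t ^ 0"
  proof (rule always_eventually, rule allI)
    fix t
    have "card (discrete_states_upto H u t) \<le> card (extremal_states H u)"
      using fin by (intro card_mono) (auto simp: discrete_states_upto_def)
    then show "?N t \<le> ?E * t ^ 0" by simp
  qed
  ultimately have "((\<lambda>t. ln (?N t) / ln t) \<longlongrightarrow> real 0) at_top"
    by (intro tendsto_ln_ratio[of 1 _ _ ?E]) auto
  then show ?thesis by simp
qed

lemma growth_and_dimension: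
  assumes u: "hoop_unit H u" and F: "cone_cells m F" and ne: "carrier H \<noteq> {\<one>}"
    and l: "l = (if m = 1 then 0 else int m)"
  shows "(\<forall>t. finite (discrete_states_upto H u t)) \<and>
    (\<forall>\<^sub>F t in at_top. discrete_states_upto H u t \<noteq> {}) \<and>
    ((\<lambda>t::real. ln (real (card (discrete_states_upto H u t))) / ln t) \<longlongrightarrow> of_int l) at_top \<and>
    (l = 0 \<longleftrightarrow> finite (extremal_states H u)) \<and>
    (finite (extremal_states H u) \<longleftrightarrow> has_dimension (max_spec_topology H) 0) \<and>
    (l \<noteq> 0 \<longrightarrow> 2 \<le> l \<and> l \<le> int (min_generators H) \<and>
       has_dimension (max_spec_topology H) (l - 1))"
proof -
  have m: "1 \<le> m" using u ne F by (rule cone_cells_pos)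
  have fin: "finite (extremal_states H u) \<longleftrightarrow> m = 1"
    using finite_extremal_iff[OF u] finite_base_iff[OF F m] by simp
  have ev: "\<forall>\<^sub>F t in at_top. discrete_states_upto H u t \<noteq> {}"
    by (rule eventually_discrete_states[OF u F m])
  have dim: "has_dimension (max_spec_topology H) d \<longleftrightarrow> d = int m - 1" for d
    by (rule base_has_dimension_iff[OF F m])
  show ?thesis
  proof (cases "m = 1")
    case True
    then show ?thesis
      using tendsto_growth_finite[OF u _ ev] finite_discrete_states[OF u] ev fin dim l by simp
  next
    case False
    then have "2 \<le> m" using m by simp
    then show ?thesis
      using tendsto_growth[OF u F] finite_discrete_states[OF u] ev fin dim l False m by simp
  qed
qed

end

text \<open>The one-element hoop has to be excluded: it has no states, so \<open>E_u\<close> is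
  finite, while its spectrum is empty and has dimension -1 instead of 0.\<close>

theorem theorem5p1:
  fixes H :: "'a hoop"
  assumes "cancellative_hoop H"
    and "finitely_presented H"
    and "carrier H \<noteq> {\<one>\<^bsub>H\<^esub>}"
  shows "\<exists>l::int. \<forall>u. hoop_unit H u \<longrightarrow>
    (\<forall>t. finite (discrete_states_upto H u t)) \<and>
    (\<forall>\<^sub>F t in at_top. discrete_states_upto H u t \<noteq> {}) \<and>
    ((\<lambda>t::real. ln (real (card (discrete_states_upto H u t))) / ln t) \<longlongrightarrow> of_int l) at_top \<and>
    (l = 0 \<longleftrightarrow> finite (extremal_states H u)) \<and>
    (finite (extremal_states H u) \<longleftrightarrow> has_dimension (max_spec_topology H) 0) \<and>
    (l \<noteq> 0 \<longrightarrow> 2 \<le> l \<and> l \<le> int (min_generators H) \<and>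
       has_dimension (max_spec_topology H) (l - 1))"
proof -
  obtain n R rep where "presented_hoop H n R rep"
    using finitely_presented_imp_presented_hoop[OF assms(1,2)] by (elim exE)
  then interpret presented_hoop H n R rep .
  obtain m F where F: "cone_cells m F" using cone_cells_exists by (elim exE)
  show ?thesis
  proof (rule exI[of _ "if m = 1 then 0 else int m"], rule allI, rule impI)
    fix u assume "hoop_unit H u"
    then show "(\<forall>t. finite (discrete_states_upto H u t)) \<and>
      (\<forall>\<^sub>F t in at_top. discrete_states_upto H u t \<noteq> {}) \<and>
      ((\<lambda>t::real. ln (real (card (discrete_states_upto H u t))) / ln t) \<longlongrightarrow>
         of_int (if m = 1 then 0 else int m)) at_top \<and>
      ((if m = 1 then 0 else int m) = 0 \<longleftrightarrow> finite (extremal_states H u)) \<and>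
      (finite (extremal_states H u) \<longleftrightarrow> has_dimension (max_spec_topology H) 0) \<and>
      ((if m = 1 then 0 else int m) \<noteq> 0 \<longrightarrow> 2 \<le> (if m = 1 then 0 else int m) \<and>
         (if m = 1 then 0 else int m) \<le> int (min_generators H) \<and>
         has_dimension (max_spec_topology H) ((if m = 1 then 0 else int m) - 1))"
      using F assms(3) refl by (rule growth_and_dimension)
  qed
qed

end
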